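(* Let $\tau>0$, let $(v^n_h,\xi^n_h)_{n\ge0}\subset U_h\times H_h$ be iterates of the fully-discrete scheme described in the context, with initial iterate $(v^0_h,\xi^0_h)\in U_h\times H_h$ such that $F^0_h$ is a gradient, and let $\widehat\Theta=(\widehat v,\widehat\xi)$, $\bar\Theta=(\bar v,\bar\xi)$, $\bar F_*$ be the associated interpolates defined in the context. Let $\Theta=(v,\xi)=(v,F,Z,w)$ be a smooth solution on $\mathbb{T}^3\times[0,T]$ of the extended system $$\partial_tv_i=\partial_\alpha\bigl(G_{,A}(\xi)\,\Phi^A_{,i\alpha}(F)\bigr),\qquad \partial_t\xi_A=\partial_\alpha\bigl(\Phi^A_{,i\alpha}(F)\,v_i\bigr),$$ with $F(\cdot,0)$ a gradient. Let $$\eta^r(x,t)=\eta(\widehat\Theta)-\eta(\Theta)-D\eta(\Theta)(\widehat\Theta-\Theta),\qquad \eta(v,\xi)=\tfrac12|v|^2+G(\xi).$$ Then for a.e. $t\in[0,T]$ $$\int_{\mathbb{T}^3}\partial_t\eta^r(x,t)\,dx=\int_{\mathbb{T}^3}\Bigl(-\frac1\tau D+Q+E+\bar E\Bigr)dx,$$ where $$\begin{aligned}Q&=\partial_\alpha(G_{,A}(\xi))\bigl(\Phi^A_{,i\alpha}(\widehat F)-\Phi^A_{,i\alpha}(F)\bigr)(\widehat v_i-v_i)\\&\quad+\partial_\alpha v_i\bigl(G_{,A}(\widehat\xi)-G_{,A}(\xi)\bigr)\bigl(\Phi^A_{,i\alpha}(\widehat F)-\Phi^A_{,i\alpha}(F)\bigr)\\&\quad+\partial_\alpha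 v_i\bigl(G_{,A}(\widehat\xi)-G_{,A}(\xi)-G_{,AB}(\xi)(\widehat\xi-\xi)_B\bigr)\Phi^A_{,i\alpha}(F),\end{aligned}$$ $$D=\sum_{n=1}^\infty\chi^n(t)D^n,\qquad D^n=\bigl(\nabla\eta(\bar\Theta)-\nabla\eta(\widehat\Theta)\bigr)\cdot\delta\Theta^n,\qquad \delta\Theta^n=(v^n_h-v^{n-1}_h,\;\xi^n_h-\xi^{n-1}_h),$$ $$\begin{aligned}E&=\partial_\alpha(G_{,A}(\xi))\Bigl[\Phi^A_{,i\alpha}(F)(\bar v_i-\widehat v_i)+\bigl(\Phi^A_{,i\alpha}(\widehat F)-\Phi^A_{,i\alpha}(F)\bigr)(\bar v_i-\widehat v_i)\\&\qquad\quad+\bigl(\Phi^A_{,i\alpha}(\bar F_* )-\Phi^A_{,i\alpha}(\widehat F)\bigr)(\bar v_i-\widehat v_i)+\bigl(\Phi^A_{,i\alpha}(\bar F_* )-\Phi^A_{,i\alpha}(\widehat F)\bigr)(\widehat v_i-v_i)\Bigr]\\&\quad+\partial_\alpha v_i\Bigl[\bigl(G_{,A}(\bar\xi)-G_{,A}(\widehat\xi)\bigr)\Phi^A_{,i\alpha}(F)+\bigl(G_{,A}(\bar\xi)-G_{,A}(\widehat\xi)\bigr)\bigl(\Phi^A_{,i\alpha}(\bar F_* )-\Phi^A_{,i\alpha}(\widehat F)\bigr)\\&\qquad\quad+\bigl(G_{,A}(\bar\xi)-G_{,A}(\widehat\xi)\bigr)\bigl(\Phi^A_{,i\alpha}(\widehat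 F)-\Phi^A_{,i\alpha}(F)\bigr)+\bigl(G_{,A}(\widehat\xi)-G_{,A}(\xi)\bigr)\bigl(\Phi^A_{,i\alpha}(\bar F_* )-\Phi^A_{,i\alpha}(\widehat F)\bigr)\Bigr],\end{aligned}$$ $$\bar E=G_{,A}(\bar\xi)\,\Phi^A_{,i\alpha}(\bar F_* )\,\partial_\alpha\bigl((\mathbb{P}^Uv)_i-v_i\bigr).$$
   Context: $\mathbb{T}^3$ is the three-dimensional torus; $M^{3\times3}$ is the space of real $3\times 3$ matrices. Indices $i,j,k,\alpha,\beta,\gamma$ (as tensor indices) run over $1,2,3$ and $A,B$ over $1,\dots,19$; repeated indices are summed. $\Phi:M^{3\times3}\to\mathbb{R}^{19}$, $\Phi(F)=(F,\mathrm{cof}\,F,\det F)$, where $(\mathrm{cof}\,F)_{i\alpha}=\tfrac12\varepsilon_{ijk}\varepsilon_{\alpha\beta\gamma}F_{j\beta}F_{k\gamma}$. Notation: $\Phi^A_{,i\alpha}=\partial\Phi^A/\partial F_{i\alpha}$, $G_{,A}=\partial G/\partial\xi_A$, $G_{,AB}=\partial^2G/\partial\xi_A\partial\xi_B$; $\xi=(F,Z,w)\in\mathbb{R}^{19}$, and $\widehat F,\bar F$ denote the $F$-components of $\widehat\xi,\bar\xi$. A matrix field $F$ on $\mathbb{T}^3$ (identified with a periodic field on $\mathbb{R}^3$) is a gradient if $F=\nabla y$, i.e. $F_{i\alpha}=\partial_\alpha y_i$, for some weakly differentiable $y:\mathbb{R}^3\to\mathbb{R}^3$. Assumptions on $G$: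 $G=G(\xi)=G(F,Z,w):M^{3\times3}\times M^{3\times3}\times\mathbb{R}\cong\mathbb{R}^{19}\to[0,\infty)$ is $C^3$, uniformly convex, and, for some $p\in(6,\infty)$ and positive constants $\kappa,\kappa',\gamma,\gamma',c_1,\dots,c_8$: - $G(\xi)=H(F)+R(\xi)$ with $H\in C^3(M^{3\times3};[0,\infty))$ and $R\in C^3(\mathbb{R}^{19};[0,\infty))$ strictly convex, $\kappa|F|^{p-2}|z|^2\le z^T\nabla^2H(F)z\le\kappa'|F|^{p-2}|z|^2$ for all $z\in\mathbb{R}^9$, and $\gamma I\le\nabla^2R\le\gamma' I$; - $G(\xi)\ge c_1|F|^p+c_2|Z|^2+c_3|w|^2-c_4$; - $G(\xi)\le c_5(|F|^p+|Z|^2+|w|^2+1)$; - $|G_F|^{p/(p-1)}+|G_Z|^{p/(p-2)}+|G_w|^{p/(p-3)}\le c_6(|F|^p+|Z|^2+|w|^2+1)$; - $|\partial^3H/\partial F_{i\alpha}\partial F_{ml}\partial F_{rs}|\le c_7|F|^{p-3}$ and $|\partial^3R/\partial\xi_A\partial\xi_B\partial\xi_D|\le c_8$. Finite element spaces: $\mathcal{T}_h=\mathcal{T}_h(\mathbb{T}^3)$ is a (finite, conforming, simplicial) triangulation of $\mathbb{T}^3$ with elements $K$, $k\ge1$ is an integer, $\mathcal{P}_m(K)$ is the space of polynomials on $K$ of total degree at most $m$, and $U_h=\{\varphi\in C(\mathbb{T}^3;\mathbb{R}^3):\varphi|_K\in[\mathcal{P}_k(K)]^3\ \forall K\in\mathcal{T}_h\}$,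 $H^F_h=\{A\in L^2(\mathbb{T}^3;M^{3\times3}):A|_K\in[\mathcal{P}_{k-1}(K)]^9\ \forall K\}$, $H^Z_h=\{B\in L^2(\mathbb{T}^3;M^{3\times3}):B|_K\in[\mathcal{P}_{2(k-1)}(K)]^9\ \forall K\}$, $H^w_h=\{d\in L^2(\mathbb{T}^3):d|_K\in\mathcal{P}_{3(k-1)}(K)\ \forall K\}$, and $H_h=H^F_h\times H^Z_h\times H^w_h$. $\mathbb{P}^U:L^2(\mathbb{T}^3;\mathbb{R}^3)\to U_h$ is the $L^2$-orthogonal projector. Fully-discrete scheme: for each $n\ge1$, given $(v^{n-1}_h,\xi^{n-1}_h)\in U_h\times H_h$ with $\xi^{n-1}_h=(F^{n-1}_h,Z^{n-1}_h,w^{n-1}_h)$, the iterate $(v^n_h,\xi^n_h)\in U_h\times H_h$ satisfies $$\int_{\mathbb{T}^3}\frac{v^n_{i,h}-v^{n-1}_{i,h}}{\tau}\,\varphi^i_h\,dx=-\int_{\mathbb{T}^3}G_{,A}(\xi^n_h)\,\Phi^A_{,i\alpha}(F^{n-1}_h)\,\partial_\alpha\varphi^i_h\,dx\quad\forall\varphi_h\in U_h,$$ $$\int_{\mathbb{T}^3}\frac{\xi^n_{A,h}-\xi^{n-1}_{A,h}}{\tau}\,\psi^A_h\,dx=\int_{\mathbb{T}^3}\Phi^A_{,i\alpha}(F^{n-1}_h)\,\partial_\alpha v^n_{i,h}\,\psi^A_h\,dx\quad\forall\psi_h\in H_h.$$ Interpolates: with $\chi^n(t)$ the characteristic function of $[(n-1)\tau,n\tau)$,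 $$\widehat v(t)=\sum_{n\ge1}\chi^n(t)\Bigl(v^{n-1}_h+\tfrac{t-\tau(n-1)}{\tau}(v^n_h-v^{n-1}_h)\Bigr),\quad \widehat\xi(t)=(\widehat F,\widehat Z,\widehat w)(t)=\sum_{n\ge1}\chi^n(t)\Bigl(\xi^{n-1}_h+\tfrac{t-\tau(n-1)}{\tau}(\xi^n_h-\xi^{n-1}_h)\Bigr),$$ $$\bar v(t)=\sum_{n\ge1}\chi^n(t)v^n_h,\qquad\bar\xi(t)=(\bar F,\bar Z,\bar w)(t)=\sum_{n\ge1}\chi^n(t)\xi^n_h,\qquad\bar F_*(t)=\sum_{n\ge1}\chi^n(t)F^{n-1}_h.$$ *)

theory Defs
  imports "HOL-Analysis.Analysis"
begin

section \<open>Differentiation\<close>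

definition pd :: "'a::euclidean_space \<Rightarrow> ('a \<Rightarrow> 'b::real_normed_vector) \<Rightarrow> 'a \<Rightarrow> 'b" where
  "pd b f x = frechet_derivative f (at x) b"

definition grad :: "('a::euclidean_space \<Rightarrow> real) \<Rightarrow> 'a \<Rightarrow> 'a" where
  "grad f x = (\<Sum>b\<in>Basis. pd b f x *\<^sub>R b)"

definition hess :: "('a::euclidean_space \<Rightarrow> real) \<Rightarrow> 'a \<Rightarrow> 'a \<Rightarrow> real" where
  "hess f x z = (\<Sum>a\<in>Basis. \<Sum>b\<in>Basis. (z \<bullet> a) * pd a (pd b f) x * (z \<bullet> b))"

text \<open>Derivatives are taken within the set \<open>S\<close>. This is meant for sets on which they are unique:
  open sets, and \<open>{0..T} \<times> UNIV\<close> with \<open>T > 0\<close>, where they are one-sided at the end times.\<close>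

fun Ck_on :: "nat \<Rightarrow> 'a::euclidean_space set \<Rightarrow> ('a \<Rightarrow> 'b::real_normed_vector) \<Rightarrow> bool" where
  "Ck_on 0 S f \<longleftrightarrow> continuous_on S f"
| "Ck_on (Suc k) S f \<longleftrightarrow> f differentiable_on S \<and>
     (\<forall>b\<in>Basis. Ck_on k S (\<lambda>x. frechet_derivative f (at x within S) b))"

definition smooth_on :: "'a::euclidean_space set \<Rightarrow> ('a \<Rightarrow> 'b::real_normed_vector) \<Rightarrow> bool" where
  "smooth_on S f \<longleftrightarrow> (\<forall>k. Ck_on k S f)"

definition strictly_convex :: "('a::real_vector \<Rightarrow> real) \<Rightarrow> bool" where
  "strictly_convex f \<longleftrightarrow> (\<forall>x y u. x \<noteq> y \<longrightarrow> 0 < u \<longrightarrow> u < 1 \<longrightarrow>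
     f ((1 - u) *\<^sub>R x + u *\<^sub>R y) < (1 - u) * f x + u * f y)"

definition uniformly_convex :: "('a::euclidean_space \<Rightarrow> real) \<Rightarrow> bool" where
  "uniformly_convex f \<longleftrightarrow> (\<exists>c>0. \<forall>x z. c * (norm z)\<^sup>2 \<le> hess f x z)"

section \<open>The map \<open>\<Phi>\<close> and the stored energy\<close>

text \<open>The entry \<open>F\<^sub>i\<^sub>\<alpha>\<close> is \<open>F $ i $ \<alpha>\<close>. The index \<open>A = 1, \<dots>, 19\<close> is rendered as a basis element
  \<open>A \<in> Basis\<close> of the 19-dimensional space \<open>xi_vec\<close>, with \<open>\<xi>\<^sub>A = \<xi> \<bullet> A\<close>.\<close>

type_synonym mat3 = "real^3^3"
type_synonym xi_vec = "mat3 \<times> mat3 \<times> real"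
type_synonym state = "(real^3) \<times> xi_vec"

definition levi_civita :: "3 \<Rightarrow> 3 \<Rightarrow> 3 \<Rightarrow> real" where
  "levi_civita i j k =
     (if (i, j, k) \<in> {(1, 2, 3), (2, 3, 1), (3, 1, 2)} then 1
      else if (i, j, k) \<in> {(3, 2, 1), (1, 3, 2), (2, 1, 3)} then - 1
      else 0)"

definition cof :: "mat3 \<Rightarrow> mat3" where
  "cof F = (\<chi> i \<alpha>. 1 / 2 * (\<Sum>j\<in>UNIV. \<Sum>k\<in>UNIV. \<Sum>\<beta>\<in>UNIV. \<Sum>\<gamma>\<in>UNIV.
     levi_civita i j k * levi_civita \<alpha> \<beta> \<gamma> * F $ j $ \<beta> * F $ k $ \<gamma>))"

definition Phi :: "mat3 \<Rightarrow> xi_vec" where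
  "Phi F = (F, cof F, det F)"

definition dPhi :: "xi_vec \<Rightarrow> 3 \<Rightarrow> 3 \<Rightarrow> mat3 \<Rightarrow> real" where
  "dPhi A i \<alpha> = pd (axis i (axis \<alpha> 1)) (\<lambda>F. Phi F \<bullet> A)"

definition energy_assms :: "(xi_vec \<Rightarrow> real) \<Rightarrow> bool" where
  "energy_assms G \<longleftrightarrow>
     Ck_on 3 UNIV G \<and> (\<forall>\<xi>. 0 \<le> G \<xi>) \<and> uniformly_convex G \<and>
     (\<exists>p \<kappa> \<kappa>' \<gamma> \<gamma>' c1 c2 c3 c4 c5 c6 c7 c8 :: real.
      \<exists>(H :: mat3 \<Rightarrow> real) (R :: xi_vec \<Rightarrow> real).
        6 < p \<and> 0 < \<kappa> \<and> 0 < \<kappa>' \<and> 0 < \<gamma> \<and> 0 < \<gamma>' \<and>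
        0 < c1 \<and> 0 < c2 \<and> 0 < c3 \<and> 0 < c4 \<and> 0 < c5 \<and> 0 < c6 \<and> 0 < c7 \<and> 0 < c8 \<and>
        Ck_on 3 UNIV H \<and> (\<forall>F. 0 \<le> H F) \<and>
        Ck_on 3 UNIV R \<and> (\<forall>\<xi>. 0 \<le> R \<xi>) \<and> strictly_convex R \<and>
        (\<forall>F Z w. G (F, Z, w) = H F + R (F, Z, w)) \<and>
        (\<forall>F z. \<kappa> * norm F powr (p - 2) * (norm z)\<^sup>2 \<le> hess H F z \<and>
               hess H F z \<le> \<kappa>' * norm F powr (p - 2) * (norm z)\<^sup>2) \<and>
        (\<forall>\<xi> z. \<gamma> * (norm z)\<^sup>2 \<le> hess R \<xi> z \<and> hess R \<xi> z \<le> \<gamma>' * (norm z)\<^sup>2) \<and>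
        (\<forall>F Z w. c1 * norm F powr p + c2 * (norm Z)\<^sup>2 + c3 * \<bar>w\<bar>\<^sup>2 - c4 \<le> G (F, Z, w)) \<and>
        (\<forall>F Z w. G (F, Z, w) \<le> c5 * (norm F powr p + (norm Z)\<^sup>2 + \<bar>w\<bar>\<^sup>2 + 1)) \<and>
        (\<forall>F Z w. norm (grad (\<lambda>F'. G (F', Z, w)) F) powr (p / (p - 1))
               + norm (grad (\<lambda>Z'. G (F, Z', w)) Z) powr (p / (p - 2))
               + norm (grad (\<lambda>w'. G (F, Z, w')) w) powr (p / (p - 3))
               \<le> c6 * (norm F powr p + (norm Z)\<^sup>2 + \<bar>w\<bar>\<^sup>2 + 1)) \<and>
        (\<forall>F. \<forall>a\<in>Basis. \<forall>b\<in>Basis. \<forall>c\<in>Basis.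
               \<bar>pd a (pd b (pd c H)) F\<bar> \<le> c7 * norm F powr (p - 3)) \<and>
        (\<forall>\<xi>. \<forall>a\<in>Basis. \<forall>b\<in>Basis. \<forall>d\<in>Basis. \<bar>pd a (pd b (pd d R)) \<xi>\<bar> \<le> c8))"

definition eta :: "(xi_vec \<Rightarrow> real) \<Rightarrow> state \<Rightarrow> real" where
  "eta G = (\<lambda>(v, \<xi>). 1 / 2 * (norm v)\<^sup>2 + G \<xi>)"

section \<open>Fields on the torus\<close>

text \<open>The torus is \<open>\<real>\<^sup>3 / \<int>\<^sup>3\<close>. Fields on it are \<open>\<int>\<^sup>3\<close>-periodic functions on \<open>\<real>\<^sup>3\<close>, and
  integrals over it are Lebesgue integrals over the closed unit cube.\<close>

definition lattice3 :: "(real^3) set" where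
  "lattice3 = {z. \<forall>i. z $ i \<in> \<int>}"

abbreviation torus :: "(real^3) measure" where
  "torus \<equiv> lebesgue_on (cbox 0 1)"

definition periodic :: "(real^3 \<Rightarrow> 'a) \<Rightarrow> bool" where
  "periodic f \<longleftrightarrow> (\<forall>x. \<forall>z\<in>lattice3. f (x + z) = f x)"

definition L2_torus :: "(real^3 \<Rightarrow> 'a::euclidean_space) set" where
  "L2_torus = {f. periodic f \<and> f \<in> borel_measurable torus \<and> integrable torus (\<lambda>x. (norm (f x))\<^sup>2)}"

definition test_function :: "(real^3 \<Rightarrow> real) \<Rightarrow> bool" where
  "test_function \<phi> \<longleftrightarrow> smooth_on UNIV \<phi> \<and> compact (closure {x. \<phi> x \<noteq> 0})"

definition locally_integrable :: "(real^3 \<Rightarrow> real) \<Rightarrow> bool" where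
  "locally_integrable f \<longleftrightarrow> (\<forall>K. compact K \<longrightarrow> set_integrable lebesgue K f)"

definition has_weak_pd :: "3 \<Rightarrow> (real^3 \<Rightarrow> real) \<Rightarrow> (real^3 \<Rightarrow> real) \<Rightarrow> bool" where
  "has_weak_pd \<alpha> u g \<longleftrightarrow> locally_integrable u \<and> locally_integrable g \<and>
     (\<forall>\<phi>. test_function \<phi> \<longrightarrow>
        (LINT x|lebesgue. u x * pd (axis \<alpha> 1) \<phi> x) = - (LINT x|lebesgue. g x * \<phi> x))"

definition is_gradient :: "(real^3 \<Rightarrow> mat3) \<Rightarrow> bool" where
  "is_gradient F \<longleftrightarrow> (\<exists>y :: real^3 \<Rightarrow> real^3. \<forall>i \<alpha>. has_weak_pd \<alpha> (\<lambda>x. y x $ i) (\<lambda>x. F x $ i $ \<alpha>))"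

section \<open>Finite element spaces\<close>

text \<open>A triangulation of the torus is given by its lift to \<open>\<real>\<^sup>3\<close>: a face-to-face covering by
  nondegenerate tetrahedra that consists of the lattice translates of finitely many of them.\<close>

definition torus_triangulation :: "(real^3) set set \<Rightarrow> bool" where
  "torus_triangulation \<T> \<longleftrightarrow>
     (\<exists>\<S>. finite \<S> \<and> \<T> = {(+) z ` K | z K. z \<in> lattice3 \<and> K \<in> \<S>}) \<and>
     (\<forall>K\<in>\<T>. 3 simplex K) \<and>
     (\<forall>K\<in>\<T>. \<forall>K'\<in>\<T>. (K \<inter> K') face_of K \<and> (K \<inter> K') face_of K') \<and>
     \<Union>\<T> = UNIV"

definition polys :: "nat \<Rightarrow> (real^3 \<Rightarrow> real) set" where
  "polys m = {q. \<exists>c :: nat^3 \<Rightarrow> real. \<forall>x.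
     q x = (\<Sum>a\<in>{a. (\<Sum>i\<in>UNIV. a $ i) \<le> m}. c a * (\<Prod>i\<in>UNIV. (x $ i) ^ (a $ i)))}"

definition U_space :: "(real^3) set set \<Rightarrow> nat \<Rightarrow> (real^3 \<Rightarrow> real^3) set" where
  "U_space \<T> k = {\<phi>. periodic \<phi> \<and> continuous_on UNIV \<phi> \<and>
     (\<forall>K\<in>\<T>. \<forall>i. \<exists>q\<in>polys k. \<forall>x\<in>K. \<phi> x $ i = q x)}"

text \<open>Elements of the discontinuous spaces are \<open>L\<^sup>2\<close> functions, so their restriction to an element is
  a polynomial only almost everywhere. Requiring this at every point of the closed elements would
  force continuity across their common faces.\<close>

definition DG_space :: "(real^3) set set \<Rightarrow> nat \<Rightarrow> (real^3 \<Rightarrow> 'a::euclidean_space) set" where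
  "DG_space \<T> m = {f \<in> L2_torus.
     \<forall>K\<in>\<T>. \<forall>b\<in>Basis. \<exists>q\<in>polys m. AE x in lebesgue_on K. f x \<bullet> b = q x}"

definition H_space :: "(real^3) set set \<Rightarrow> nat \<Rightarrow> (real^3 \<Rightarrow> xi_vec) set" where
  "H_space \<T> k = {\<xi>. (\<lambda>x. fst (\<xi> x)) \<in> DG_space \<T> (k - 1) \<and>
     (\<lambda>x. fst (snd (\<xi> x))) \<in> DG_space \<T> (2 * (k - 1)) \<and>
     (\<lambda>x. snd (snd (\<xi> x))) \<in> DG_space \<T> (3 * (k - 1))}"

definition L2_proj :: "(real^3 \<Rightarrow> real^3) set \<Rightarrow> (real^3 \<Rightarrow> real^3) \<Rightarrow> real^3 \<Rightarrow> real^3" where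
  "L2_proj U f = (THE u. u \<in> U \<and> (\<forall>\<phi>\<in>U. (LINT x|torus. (f x - u x) \<bullet> \<phi> x) = 0))"

section \<open>Scheme, interpolates and smooth solutions\<close>

text \<open>The functions in \<open>U_space\<close> are continuous and piecewise polynomial, so their weak derivatives
  agree almost everywhere with the classical ones used here.\<close>

definition scheme ::
  "(xi_vec \<Rightarrow> real) \<Rightarrow> (real^3) set set \<Rightarrow> nat \<Rightarrow> real \<Rightarrow>
   (nat \<Rightarrow> real^3 \<Rightarrow> real^3) \<Rightarrow> (nat \<Rightarrow> real^3 \<Rightarrow> xi_vec) \<Rightarrow> bool" where
  "scheme G \<T> k \<tau> vh \<xi>h \<longleftrightarrow>
     (\<forall>n. vh n \<in> U_space \<T> k \<and> \<xi>h n \<in> H_space \<T> k) \<and>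
     (\<forall>n\<ge>1.
       (\<forall>\<phi>\<in>U_space \<T> k.
          (LINT x|torus. (\<Sum>i\<in>UNIV. (vh n x $ i - vh (n - 1) x $ i) / \<tau> * \<phi> x $ i))
          = - (LINT x|torus. (\<Sum>A\<in>Basis. \<Sum>i\<in>UNIV. \<Sum>\<alpha>\<in>UNIV.
                pd A G (\<xi>h n x) * dPhi A i \<alpha> (fst (\<xi>h (n - 1) x))
                * pd (axis \<alpha> 1) (\<lambda>x. \<phi> x $ i) x))) \<and>
       (\<forall>\<psi>\<in>H_space \<T> k.
          (LINT x|torus. (\<Sum>A\<in>Basis. (\<xi>h n x \<bullet> A - \<xi>h (n - 1) x \<bullet> A) / \<tau> * (\<psi> x \<bullet> A)))
          = (LINT x|torus. (\<Sum>A\<in>Basis. \<Sum>i\<in>UNIV. \<Sum>\<alpha>\<in>UNIV.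
                dPhi A i \<alpha> (fst (\<xi>h (n - 1) x))
                * pd (axis \<alpha> 1) (\<lambda>x. vh n x $ i) x * (\<psi> x \<bullet> A)))))"

definition chi :: "real \<Rightarrow> nat \<Rightarrow> real \<Rightarrow> real" where
  "chi \<tau> n t = indicat_real {(real n - 1) * \<tau> ..< real n * \<tau>} t"

text \<open>The sums over \<open>n \<ge> 1\<close> are reindexed by \<open>Suc n\<close>; at each time at most one term is nonzero.\<close>

definition hat_interp ::
  "real \<Rightarrow> (nat \<Rightarrow> real^3 \<Rightarrow> 'a::real_normed_vector) \<Rightarrow> real \<Rightarrow> real^3 \<Rightarrow> 'a" where
  "hat_interp \<tau> f t x = (\<Sum>n. chi \<tau> (Suc n) t *\<^sub>R
     (f n x + ((t - \<tau> * real n) / \<tau>) *\<^sub>R (f (Suc n) x - f n x)))"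

definition bar_interp ::
  "real \<Rightarrow> (nat \<Rightarrow> real^3 \<Rightarrow> 'a::real_normed_vector) \<Rightarrow> real \<Rightarrow> real^3 \<Rightarrow> 'a" where
  "bar_interp \<tau> f t x = (\<Sum>n. chi \<tau> (Suc n) t *\<^sub>R f (Suc n) x)"

definition lag_interp ::
  "real \<Rightarrow> (nat \<Rightarrow> real^3 \<Rightarrow> 'a::real_normed_vector) \<Rightarrow> real \<Rightarrow> real^3 \<Rightarrow> 'a" where
  "lag_interp \<tau> f t x = (\<Sum>n. chi \<tau> (Suc n) t *\<^sub>R f n x)"

definition smooth_solution ::
  "(xi_vec \<Rightarrow> real) \<Rightarrow> real \<Rightarrow> (real \<Rightarrow> real^3 \<Rightarrow> real^3) \<Rightarrow> (real \<Rightarrow> real^3 \<Rightarrow> xi_vec) \<Rightarrow> bool" where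
  "smooth_solution G T v \<xi> \<longleftrightarrow>
     smooth_on ({0..T} \<times> UNIV) (\<lambda>(t, x). v t x) \<and>
     smooth_on ({0..T} \<times> UNIV) (\<lambda>(t, x). \<xi> t x) \<and>
     (\<forall>t\<in>{0..T}. periodic (v t) \<and> periodic (\<xi> t)) \<and>
     (\<forall>t\<in>{0..T}. \<forall>x.
       (\<forall>i. ((\<lambda>s. v s x $ i) has_real_derivative
          (\<Sum>\<alpha>\<in>UNIV. pd (axis \<alpha> 1)
             (\<lambda>y. \<Sum>A\<in>Basis. pd A G (\<xi> t y) * dPhi A i \<alpha> (fst (\<xi> t y))) x)) (at t within {0..T})) \<and>
       (\<forall>A\<in>Basis. ((\<lambda>s. \<xi> s x \<bullet> A) has_real_derivative
          (\<Sum>\<alpha>\<in>UNIV. pd (axis \<alpha> 1)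
             (\<lambda>y. \<Sum>i\<in>UNIV. dPhi A i \<alpha> (fst (\<xi> t y)) * v t y $ i) x)) (at t within {0..T})))"

section \<open>Relative entropy identity\<close>

definition eta_rel :: "(xi_vec \<Rightarrow> real) \<Rightarrow> state \<Rightarrow> state \<Rightarrow> real" where
  "eta_rel G \<Theta>' \<Theta> = eta G \<Theta>' - eta G \<Theta> - frechet_derivative (eta G) (at \<Theta>) (\<Theta>' - \<Theta>)"

text \<open>In the next three definitions \<open>v\<close>, \<open>\<xi>\<close>, \<open>vhat\<close>, \dots are the fields at a fixed time.\<close>

definition Q_term ::
  "(xi_vec \<Rightarrow> real) \<Rightarrow> (real^3 \<Rightarrow> real^3) \<Rightarrow> (real^3 \<Rightarrow> xi_vec) \<Rightarrow>
   (real^3 \<Rightarrow> real^3) \<Rightarrow> (real^3 \<Rightarrow> xi_vec) \<Rightarrow> real^3 \<Rightarrow> real" where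
  "Q_term G v \<xi> vhat \<xi>hat x = (\<Sum>A\<in>Basis. \<Sum>i\<in>UNIV. \<Sum>\<alpha>\<in>UNIV.
      pd (axis \<alpha> 1) (\<lambda>y. pd A G (\<xi> y)) x
        * (dPhi A i \<alpha> (fst (\<xi>hat x)) - dPhi A i \<alpha> (fst (\<xi> x))) * (vhat x $ i - v x $ i)
    + pd (axis \<alpha> 1) (\<lambda>y. v y $ i) x
        * (pd A G (\<xi>hat x) - pd A G (\<xi> x))
        * (dPhi A i \<alpha> (fst (\<xi>hat x)) - dPhi A i \<alpha> (fst (\<xi> x)))
    + pd (axis \<alpha> 1) (\<lambda>y. v y $ i) x
        * (pd A G (\<xi>hat x) - pd A G (\<xi> x)
           - (\<Sum>B\<in>Basis. pd B (pd A G) (\<xi> x) * ((\<xi>hat x - \<xi> x) \<bullet> B)))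
        * dPhi A i \<alpha> (fst (\<xi> x)))"

definition E_term ::
  "(xi_vec \<Rightarrow> real) \<Rightarrow> (real^3 \<Rightarrow> real^3) \<Rightarrow> (real^3 \<Rightarrow> xi_vec) \<Rightarrow>
   (real^3 \<Rightarrow> real^3) \<Rightarrow> (real^3 \<Rightarrow> xi_vec) \<Rightarrow>
   (real^3 \<Rightarrow> real^3) \<Rightarrow> (real^3 \<Rightarrow> xi_vec) \<Rightarrow> (real^3 \<Rightarrow> mat3) \<Rightarrow> real^3 \<Rightarrow> real" where
  "E_term G v \<xi> vhat \<xi>hat vbar \<xi>bar Fstar x = (\<Sum>A\<in>Basis. \<Sum>i\<in>UNIV. \<Sum>\<alpha>\<in>UNIV.
      pd (axis \<alpha> 1) (\<lambda>y. pd A G (\<xi> y)) x *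
        (dPhi A i \<alpha> (fst (\<xi> x)) * (vbar x $ i - vhat x $ i)
         + (dPhi A i \<alpha> (fst (\<xi>hat x)) - dPhi A i \<alpha> (fst (\<xi> x))) * (vbar x $ i - vhat x $ i)
         + (dPhi A i \<alpha> (Fstar x) - dPhi A i \<alpha> (fst (\<xi>hat x))) * (vbar x $ i - vhat x $ i)
         + (dPhi A i \<alpha> (Fstar x) - dPhi A i \<alpha> (fst (\<xi>hat x))) * (vhat x $ i - v x $ i))
    + pd (axis \<alpha> 1) (\<lambda>y. v y $ i) x *
        ((pd A G (\<xi>bar x) - pd A G (\<xi>hat x)) * dPhi A i \<alpha> (fst (\<xi> x))
         + (pd A G (\<xi>bar x) - pd A G (\<xi>hat x))
             * (dPhi A i \<alpha> (Fstar x) - dPhi A i \<alpha> (fst (\<xi>hat x)))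
         + (pd A G (\<xi>bar x) - pd A G (\<xi>hat x))
             * (dPhi A i \<alpha> (fst (\<xi>hat x)) - dPhi A i \<alpha> (fst (\<xi> x)))
         + (pd A G (\<xi>hat x) - pd A G (\<xi> x))
             * (dPhi A i \<alpha> (Fstar x) - dPhi A i \<alpha> (fst (\<xi>hat x)))))"

definition Ebar_term ::
  "(xi_vec \<Rightarrow> real) \<Rightarrow> (real^3) set set \<Rightarrow> nat \<Rightarrow> (real^3 \<Rightarrow> real^3) \<Rightarrow>
   (real^3 \<Rightarrow> xi_vec) \<Rightarrow> (real^3 \<Rightarrow> mat3) \<Rightarrow> real^3 \<Rightarrow> real" where
  "Ebar_term G \<T> k v \<xi>bar Fstar x = (\<Sum>A\<in>Basis. \<Sum>i\<in>UNIV. \<Sum>\<alpha>\<in>UNIV.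
      pd A G (\<xi>bar x) * dPhi A i \<alpha> (Fstar x)
        * pd (axis \<alpha> 1) (\<lambda>y. L2_proj (U_space \<T> k) v y $ i - v y $ i) x)"

definition D_term ::
  "(xi_vec \<Rightarrow> real) \<Rightarrow> real \<Rightarrow> (nat \<Rightarrow> real^3 \<Rightarrow> state) \<Rightarrow> real \<Rightarrow> real^3 \<Rightarrow> real" where
  "D_term G \<tau> \<Theta>h t x = (\<Sum>n. chi \<tau> (Suc n) t *
     ((grad (eta G) (bar_interp \<tau> \<Theta>h t x) - grad (eta G) (hat_interp \<tau> \<Theta>h t x))
      \<bullet> (\<Theta>h (Suc n) x - \<Theta>h n x)))"

end

(* A continuous piecewise polynomial field is locally Lipschitz and differentiable almost everywhere,
   so integration by parts on the torus holds for it and for its products with smooth fields. The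
   equation for xi in the scheme may be tested with the difference of its two sides and therefore
   holds almost everywhere. In particular every F iterate is a gradient as soon as the first one is,
   and the null Lagrangian (Piola) identity div (Phi^A_{,i alpha}(F)) = 0 holds weakly for it; the same
   is true, pointwise, for the smooth solution. Away from the grid times the interpolates are affine
   in time and the relative entropy can be differentiated pointwise. What remains after splitting off
   -D / tau is rewritten with the momentum equation tested with vbar - P v, the orthogonality of v - P v
   to the finite element space, and the weak Piola identity tested with G_{,A}(xi) (vbar_i - v_i); the
   result agrees with Q + E + Ebar summand by summand. *)

theory Submission
  imports Defs
begin

section \<open>Partial derivatives\<close>

text \<open>The obstacle is that the iterates \<open>F\<close> jump across element faces, so the
  Piola identity cannot be obtained for them by differentiating. Its weak form is reached by
  mollification: the symmetry of the distributional derivatives survives convolution, the mollified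
  fields satisfy the identity pointwise, and bounded convergence almost everywhere passes it to the
  limit. This dictates how "gradient" is carried along: as the linear condition
  \<open>curl_free\<close>, without a potential, which for a periodic gradient need not be periodic
  itself. The test function \<open>h A y * (v1 y $ i - v y $ i)\<close> in the weak identity is only
  piecewise smooth, whence the class \<open>admissible\<close>; integration by parts for it comes
  from translation invariance of the integral, applied to difference quotients that are bounded and
  converge almost everywhere. \<open>L2_proj\<close> is a definite description, so existence and
  uniqueness of the projection precede every use of it. The exact solution is a gradient only
  initially by hypothesis; its own equation for \<open>F\<close> propagates this.\<close>

lemma pd_eqI: "(f has_derivative f') (at x) \<Longrightarrow> pd b f x = f' b"
  by (simp add: pd_def frechet_derivative_at[symmetric])

lemma has_derivative_pd: "f differentiable (at x) \<Longrightarrow> (f has_derivative (\<lambda>h. pd h f x)) (at x)"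
  unfolding pd_def by (simp flip: frechet_derivative_works)

lemma pd_const [simp]: "pd b (\<lambda>x. c) x = 0"
  using pd_eqI[OF has_derivative_const] by metis

lemma pd_add:
  "f differentiable (at x) \<Longrightarrow> g differentiable (at x) \<Longrightarrow>
    pd b (\<lambda>x. f x + g x) x = pd b f x + pd b g x"
  by (rule pd_eqI) (intro has_derivative_add has_derivative_pd)

lemma pd_diff:
  "f differentiable (at x) \<Longrightarrow> g differentiable (at x) \<Longrightarrow>
    pd b (\<lambda>x. f x - g x) x = pd b f x - pd b g x"
  by (rule pd_eqI) (intro has_derivative_diff has_derivative_pd)

lemma pd_sum:
  "(\<And>i. i \<in> I \<Longrightarrow> f i differentiable (at x)) \<Longrightarrow>
    pd b (\<lambda>x. \<Sum>i\<in>I. f i x) x = (\<Sum>i\<in>I. pd b (f i) x)"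
  by (rule pd_eqI) (intro has_derivative_sum has_derivative_pd)

lemma pd_mult:
  fixes f g :: "'a::euclidean_space \<Rightarrow> real"
  assumes "f differentiable (at x)" "g differentiable (at x)"
  shows "pd b (\<lambda>x. f x * g x) x = pd b f x * g x + f x * pd b g x"
  using pd_eqI[OF has_derivative_mult[OF has_derivative_pd[OF assms(1)] has_derivative_pd[OF assms(2)]]]
  by (simp add: add.commute)

lemma pd_bounded_linear:
  assumes "bounded_linear L" "f differentiable (at x)"
  shows "pd b (\<lambda>x. L (f x)) x = L (pd b f x)"
  by (rule pd_eqI) (intro bounded_linear.has_derivative[OF assms(1)] has_derivative_pd assms)

lemma differentiable_bounded_linear:
  assumes "bounded_linear L" "f differentiable (at x)"
  shows "(\<lambda>x. L (f x)) differentiable (at x)"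
  using assms bounded_linear.has_derivative unfolding differentiable_def by blast

lemma pd_linear_direction:
  assumes "f differentiable (at x)"
  shows "linear (\<lambda>h. pd h f x)"
  using has_derivative_pd[OF assms] has_derivative_linear by blast

lemma pd_direction_sum:
  fixes f :: "'a::euclidean_space \<Rightarrow> 'b::real_normed_vector"
  assumes "f differentiable (at x)"
  shows "pd h f x = (\<Sum>b\<in>Basis. (h \<bullet> b) *\<^sub>R pd b f x)"
proof -
  interpret linear "\<lambda>h. pd h f x" by (rule pd_linear_direction[OF assms])
  have "pd h f x = pd (\<Sum>b\<in>Basis. (h \<bullet> b) *\<^sub>R b) f x" by (simp add: euclidean_representation)
  also have "\<dots> = (\<Sum>b\<in>Basis. (h \<bullet> b) *\<^sub>R pd b f x)" by (simp add: sum scale)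
  finally show ?thesis .
qed

lemma pd_compose:
  fixes f :: "'b::euclidean_space \<Rightarrow> 'c::real_normed_vector" and g :: "'a::euclidean_space \<Rightarrow> 'b"
  assumes "g differentiable (at x)" "f differentiable (at (g x))"
  shows "pd b (\<lambda>x. f (g x)) x = pd (pd b g x) f (g x)"
  by (rule pd_eqI[OF has_derivative_compose[OF has_derivative_pd[OF assms(1)] has_derivative_pd[OF
    assms(2)]]])

lemma differentiable_cong_ev:
  assumes "f differentiable (at x)" "eventually (\<lambda>y. f y = g y) (nhds x)"
  shows "g differentiable (at x)" "pd b g x = pd b f x"
proof -
  have "(g has_derivative (\<lambda>h. pd h f x)) (at x)"
    using has_derivative_transform_eventually[OF has_derivative_pd[OF assms(1)], of g]
      assms(2) eventually_nhds_x_imp_x[OF assms(2)]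
    by (simp add: eventually_at_filter eventually_mono)
  then show "g differentiable (at x)" "pd b g x = pd b f x"
    by (auto intro: differentiableI pd_eqI)
qed

lemma pd_eq_0_outside:
  assumes "\<And>y. r < norm y \<Longrightarrow> g y = 0" "r < norm x"
  shows "pd b g x = 0"
proof -
  have "open {x::'a. r < norm x}" by (intro open_Collect_less continuous_intros)
  then have "eventually (\<lambda>y. r < norm y) (nhds x)" using assms(2) by (auto simp: eventually_nhds)
  then have "eventually (\<lambda>y. 0 = g y) (nhds x)" by eventually_elim (simp add: assms(1))
  then show ?thesis using differentiable_cong_ev(2)[of "\<lambda>_. 0" x g b] by simp
qed

text \<open>Restriction to a line, which makes the one-variable mean value theorem and the
  uniqueness of real derivatives available for \<open>pd\<close>.\<close>

lemma pd_has_real_derivative: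
  fixes f :: "'a::euclidean_space \<Rightarrow> real"
  assumes "f differentiable (at (c + u *\<^sub>R a))"
  shows "((\<lambda>u. f (c + u *\<^sub>R a)) has_real_derivative pd a f (c + u *\<^sub>R a)) (at u)"
proof -
  have 1: "((\<lambda>u. c + u *\<^sub>R a) has_derivative (\<lambda>h. h *\<^sub>R a)) (at u)"
    by (auto intro!: derivative_eq_intros)
  interpret linear "\<lambda>h. pd h f (c + u *\<^sub>R a)" by (rule pd_linear_direction[OF assms])
  show ?thesis
    using has_derivative_compose[OF 1 has_derivative_pd[OF assms]]
    by (simp add: has_field_derivative_def scale mult.commute[of _ "pd a f _"] fun_eq_iff)
qed

section \<open>Calculus of \<open>Ck_on\<close> on the whole space\<close>

lemma Ck_on_UNIV_Suc:
  "Ck_on (Suc k) UNIV f \<longleftrightarrow> (\<forall>x. f differentiable (at x)) \<and> (\<forall>b\<in>Basis. Ck_on k UNIV (pd b f))"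
  by (simp add: differentiable_on_def pd_def[abs_def])

lemma Ck_on_imp_continuous: "Ck_on k S f \<Longrightarrow> continuous_on S f"
  by (cases k) (auto intro: differentiable_imp_continuous_on)

lemma Ck_on_SucD: "Ck_on (Suc k) S f \<Longrightarrow> Ck_on k S f"
proof (induction k arbitrary: f)
  case 0
  then show ?case by (auto intro: differentiable_imp_continuous_on)
next
  case (Suc k)
  have "f differentiable_on S" "\<forall>b\<in>Basis. Ck_on (Suc k) S (\<lambda>x. frechet_derivative f (at x within S) b)"
    using Suc.prems by (simp_all only: Ck_on.simps(2)) blast+
  then show ?case using Suc.IH by simp
qed

lemma Ck_on_mono: "Ck_on m S f \<Longrightarrow> k \<le> m \<Longrightarrow> Ck_on k S f"
  by (induction m) (auto simp: le_Suc_eq simp del: Ck_on.simps dest: Ck_on_SucD)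

lemma Ck_differentiable: "Ck_on k UNIV f \<Longrightarrow> k > 0 \<Longrightarrow> f differentiable (at x)"
  by (cases k) (auto simp: differentiable_on_def)

lemma Ck_pd: "Ck_on k UNIV f \<Longrightarrow> k > 0 \<Longrightarrow> b \<in> Basis \<Longrightarrow> Ck_on (k - 1) UNIV (pd b f)"
  by (cases k) (auto simp: pd_def[abs_def])

lemma Ck_const: "Ck_on k UNIV (\<lambda>x. c)"
proof (induction k arbitrary: c)
  case (Suc k)
  have "pd b (\<lambda>x::'a. c) = (\<lambda>x. 0)" for b by auto
  with Suc show ?case by (simp add: Ck_on_UNIV_Suc del: Ck_on.simps(2))
qed auto

lemma Ck_bounded_linear:
  assumes L: "bounded_linear L" and "Ck_on k UNIV f"
  shows "Ck_on k UNIV (\<lambda>x. L (f x))"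
  using assms(2)
proof (induction k arbitrary: f)
  case 0
  then show ?case by (auto intro!: bounded_linear.continuous_on[OF L])
next
  case (Suc k)
  have d: "f differentiable (at x)" for x using Suc.prems by (auto simp: Ck_on_UNIV_Suc simp del:
    Ck_on.simps(2))
  have "pd b (\<lambda>x. L (f x)) = (\<lambda>x. L (pd b f x))" for b
    by (rule ext) (rule pd_bounded_linear[OF L d])
  with Suc d show ?case
    by (auto simp: Ck_on_UNIV_Suc differentiable_bounded_linear[OF L d] simp del: Ck_on.simps(2))
qed

lemma Ck_add:
  assumes "Ck_on k UNIV f" "Ck_on k UNIV g"
  shows "Ck_on k UNIV (\<lambda>x. f x + g x)"
  using assms
proof (induction k arbitrary: f g)
  case 0
  then show ?case by (auto intro!: continuous_intros)
next
  case (Suc k)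
  have d: "f differentiable (at x)" "g differentiable (at x)" for x
    using Suc.prems by (auto simp: Ck_on_UNIV_Suc simp del: Ck_on.simps(2))
  have "pd b (\<lambda>x. f x + g x) = (\<lambda>x. pd b f x + pd b g x)" for b
    by (rule ext) (rule pd_add[OF d])
  with Suc d show ?case
    by (auto simp: Ck_on_UNIV_Suc simp del: Ck_on.simps(2))
qed

lemma Ck_sum:
  assumes "\<And>i. i \<in> I \<Longrightarrow> Ck_on k UNIV (f i)"
  shows "Ck_on k UNIV (\<lambda>x. \<Sum>i\<in>I. f i x)"
  using assms by (induction I rule: infinite_finite_induct) (auto intro: Ck_add Ck_const)

lemma Ck_mult:
  fixes f g :: "'a::euclidean_space \<Rightarrow> real"
  assumes "Ck_on k UNIV f" "Ck_on k UNIV g"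
  shows "Ck_on k UNIV (\<lambda>x. f x * g x)"
  using assms
proof (induction k arbitrary: f g)
  case 0
  then show ?case by (auto intro!: continuous_intros)
next
  case (Suc k)
  have d: "f differentiable (at x)" "g differentiable (at x)" for x
    using Suc.prems by (auto simp: Ck_on_UNIV_Suc simp del: Ck_on.simps(2))
  have "pd b (\<lambda>x. f x * g x) = (\<lambda>x. pd b f x * g x + f x * pd b g x)" for b
    by (rule ext) (rule pd_mult[OF d])
  moreover have "Ck_on k UNIV f" "Ck_on k UNIV g" using Suc.prems Ck_on_SucD by blast+
  ultimately show ?case using Suc d
    by (auto simp: Ck_on_UNIV_Suc intro!: Ck_add simp del: Ck_on.simps(2))
qed

lemma Ck_cmult: "Ck_on k UNIV f \<Longrightarrow> Ck_on k UNIV (\<lambda>x. c * f x)" for c :: real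
  by (rule Ck_mult[OF Ck_const])

lemma Ck_diff:
  fixes f g :: "'a::euclidean_space \<Rightarrow> real"
  assumes "Ck_on k UNIV f" "Ck_on k UNIV g"
  shows "Ck_on k UNIV (\<lambda>x. f x - g x)"
  using Ck_add[OF assms(1) Ck_cmult[OF assms(2), of "-1"]] by simp

text \<open>The chain rule is expanded in the basis, so that continuity of the partial derivatives
  of the composite reduces to that of its factors. It is meant for \<open>pd A G\<close> along the
  exact solution.\<close>

lemma C1_compose:
  fixes f :: "'b::euclidean_space \<Rightarrow> real" and g :: "'a::euclidean_space \<Rightarrow> 'b"
  assumes "Ck_on (Suc 0) UNIV f" "Ck_on (Suc 0) UNIV g"
  shows "Ck_on (Suc 0) UNIV (\<lambda>x. f (g x))"
proof -
  have d: "f differentiable (at y)" "g differentiable (at x)" for x y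
    using assms by (auto simp: Ck_on_UNIV_Suc simp del: Ck_on.simps(2))
  have c: "continuous_on UNIV (pd b f)" "continuous_on UNIV (pd c g)" if "b \<in> Basis" "c \<in> Basis" for b c
    using assms that by (auto simp: Ck_on_UNIV_Suc simp del: Ck_on.simps(2))
  have cg: "continuous_on UNIV g" using assms Ck_on_imp_continuous by blast
  have "pd b (\<lambda>x. f (g x)) = (\<lambda>x. \<Sum>a\<in>Basis. (pd b g x \<bullet> a) * pd a f (g x))" for b
    by (rule ext) (simp add: pd_compose d pd_direction_sum[of f _ "pd b g _"])
  moreover have "continuous_on UNIV (\<lambda>x. pd a f (g x))" if "a \<in> Basis" for a
    by (rule continuous_on_compose2[OF c(1)[OF that SOME_Basis] cg]) auto
  ultimately have "\<forall>b\<in>Basis. continuous_on UNIV (pd b (\<lambda>x. f (g x)))"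
    using c(2) by (auto intro!: continuous_intros)
  moreover have "(\<lambda>x. f (g x)) differentiable (at x)" for x
    using differentiable_chain_at[OF d(2) d(1)] by (simp add: o_def)
  ultimately show ?thesis by (simp add: Ck_on_UNIV_Suc del: Ck_on.simps(2))
qed

section \<open>Symmetry of mixed partial derivatives\<close>

lemma second_difference_mvt:
  fixes f :: "'a::euclidean_space \<Rightarrow> real"
  assumes f: "\<And>x. f differentiable (at x)" and fa: "\<And>x. pd a f differentiable (at x)" and "s > 0"
  shows "\<exists>\<sigma> \<theta>. 0 < \<sigma> \<and> \<sigma> < s \<and> 0 < \<theta> \<and> \<theta> < s \<and>
    f (x + s *\<^sub>R a + s *\<^sub>R b) - f (x + s *\<^sub>R a) - f (x + s *\<^sub>R b) + f x
      = s * s * pd b (pd a f) (x + \<sigma> *\<^sub>R a + \<theta> *\<^sub>R b)"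
proof -
  let ?p = "\<lambda>u. f ((x + s *\<^sub>R b) + u *\<^sub>R a) - f (x + u *\<^sub>R a)"
  have "(?p has_real_derivative pd a f ((x + s *\<^sub>R b) + u *\<^sub>R a) - pd a f (x + u *\<^sub>R a)) (at u)" for u
    by (intro DERIV_diff pd_has_real_derivative f)
  then obtain \<sigma> where \<sigma>: "0 < \<sigma>" "\<sigma> < s"
    "?p s - ?p 0 = s * (pd a f ((x + s *\<^sub>R b) + \<sigma> *\<^sub>R a) - pd a f (x + \<sigma> *\<^sub>R a))"
    using MVT2[OF \<open>s > 0\<close>, of ?p "\<lambda>u. pd a f ((x + s *\<^sub>R b) + u *\<^sub>R a) - pd a f (x + u *\<^sub>R a)"] by auto
  let ?q = "\<lambda>u. pd a f ((x + \<sigma> *\<^sub>R a) + u *\<^sub>R b)"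
  have "(?q has_real_derivative pd b (pd a f) ((x + \<sigma> *\<^sub>R a) + u *\<^sub>R b)) (at u)" for u
    by (intro pd_has_real_derivative fa)
  then obtain \<theta> where \<theta>: "0 < \<theta>" "\<theta> < s"
    "?q s - ?q 0 = s * pd b (pd a f) ((x + \<sigma> *\<^sub>R a) + \<theta> *\<^sub>R b)"
    using MVT2[OF \<open>s > 0\<close>, of ?q "\<lambda>u. pd b (pd a f) ((x + \<sigma> *\<^sub>R a) + u *\<^sub>R b)"] by auto
  have "f (x + s *\<^sub>R a + s *\<^sub>R b) - f (x + s *\<^sub>R a) - f (x + s *\<^sub>R b) + f x = ?p s - ?p 0"
    by (simp add: algebra_simps)
  also have "\<dots> = s * (?q s - ?q 0)" using \<sigma>(3) by (simp add: algebra_simps)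
  also have "\<dots> = s * s * pd b (pd a f) (x + \<sigma> *\<^sub>R a + \<theta> *\<^sub>R b)" using \<theta>(3) by simp
  finally show ?thesis using \<sigma> \<theta> by blast
qed

text \<open>The second difference over a small square is symmetric in the two directions. By the
  mean value theorem, applied in either order, it is \<open>s * s\<close> times a value of either
  mixed derivative near \<open>x\<close>, and continuity closes the gap.\<close>

lemma pd_commute:
  fixes f :: "'a::euclidean_space \<Rightarrow> real"
  assumes C: "Ck_on (Suc (Suc 0)) UNIV f" and ab: "a \<in> Basis" "b \<in> Basis"
  shows "pd a (pd b f) x = pd b (pd a f) x"
proof (rule ccontr)
  assume ne: "pd a (pd b f) x \<noteq> pd b (pd a f) x"
  have f: "f differentiable (at x)" for x using C by (auto simp: Ck_on_UNIV_Suc simp del: Ck_on.simps)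
  have fb: "pd c f differentiable (at x)" if "c \<in> Basis" for c x
    using C that by (auto simp: Ck_on_UNIV_Suc simp del: Ck_on.simps)
  have c: "continuous_on UNIV (pd c (pd d f))" if "c \<in> Basis" "d \<in> Basis" for c d
    using C that by (auto simp: Ck_on_UNIV_Suc simp del: Ck_on.simps(2))
  \<comment> \<open>Near \<open>x\<close> each mixed derivative stays within half the gap of its
    value at \<open>x\<close>, which is incompatible with the equality \<open>eq\<close>
    below.\<close>
  define e where "e = \<bar>pd a (pd b f) x - pd b (pd a f) x\<bar> / 2"
  have e: "e > 0" using ne by (simp add: e_def)
  obtain d1 where d1: "d1 > 0" "\<And>y. dist y x < d1 \<Longrightarrow> dist (pd a (pd b f) y) (pd a (pd b f) x) < e"
    using c[OF ab(1) ab(2)] e unfolding continuous_on_iff by (metis UNIV_I)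
  obtain d2 where d2: "d2 > 0" "\<And>y. dist y x < d2 \<Longrightarrow> dist (pd b (pd a f) y) (pd b (pd a f) x) < e"
    using c[OF ab(2) ab(1)] e unfolding continuous_on_iff by (metis UNIV_I)
  \<comment> \<open>\<open>a\<close> and \<open>b\<close> are unit vectors, so the points of the
    square with side \<open>s\<close> lie within \<open>2 * s\<close> of \<open>x\<close>, hence in
    both neighbourhoods.\<close>
  define s where "s = min d1 d2 / 2"
  have s: "s > 0" "2 * s \<le> d1" "2 * s \<le> d2" using d1 d2 by (auto simp: s_def)
  obtain \<sigma> \<theta> where 1: "0 < \<sigma>" "\<sigma> < s" "0 < \<theta>" "\<theta> < s"
    "f (x + s *\<^sub>R a + s *\<^sub>R b) - f (x + s *\<^sub>R a) - f (x + s *\<^sub>R b) + f x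
      = s * s * pd b (pd a f) (x + \<sigma> *\<^sub>R a + \<theta> *\<^sub>R b)"
    using second_difference_mvt[OF f fb[OF ab(1)] s(1), where x = x and b = b] by blast
  obtain \<sigma>' \<theta>' where 2: "0 < \<sigma>'" "\<sigma>' < s" "0 < \<theta>'" "\<theta>' < s"
    "f (x + s *\<^sub>R b + s *\<^sub>R a) - f (x + s *\<^sub>R b) - f (x + s *\<^sub>R a) + f x
      = s * s * pd a (pd b f) (x + \<sigma>' *\<^sub>R b + \<theta>' *\<^sub>R a)"
    using second_difference_mvt[OF f fb[OF ab(2)] s(1), where x = x and b = a] by blast
  have "s * s * pd b (pd a f) (x + \<sigma> *\<^sub>R a + \<theta> *\<^sub>R b) = s * s * pd a (pd b f) (x + \<sigma>' *\<^sub>R b + \<theta>' *\<^sub>R a)"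
    using 1(5) 2(5) by (simp add: algebra_simps)
  then have eq: "pd b (pd a f) (x + \<sigma> *\<^sub>R a + \<theta> *\<^sub>R b) = pd a (pd b f) (x + \<sigma>' *\<^sub>R b + \<theta>' *\<^sub>R a)"
    using s by simp
  have n: "norm (p *\<^sub>R a + q *\<^sub>R b) < 2 * s" "norm (p *\<^sub>R b + q *\<^sub>R a) < 2 * s"
    if "0 < p" "p < s" "0 < q" "q < s" for p q
    using norm_triangle_ineq[of "p *\<^sub>R a" "q *\<^sub>R b"] norm_triangle_ineq[of "p *\<^sub>R b" "q *\<^sub>R a"] that
      ab by auto
  have "dist (x + \<sigma> *\<^sub>R a + \<theta> *\<^sub>R b) x < d2" "dist (x + \<sigma>' *\<^sub>R b + \<theta>' *\<^sub>R a) x < d1"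
    using n(1)[OF 1(1-4)] n(2)[OF 2(1-4)] s by (auto simp: dist_norm add.assoc)
  with d1(2) d2(2) eq show False unfolding e_def dist_real_def by (smt (verit) field_sum_of_halves)
qed

section \<open>Locally Lipschitz functions that are differentiable almost everywhere\<close>

text \<open>Finite element functions and their products with smooth fields are of this kind, and for such
  functions integrals of partial derivatives are limits of integrals of difference quotients.\<close>

definition admissible :: "(real^3 \<Rightarrow> real) \<Rightarrow> bool" where
  "admissible f \<longleftrightarrow> (\<forall>r. \<exists>L. L-lipschitz_on (cball 0 r) f) \<and> (AE x in lebesgue. f differentiable (at x))"

lemma admissible_continuous:
  assumes "admissible f"
  shows "continuous_on UNIV f"
proof -
  have "isCont f x" for x
  proof -
    obtain L where "L-lipschitz_on (cball 0 (norm x + 1)) f"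
      using assms by (auto simp: admissible_def)
    then have "continuous_on (cball 0 (norm x + 1)) f" by (rule lipschitz_on_continuous_on)
    moreover have "x \<in> interior (cball 0 (norm x + 1))" by auto
    ultimately show ?thesis using continuous_on_interior by blast
  qed
  then show ?thesis by (simp add: continuous_at_imp_continuous_on)
qed

lemma admissible_add:
  assumes "admissible f" "admissible g"
  shows "admissible (\<lambda>x. f x + g x)"
  unfolding admissible_def
proof (intro conjI allI)
  fix r
  obtain L M where "L-lipschitz_on (cball 0 r) f" "M-lipschitz_on (cball 0 r) g"
    using assms unfolding admissible_def by blast
  then show "\<exists>L. L-lipschitz_on (cball 0 r) (\<lambda>x. f x + g x)" by (blast intro: lipschitz_on_add)
next
  have "AE x in lebesgue. f differentiable (at x)" "AE x in lebesgue. g differentiable (at x)"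
    using assms by (auto simp: admissible_def)
  then show "AE x in lebesgue. (\<lambda>x. f x + g x) differentiable (at x)"
    by eventually_elim (rule differentiable_add)
qed

lemma admissible_mult:
  assumes "admissible f" "admissible g"
  shows "admissible (\<lambda>x. f x * g x)"
  unfolding admissible_def
proof (intro conjI allI)
  fix r
  obtain L M where L: "L-lipschitz_on (cball 0 r) f" "M-lipschitz_on (cball 0 r) g"
    using assms unfolding admissible_def by blast
  have "bounded (f ` cball 0 r)" "bounded (g ` cball 0 r)"
    using assms[THEN admissible_continuous]
    by (auto intro!: compact_imp_bounded compact_continuous_image intro: continuous_on_subset)
  then obtain A B where A: "\<And>x. x \<in> cball 0 r \<Longrightarrow> \<bar>f x\<bar> \<le> A" and B: "\<And>x. x \<in> cball 0 r \<Longrightarrow> \<bar>g x\<bar> \<le> B"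
    unfolding bounded_iff by (simp add: image_iff) (metis mem_cball_0)
  show "\<exists>K. K-lipschitz_on (cball 0 r) (\<lambda>x. f x * g x)"
  proof (intro exI lipschitz_onI)
    fix x y assume xy: "x \<in> cball (0::real^3) r" "y \<in> cball (0::real^3) r"
    have "dist (f x * g x) (f y * g y) = \<bar>(f x - f y) * g x + f y * (g x - g y)\<bar>"
      by (simp add: dist_real_def algebra_simps)
    also have "\<dots> \<le> \<bar>f x - f y\<bar> * \<bar>g x\<bar> + \<bar>f y\<bar> * \<bar>g x - g y\<bar>"
      by (metis abs_mult abs_triangle_ineq)
    also have "\<dots> \<le> (L * dist x y) * \<bar>B\<bar> + \<bar>A\<bar> * (M * dist x y)"
      using lipschitz_onD[OF L(1) xy] lipschitz_onD[OF L(2) xy] A[OF xy(2)] B[OF xy(1)]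
        lipschitz_on_nonneg[OF L(1)] lipschitz_on_nonneg[OF L(2)]
      by (intro add_mono mult_mono) (auto simp: dist_real_def)
    finally show "dist (f x * g x) (f y * g y) \<le> (L * \<bar>B\<bar> + \<bar>A\<bar> * M) * dist x y" by (simp add:
      algebra_simps)
  next
    show "0 \<le> L * \<bar>B\<bar> + \<bar>A\<bar> * M"
      using lipschitz_on_nonneg[OF L(1)] lipschitz_on_nonneg[OF L(2)] by simp
  qed
next
  have "AE x in lebesgue. f differentiable (at x)" "AE x in lebesgue. g differentiable (at x)"
    using assms by (auto simp: admissible_def)
  then show "AE x in lebesgue. (\<lambda>x. f x * g x) differentiable (at x)"
    by eventually_elim (rule differentiable_mult)
qed

lemma admissible_const: "admissible (\<lambda>x. c)"
  unfolding admissible_def by (auto intro: lipschitz_on_constant)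

lemma admissible_diff:
  assumes "admissible f" "admissible g"
  shows "admissible (\<lambda>x. f x - g x)"
  using admissible_add[OF assms(1) admissible_mult[OF admissible_const[of "-1"] assms(2)]] by simp

lemma continuous_bounded_on_ball:
  fixes f :: "'a::euclidean_space \<Rightarrow> 'b::real_normed_vector"
  assumes "continuous_on UNIV f"
  shows "\<exists>B. \<forall>x. norm x \<le> r \<longrightarrow> norm (f x) \<le> B"
proof -
  have "bounded (f ` cball 0 r)"
    using assms by (auto intro!: compact_imp_bounded compact_continuous_image intro:
      continuous_on_subset)
  then show ?thesis unfolding bounded_iff by (simp add: image_iff) (metis mem_cball_0)
qed

text \<open>On a ball the partial derivatives are bounded by compactness, and convexity of the ball
  turns the bound on the derivative into a Lipschitz constant.\<close>

lemma C1_imp_admissible: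
  assumes "Ck_on (Suc 0) UNIV f"
  shows "admissible f"
  unfolding admissible_def
proof (intro conjI allI)
  have d: "f differentiable (at x)" for x
    using assms by (auto simp: Ck_on_UNIV_Suc simp del: Ck_on.simps)
  have c: "continuous_on UNIV (pd b f)" if "b \<in> Basis" for b
    using assms that by (auto simp: Ck_on_UNIV_Suc simp del: Ck_on.simps(2))
  show "AE x in lebesgue. f differentiable (at x)" using d by simp
  fix r
  have "\<exists>B. \<forall>x\<in>cball 0 r. \<bar>pd b f x\<bar> \<le> B" if "b \<in> Basis" for b
  proof -
    have "bounded (pd b f ` cball 0 r)"
      using c[OF that] by (auto intro!: compact_imp_bounded compact_continuous_image intro:
        continuous_on_subset)
    then show ?thesis unfolding bounded_iff by auto
  qed
  then obtain B where B: "\<And>b x. b \<in> Basis \<Longrightarrow> x \<in> cball 0 r \<Longrightarrow> \<bar>pd b f x\<bar> \<le> B b" by metis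
  have "onorm (\<lambda>h. pd h f x) \<le> (\<Sum>b\<in>Basis. \<bar>B b\<bar>)" if "x \<in> cball 0 r" for x
  proof (rule onorm_le)
    fix h :: "real^3"
    have "norm (pd h f x) \<le> (\<Sum>b\<in>Basis. norm ((h \<bullet> b) *\<^sub>R pd b f x))"
      by (subst pd_direction_sum[OF d]) (rule norm_sum)
    also have "\<dots> \<le> (\<Sum>b\<in>Basis. norm h * \<bar>B b\<bar>)"
    proof (rule sum_mono)
      fix b :: "real^3" assume "b \<in> Basis"
      then show "norm ((h \<bullet> b) *\<^sub>R pd b f x) \<le> norm h * \<bar>B b\<bar>"
        using B[OF _ that, of b] Basis_le_norm[of b h]
        by (auto simp: abs_mult intro!: mult_mono)
    qed
    finally show "norm (pd h f x) \<le> (\<Sum>b\<in>Basis. \<bar>B b\<bar>) * norm h"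
      by (simp add: sum_distrib_left mult.commute)
  qed
  then have "(\<Sum>b\<in>Basis. \<bar>B b\<bar>)-lipschitz_on (cball 0 r) f"
    by (intro bounded_derivative_imp_lipschitz[of _ _ "\<lambda>x h. pd h f x"])
       (auto intro: has_derivative_at_withinI has_derivative_pd d sum_nonneg)
  then show "\<exists>L. L-lipschitz_on (cball 0 r) f" ..
qed

text \<open>The step sizes run through a sequence, because measurability of limits and dominated
  convergence are both applied to sequences.\<close>

lemma differentiable_quotient_limit:
  fixes f :: "'a::euclidean_space \<Rightarrow> real"
  assumes "f differentiable (at x)"
  shows "(\<lambda>n. (f (x + inverse (real (Suc n)) *\<^sub>R b) - f x) / inverse (real (Suc n))) \<longlonglongrightarrow> pd b f x"
proof -
  have "((\<lambda>u. f (x + u *\<^sub>R b)) has_real_derivative pd b f (x + 0 *\<^sub>R b)) (at 0)"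
    by (rule pd_has_real_derivative) (simp add: assms)
  then have "((\<lambda>h. (f (x + h *\<^sub>R b) - f x) / h) \<longlongrightarrow> pd b f x) (at 0)"
    by (simp add: DERIV_def)
  moreover have "filterlim (\<lambda>n. inverse (real (Suc n))) (at 0) sequentially"
    unfolding filterlim_at using LIMSEQ_inverse_real_of_nat by auto
  ultimately show ?thesis by (rule filterlim_compose)
qed

text \<open>Almost everywhere \<open>pd b f\<close> is a limit of difference quotients. These are
  continuous, which gives measurability by completeness of Lebesgue measure, and the local Lipschitz
  constant bounds them uniformly in \<open>n\<close>; the limit inherits the bound.\<close>

lemma
  assumes "admissible f"
  shows admissible_pd_measurable: "pd b f \<in> borel_measurable lebesgue"
    and admissible_pd_bounded: "\<exists>L. AE x in lebesgue. norm x \<le> r \<longrightarrow> \<bar>pd b f x\<bar> \<le> L"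
    and admissible_quotient_bounded: "\<exists>L. \<forall>n x. norm x \<le> r \<longrightarrow>
      \<bar>(f (x + inverse (real (Suc n)) *\<^sub>R b) - f x) / inverse (real (Suc n))\<bar> \<le> L"
proof -
  let ?q = "\<lambda>n x. (f (x + inverse (real (Suc n)) *\<^sub>R b) - f x) / inverse (real (Suc n))"
  have lim: "AE x in lebesgue. (\<lambda>n. ?q n x) \<longlonglongrightarrow> pd b f x"
    using assms[unfolded admissible_def, THEN conjunct2]
    by eventually_elim (rule differentiable_quotient_limit)
  have c: "continuous_on UNIV f" by (rule admissible_continuous[OF assms])
  have "continuous_on UNIV (?q n)" for n
    by (intro continuous_intros continuous_on_compose2[OF c]) auto
  then have "?q n \<in> borel_measurable lebesgue" for n
    by (intro measurable_completion) (auto intro: borel_measurable_continuous_onI)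
  then have "(\<lambda>x. lim (\<lambda>n. ?q n x)) \<in> borel_measurable lebesgue"
    by (rule borel_measurable_lim_metric)
  then show "pd b f \<in> borel_measurable lebesgue"
    by (rule borel_measurable_AE) (use lim in eventually_elim, auto intro: limI)
  show ex: "\<exists>L. \<forall>n x. norm x \<le> r \<longrightarrow> \<bar>?q n x\<bar> \<le> L"
  proof -
    \<comment> \<open>The step sizes are at most 1, so the shifted points stay in the ball of radius
      \<open>r + norm b\<close>.\<close>
    obtain L where L: "L-lipschitz_on (cball 0 (r + norm b)) f" using assms by (auto simp:
      admissible_def)
    have "\<bar>?q n x\<bar> \<le> L * norm b" if "norm x \<le> r" for n x
    proof -
      let ?s = "inverse (real (Suc n))"
      have s: "0 < ?s" "?s \<le> 1" by (auto simp: field_simps)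
      have "norm (x + ?s *\<^sub>R b) \<le> norm x + ?s * norm b" using norm_triangle_ineq[of x "?s *\<^sub>R b"] by
        simp
      also have "\<dots> \<le> r + norm b" using that s mult_right_mono[OF s(2), of "norm b"] by simp
      finally have "dist (f (x + ?s *\<^sub>R b)) (f x) \<le> L * dist (x + ?s *\<^sub>R b) x"
        using that by (intro lipschitz_onD[OF L]) (auto simp: add_increasing2)
      then have "\<bar>f (x + ?s *\<^sub>R b) - f x\<bar> \<le> (L * norm b) * ?s"
        by (simp add: dist_norm mult_ac del: of_nat_Suc)
      moreover have "\<bar>?q n x\<bar> = \<bar>f (x + ?s *\<^sub>R b) - f x\<bar> / ?s"
        using s by (simp add: abs_divide del: of_nat_Suc)
      ultimately show ?thesis using s by (simp add: pos_divide_le_eq del: of_nat_Suc)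
    qed
    then show ?thesis by blast
  qed
  then obtain L where L: "\<And>n x. norm x \<le> r \<Longrightarrow> \<bar>?q n x\<bar> \<le> L" by blast
  show "\<exists>L. AE x in lebesgue. norm x \<le> r \<longrightarrow> \<bar>pd b f x\<bar> \<le> L"
  proof (intro exI)
    show "AE x in lebesgue. norm x \<le> r \<longrightarrow> \<bar>pd b f x\<bar> \<le> L"
      using lim
    proof eventually_elim
      case (elim x)
      then have "(\<lambda>n. \<bar>?q n x\<bar>) \<longlonglongrightarrow> \<bar>pd b f x\<bar>" by (rule tendsto_rabs)
      then show ?case using L by (auto intro: LIMSEQ_le_const2)
    qed
  qed
qed

text \<open>The common core of integration by parts on the whole space and on the torus: each
  difference quotient has integral zero by \<open>shift\<close>, and dominated convergence carries
  this over to the derivative.\<close>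

lemma integral_pd_eq_0:
  assumes f: "admissible f" and S: "S \<in> sets lebesgue" "bounded S"
    and shift: "\<And>n. (LINT x|lebesgue_on S. f (x + inverse (real (Suc n)) *\<^sub>R b)) = (LINT
      x|lebesgue_on S. f x)"
  shows "(LINT x|lebesgue_on S. pd b f x) = 0"
proof -
  let ?q = "\<lambda>n x. (f (x + inverse (real (Suc n)) *\<^sub>R b) - f x) / inverse (real (Suc n))"
  obtain r where r: "\<And>x. x \<in> S \<Longrightarrow> norm x \<le> r" using S(2) bounded_iff by blast
  obtain L where L: "\<And>n x. norm x \<le> r \<Longrightarrow> \<bar>?q n x\<bar> \<le> L"
    using admissible_quotient_bounded[OF f, of r b] by blast
  have Sm: "S \<inter> space lebesgue \<in> sets lebesgue" using S by simp
  have fin: "emeasure lebesgue S < \<infinity>"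
    using bounded_set_imp_lmeasurable[OF S(2,1)] by (simp add: fmeasurable_def del: emeasure_completion)
  then have const: "integrable (lebesgue_on S) (\<lambda>x. K)" for K :: real
    using S by (simp add: integrable_restrict_space del: emeasure_completion integrable_completion
      space_completion)
  have c: "continuous_on UNIV f" by (rule admissible_continuous[OF f])
  have meas: "g \<in> borel_measurable (lebesgue_on S)" if "continuous_on UNIV g" for g :: "real^3 \<Rightarrow> real"
    using that by (intro measurable_restrict_space1 measurable_completion) (auto intro:
      borel_measurable_continuous_onI)
  have cs: "continuous_on UNIV (\<lambda>x. f (x + v))" for v
    by (intro continuous_intros continuous_on_compose2[OF c]) auto
  have int: "integrable (lebesgue_on S) g" if g: "continuous_on UNIV g" for g :: "real^3 \<Rightarrow> real"
  proof -
    obtain B where B: "\<And>x. norm x \<le> r \<Longrightarrow> \<bar>g x\<bar> \<le> B"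
      using continuous_bounded_on_ball[OF g, of r] by auto
    show ?thesis
      by (rule Bochner_Integration.integrable_bound[OF const[of B] meas[OF g]])
         (use r B in \<open>force intro!: AE_I2 simp: space_restrict_space\<close>)
  qed
  have "(\<lambda>n. LINT x|lebesgue_on S. ?q n x) \<longlonglongrightarrow> (LINT x|lebesgue_on S. pd b f x)"
  proof (rule integral_dominated_convergence[where w = "\<lambda>_. L"])
    show "pd b f \<in> borel_measurable (lebesgue_on S)"
      by (intro measurable_restrict_space1 admissible_pd_measurable f)
    show "?q n \<in> borel_measurable (lebesgue_on S)" for n
      by (intro meas continuous_intros cs c) auto
    show "integrable (lebesgue_on S) (\<lambda>x. L)" by (rule const)
    show "AE x in lebesgue_on S. (\<lambda>n. ?q n x) \<longlonglongrightarrow> pd b f x"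
      unfolding AE_restrict_space_iff[OF Sm] using f[unfolded admissible_def, THEN conjunct2]
      by eventually_elim (intro impI differentiable_quotient_limit)
    show "AE x in lebesgue_on S. norm (?q n x) \<le> L" for n
      using L r by (intro AE_I2) (auto simp: space_restrict_space)
  qed
  moreover have "(LINT x|lebesgue_on S. ?q n x) = 0" for n
    using shift[of n] by (simp add: Bochner_Integration.integral_diff int cs c)
  ultimately show ?thesis by (simp add: LIMSEQ_const_iff)
qed

section \<open>Integration by parts\<close>

lemma lebesgue_distr_plus: "distr lebesgue lebesgue ((+) c) = (lebesgue :: 'a::euclidean_space measure)"
  and measurable_lebesgue_plus: "(+) c \<in> lebesgue \<rightarrow>\<^sub>M (lebesgue :: 'a::euclidean_space measure)"
  using lebesgue_affine_euclidean[of "\<lambda>_::'a. 1" c] lebesgue_affine_measurable[of "\<lambda>_::'a. 1" c]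
  by (simp_all add: euclidean_representation density_1)

lemma measurable_lebesgue_shift:
  "f \<in> borel_measurable lebesgue \<Longrightarrow> (\<lambda>x. f (x + c :: 'a::euclidean_space)) \<in> borel_measurable lebesgue"
  using measurable_compose[OF measurable_lebesgue_plus[of c]] by (simp add: add.commute)

lemma lebesgue_integral_shift:
  fixes f :: "'a::euclidean_space \<Rightarrow> real"
  assumes f: "f \<in> borel_measurable lebesgue"
  shows "(LINT x|lebesgue. f (x + c)) = (LINT x|lebesgue. f x)"
proof -
  have "(LINT x|lebesgue. f (c + x)) = (LINT x|distr lebesgue lebesgue ((+) c). f x)"
    by (rule integral_distr[symmetric, OF measurable_lebesgue_plus f])
  then show ?thesis by (simp add: lebesgue_distr_plus add.commute)
qed

lemma AE_lebesgue_shift: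
  assumes "AE x in lebesgue. P x"
  shows "AE x in lebesgue. P (x + c :: 'a::euclidean_space)"
proof -
  have "AE x in distr lebesgue lebesgue ((+) c). P x" by (subst lebesgue_distr_plus) (rule assms)
  then have "AE x in lebesgue. P (c + x)" by (rule AE_distrD[OF measurable_lebesgue_plus])
  then show ?thesis by (simp add: add.commute)
qed

lemma lebesgue_integral_pd:
  assumes f: "admissible f" and supp: "\<And>x. r < norm x \<Longrightarrow> f x = 0"
  shows "(LINT x|lebesgue. pd b f x) = 0"
proof -
  \<comment> \<open>The ball exceeds the support by \<open>norm b\<close>, so that the shifted
    functions vanish outside it as well and integrals over \<open>?S\<close> are integrals over the
    whole space.\<close>
  let ?S = "cball (0::real^3) (r + norm b)"
  have S: "?S \<inter> space lebesgue \<in> sets lebesgue" by auto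
  have restr: "(LINT x|lebesgue_on ?S. g x) = (LINT x|lebesgue. g x)"
    if "\<And>x. x \<notin> ?S \<Longrightarrow> g x = 0" for g :: "real^3 \<Rightarrow> real"
    unfolding integral_restrict_space[OF S]
    by (rule Bochner_Integration.integral_cong) (use that in \<open>auto simp: indicator_def\<close>)
  have c: "continuous_on UNIV f" by (rule admissible_continuous[OF f])
  have fm: "f \<in> borel_measurable lebesgue"
    using c by (intro measurable_completion) (auto intro: borel_measurable_continuous_onI)
  have pd0: "pd b f x = 0" if "x \<notin> ?S" for x
  proof (rule pd_eq_0_outside[OF supp])
    show "r < norm x" using that norm_ge_zero[of b] by (simp only: mem_cball_0)
  qed
  have "(LINT x|lebesgue_on ?S. pd b f x) = 0"
  proof (rule integral_pd_eq_0[OF f])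
    show "?S \<in> sets lebesgue" "bounded ?S" by auto
    fix n
    let ?s = "inverse (real (Suc n))"
    have "f (x + ?s *\<^sub>R b) = 0" if "x \<notin> ?S" for x
    proof (rule supp)
      have "norm x \<le> norm (x + ?s *\<^sub>R b) + ?s * norm b"
        using norm_triangle_ineq4[of "x + ?s *\<^sub>R b" "?s *\<^sub>R b"] by (simp del: of_nat_Suc)
      moreover have "?s * norm b \<le> 1 * norm b" by (rule mult_right_mono) (auto simp: field_simps)
      ultimately show "r < norm (x + ?s *\<^sub>R b)" using that by simp
    qed
    moreover have "f x = 0" if "x \<notin> ?S" for x
      using that by (intro supp) (smt (verit) mem_cball_0 norm_ge_zero)
    ultimately show "(LINT x|lebesgue_on ?S. f (x + ?s *\<^sub>R b)) = (LINT x|lebesgue_on ?S. f x)"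
      using restr[of f] restr[of "\<lambda>x. f (x + ?s *\<^sub>R b)"] lebesgue_integral_shift[of f "?s *\<^sub>R b"]
        fm by (simp del: of_nat_Suc)
  qed
  then show ?thesis using restr pd0 by simp
qed

lemma torus_AE: "(AE x in lebesgue. P x) \<Longrightarrow> (AE x in torus. P x)"
  by (subst AE_restrict_space_iff) auto

lemma axis_in_lattice3: "axis \<alpha> 1 \<in> lattice3"
  by (auto simp: lattice3_def axis_def)

lemma periodic_axis: "periodic f \<Longrightarrow> f (x + axis \<alpha> 1) = f x"
  using axis_in_lattice3 by (auto simp: periodic_def)

text \<open>Cut and paste: of the cube translated by \<open>s\<close>, the part \<open>?A\<close>
  still lies in the original cube, and the rest is the slab \<open>?B\<close> moved by one period,
  over which a periodic function has the same integral as over \<open>?B\<close>.\<close>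

lemma torus_integral_shift:
  fixes f :: "real^3 \<Rightarrow> real"
  assumes c: "continuous_on UNIV f" and per: "periodic f" and s: "0 \<le> s" "s \<le> 1"
  shows "(LINT x|torus. f (x + s *\<^sub>R axis \<alpha> 1)) = (LINT x|torus. f x)"
proof -
  let ?e = "axis \<alpha> 1 :: real^3"
  let ?Q = "cbox 0 1 :: (real^3) set"
  let ?A = "{x \<in> ?Q. s \<le> x $ \<alpha>}" and ?B = "{x \<in> ?Q. x $ \<alpha> < s}"
  have restr: "(LINT x|torus. g x) = (LINT x|lebesgue. indicator ?Q x * g x)" for g :: "real^3 \<Rightarrow> real"
    by (subst integral_restrict_space) auto
  have fm [measurable]: "f \<in> borel_measurable borel" by (rule borel_measurable_continuous_onI[OF c])
  have Bm [measurable]: "?B \<in> sets borel" and Am [measurable]: "?A \<in> sets borel"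
    by (simp_all add: Collect_conj_eq) measurable
  have bnd: "\<exists>M. \<forall>x\<in>cbox 0 2. \<bar>f x\<bar> \<le> M"
  proof -
    have "bounded (f ` cbox 0 2)"
      using c by (auto intro!: compact_imp_bounded compact_continuous_image intro: continuous_on_subset)
    then show ?thesis unfolding bounded_iff by auto
  qed
  then obtain M where M: "\<And>x. x \<in> cbox 0 2 \<Longrightarrow> \<bar>f x\<bar> \<le> M" by blast
  have int: "integrable lebesgue (\<lambda>x. indicator C x * f x)"
    if C: "C \<in> sets borel" "C \<subseteq> cbox 0 2" for C
  proof (rule Bochner_Integration.integrable_bound[where f = "\<lambda>x. indicator (cbox 0 2) x * M"])
    have "integrable lborel (\<lambda>x::real^3. indicator (cbox 0 2) x * M)"
      by (intro integrable_mult_left integrable_real_indicator) (auto simp: emeasure_lborel_cbox_eq)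
    then show "integrable lebesgue (\<lambda>x::real^3. indicator (cbox 0 2) x * M)" by (simp add:
      integrable_completion)
    show "(\<lambda>x. indicator C x * f x) \<in> borel_measurable lebesgue"
      using C(1) fm by (intro measurable_completion borel_measurable_times
        borel_measurable_indicator) auto
    show "AE x in lebesgue. norm (indicator C x * f x) \<le> norm (indicator (cbox 0 2) x * M)"
      using M C by (intro AE_I2) (force simp: indicator_def)
  qed
  have sub: "?Q \<subseteq> cbox 0 2" by (auto simp: mem_box_cart) (smt (verit))
  have hyper: "AE x::real^3 in lebesgue. x $ \<alpha> \<noteq> a" for a
  proof -
    have "negligible {x. ?e \<bullet> x = a}" by (rule negligible_hyperplane) auto
    then have "{x::real^3. x $ \<alpha> = a} \<in> null_sets lebesgue" by (simp add: negligible_iff_null_sets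
      inner_axis')
    then show ?thesis by (rule AE_I') auto
  qed
  \<comment> \<open>The two pieces overlap where the coordinate is 1 and miss the face where it is
    \<open>1 + s\<close>, so the decomposition holds off two hyperplanes.\<close>
  have split: "AE x in lebesgue. indicator ?Q (x - s *\<^sub>R ?e) * f x
      = indicator ?A x * f x + indicator ?B (x - ?e) * f x"
    using hyper[of 1] hyper[of "1 + s"]
  proof eventually_elim
    case (elim x)
    have Q: "y \<in> ?Q \<longleftrightarrow> (0 \<le> y $ \<alpha> \<and> y $ \<alpha> \<le> 1) \<and> (\<forall>\<beta>. \<beta> \<noteq> \<alpha> \<longrightarrow> 0 \<le> y $ \<beta> \<and> y $ \<beta> \<le> 1)" for y :: "real^3"
      by (auto simp: mem_box_cart)
    have "indicator ?Q (x - s *\<^sub>R ?e) = (indicator ?A x + indicator ?B (x - ?e) :: real)"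
      using elim s by (auto simp: indicator_def Q axis_def)
    then show ?case by (simp add: algebra_simps)
  qed
  have iA: "integrable lebesgue (\<lambda>x. indicator ?A x * f x)" using sub by (intro int) auto
  have iB: "integrable lebesgue (\<lambda>x. indicator ?B x * f x)" using sub by (intro int) auto
  have iB': "integrable lebesgue (\<lambda>x. indicator ?B (x - ?e) * f x)"
  proof -
    have eq: "(\<lambda>x. indicator ?B (x - ?e) * f x) = (\<lambda>x. indicator {x. x - ?e \<in> ?B} x * f x)"
      by (auto simp: indicator_def)
    have "{x. x - ?e \<in> ?B} \<subseteq> cbox 0 2"
      by (auto simp: mem_box_cart axis_def) (smt (verit))+
    moreover have "{x. x - ?e \<in> ?B} \<in> sets borel" by measurable
    ultimately show ?thesis unfolding eq by (rule int[rotated])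
  qed
  have "(LINT x|torus. f (x + s *\<^sub>R ?e)) = (LINT x|lebesgue. (\<lambda>x. indicator ?Q (x - s *\<^sub>R ?e) * f x)
    (x + s *\<^sub>R ?e))"
    by (simp add: restr)
  also have "\<dots> = (LINT x|lebesgue. indicator ?Q (x - s *\<^sub>R ?e) * f x)"
    by (intro lebesgue_integral_shift measurable_completion) measurable
  also have "\<dots> = (LINT x|lebesgue. indicator ?A x * f x + indicator ?B (x - ?e) * f x)"
    by (rule integral_cong_AE[OF _ _ split]; intro measurable_completion; measurable)
  also have "\<dots> = (LINT x|lebesgue. indicator ?A x * f x) + (LINT x|lebesgue. indicator ?B (x - ?e) *
    f x)"
    by (rule Bochner_Integration.integral_add[OF iA iB'])
  also have "(LINT x|lebesgue. indicator ?B (x - ?e) * f x) = (LINT x|lebesgue. (\<lambda>x. indicator ?B (x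
    - ?e) * f x) (x + ?e))"
    by (intro lebesgue_integral_shift[symmetric] measurable_completion) measurable
  also have "\<dots> = (LINT x|lebesgue. indicator ?B x * f x)"
    by (simp add: periodic_axis[OF per])
  also have "(LINT x|lebesgue. indicator ?A x * f x) + \<dots> = (LINT x|lebesgue. indicator ?A x * f x +
    indicator ?B x * f x)"
    by (rule Bochner_Integration.integral_add[symmetric, OF iA iB])
  also have "\<dots> = (LINT x|torus. f x)"
    unfolding restr by (rule Bochner_Integration.integral_cong) (auto simp: indicator_def)
  finally show ?thesis .
qed

lemma torus_integral_pd:
  assumes f: "admissible f" "periodic f"
  shows "(LINT x|torus. pd (axis \<alpha> 1) f x) = 0"
proof (rule integral_pd_eq_0[OF f(1)])
  show "(LINT x|torus. f (x + inverse (real (Suc n)) *\<^sub>R axis \<alpha> 1)) = (LINT x|torus. f x)" for n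
    by (rule torus_integral_shift[OF admissible_continuous[OF f(1)] f(2)]) (auto simp: field_simps)
qed auto

section \<open>Smooth compactly supported kernels\<close>

text \<open>The classical smooth function \<open>exp (- (1 / s))\<close>, extended by zero. The
  polynomial factor in \<open>1 / s\<close> makes the family closed under differentiation.\<close>

definition bump :: "real poly \<Rightarrow> real \<Rightarrow> real" where
  "bump p s = (if 0 < s then poly p (1 / s) * exp (- (1 / s)) else 0)"

lemma poly_mult_exp_neg_tendsto_0: "((\<lambda>u::real. poly p u * exp (- u)) \<longlongrightarrow> 0) at_top"
proof -
  have "((\<lambda>u. \<Sum>i\<le>degree p. coeff p i * (u ^ i / exp u)) \<longlongrightarrow> (\<Sum>i\<le>degree p. coeff p i * 0)) at_top"
    by (intro tendsto_sum tendsto_mult tendsto_const tendsto_power_div_exp_0)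
  then show ?thesis
    by (simp add: poly_altdef sum_distrib_right exp_minus divide_inverse mult.assoc)
qed

lemma bump_tendsto_0: "(bump p \<longlongrightarrow> 0) (at 0)"
proof (rule filterlim_split_at)
  have "eventually (\<lambda>s. bump p s = 0) (at_left 0)"
    by (auto simp: eventually_at_filter bump_def)
  then show "(bump p \<longlongrightarrow> 0) (at_left 0)"
    by (rule tendsto_eventually)
  have "((\<lambda>s. poly p (inverse s) * exp (- inverse s)) \<longlongrightarrow> 0) (at_right 0)"
    by (rule filterlim_compose[OF poly_mult_exp_neg_tendsto_0 filterlim_inverse_at_top_right])
  moreover have "eventually (\<lambda>s. poly p (inverse s) * exp (- inverse s) = bump p s) (at_right 0)"
    by (auto simp: eventually_at_filter bump_def divide_inverse)
  ultimately show "(bump p \<longlongrightarrow> 0) (at_right 0)"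
    by (rule Lim_transform_eventually)
qed

text \<open>With \<open>u = 1 / s\<close> the derivative of \<open>u\<close> is \<open>- u^2\<close>
  and that of \<open>p(u) exp(-u)\<close> with respect to \<open>u\<close> is
  \<open>(p'(u) - p(u)) exp(-u)\<close>; this explains the new polynomial.\<close>

lemma bump_has_derivative:
  "(bump p has_real_derivative bump (monom 1 2 * (p - pderiv p)) s) (at s)"
proof -
  consider "s > 0" | "s < 0" | "s = 0" by linarith
  then show ?thesis
  proof cases
    case 1
    have "((\<lambda>s. poly p (1 / s) * exp (- (1 / s))) has_real_derivative
        poly (pderiv p) (1 / s) * (- 1 / s\<^sup>2) * exp (- (1 / s)) + poly p (1 / s) * (exp (- (1 / s))
          * (1 / s\<^sup>2))) (at s)"
      using 1 by (auto intro!: derivative_eq_intros DERIV_chain2[OF poly_DERIV] simp: power2_eq_square)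
    also have "poly (pderiv p) (1 / s) * (- 1 / s\<^sup>2) * exp (- (1 / s)) + poly p (1 / s) * (exp (- (1
      / s)) * (1 / s\<^sup>2))
        = bump (monom 1 2 * (p - pderiv p)) s"
      using 1 by (simp add: bump_def poly_monom field_simps)
    finally show ?thesis
      by (rule has_field_derivative_transform_within_open[where S = "{0<..}"]) (use 1 in \<open>auto simp:
        bump_def\<close>)
  next
    case 2
    have "((\<lambda>s. 0) has_real_derivative bump (monom 1 2 * (p - pderiv p)) s) (at s)"
      using 2 by (simp add: bump_def)
    then show ?thesis
      by (rule has_field_derivative_transform_within_open[where S = "{..<0}"]) (use 2 in \<open>auto simp:
        bump_def\<close>)
  next
    case 3
    \<comment> \<open>\<open>pCons 0 p\<close> is \<open>p\<close> times its variable, which stands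
      for \<open>1 / h\<close>. The difference quotient at 0 is therefore again a
      \<open>bump\<close> and tends to 0.\<close>
    have "(\<lambda>h. bump (pCons 0 p) h) = (\<lambda>h. (bump p (0 + h) - bump p 0) / h)"
      by (auto simp: bump_def)
    with bump_tendsto_0[of "pCons 0 p"] 3 show ?thesis
      by (simp add: DERIV_def bump_def[of _ 0])
  qed
qed

text \<open>Since the derivative of a \<open>bump\<close> is again a \<open>bump\<close>, this algebra is closed under partial
  derivatives, so that all its members are smooth.\<close>

inductive_set bump_algebra :: "('a::euclidean_space \<Rightarrow> real) set" where
  bump: "(\<lambda>x. bump p (x \<bullet> w + c)) \<in> bump_algebra"
| const: "(\<lambda>x. c) \<in> bump_algebra"
| add: "f \<in> bump_algebra \<Longrightarrow> g \<in> bump_algebra \<Longrightarrow> (\<lambda>x. f x + g x) \<in> bump_algebra"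
| mult: "f \<in> bump_algebra \<Longrightarrow> g \<in> bump_algebra \<Longrightarrow> (\<lambda>x. f x * g x) \<in> bump_algebra"

lemma bump_algebra_prod:
  "(\<And>i. i \<in> I \<Longrightarrow> f i \<in> bump_algebra) \<Longrightarrow> (\<lambda>x. \<Prod>i\<in>I. f i x) \<in> bump_algebra"
  by (induction I rule: infinite_finite_induct) (auto intro: bump_algebra.const bump_algebra.mult)

lemma bump_algebra_pd:
  assumes "f \<in> bump_algebra"
  shows "(\<forall>x. f differentiable (at x)) \<and> (\<forall>b. pd b f \<in> bump_algebra)"
  using assms
proof induction
  case (bump p w c)
  let ?q = "monom 1 2 * (p - pderiv p)"
  have d: "((\<lambda>x. bump p (x \<bullet> w + c)) has_derivative (\<lambda>h. bump ?q (x \<bullet> w + c) * (h \<bullet> w))) (at x)" for x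
    by (rule has_derivative_compose[of "\<lambda>x. x \<bullet> w + c" _ _ _ "bump p",
          OF _ bump_has_derivative[unfolded has_field_derivative_def]])
       (auto intro!: derivative_eq_intros)
  have "pd b (\<lambda>x. bump p (x \<bullet> w + c)) = (\<lambda>x. bump ?q (x \<bullet> w + c) * (b \<bullet> w))" for b
    by (rule ext) (rule pd_eqI[OF d])
  with d show ?case
    by (auto intro: bump_algebra.intros differentiableI)
next
  case (const c)
  have "pd b (\<lambda>x::'a. c) = (\<lambda>x. 0)" for b by auto
  then show ?case by (auto intro: bump_algebra.const)
next
  case (add f g)
  then have "pd b (\<lambda>x. f x + g x) = (\<lambda>x. pd b f x + pd b g x)" for b
    by (intro ext pd_add) auto
  with add show ?case by (auto intro: bump_algebra.add)
next
  case (mult f g)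
  then have "pd b (\<lambda>x. f x * g x) = (\<lambda>x. pd b f x * g x + f x * pd b g x)" for b
    by (intro ext pd_mult) auto
  with mult show ?case by (auto intro!: bump_algebra.add bump_algebra.mult)
qed

lemma bump_algebra_Ck: "f \<in> bump_algebra \<Longrightarrow> Ck_on k UNIV f"
proof (induction k arbitrary: f)
  case 0
  then show ?case
    using bump_algebra_pd by (auto intro!: continuous_at_imp_continuous_on
      differentiable_imp_continuous_within)
next
  case (Suc k)
  then show ?case using bump_algebra_pd[OF Suc.prems] by (simp add: Ck_on_UNIV_Suc del: Ck_on.simps(2))
qed

text \<open>A product over the coordinates instead of a radial profile: the arguments of
  \<open>bump\<close> are then affine in \<open>x\<close>, and smoothness follows from
  \<open>bump_algebra\<close>. The support lies in the cube with half side \<open>r\<close>.\<close>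

definition kern :: "real \<Rightarrow> real^3 \<Rightarrow> real" where
  "kern r x = (\<Prod>i\<in>UNIV. bump 1 (r - x $ i) * bump 1 (r + x $ i))"

lemma bump_1: "bump 1 s \<ge> 0" "0 < s \<Longrightarrow> bump 1 s > 0" "s \<le> 0 \<Longrightarrow> bump 1 s = 0"
  by (auto simp: bump_def)

lemma kern_nonneg: "0 \<le> kern r x"
  unfolding kern_def by (intro prod_nonneg mult_nonneg_nonneg bump_1 ballI)

lemma kern_pos: "0 < r \<Longrightarrow> 0 < kern r 0"
  unfolding kern_def by (intro prod_pos mult_pos_pos bump_1 ballI) auto

text \<open>In the cube of half side \<open>r\<close> the sum of the three absolute coordinates,
  which dominates the norm, is at most \<open>3 * r\<close>. This is the origin of the factor 3 in
  all later radii.\<close>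

lemma kern_eq_0:
  assumes "3 * r < norm x"
  shows "kern r x = 0"
proof -
  have "norm x \<le> (\<Sum>i\<in>UNIV. \<bar>x $ i\<bar>)" by (rule norm_le_l1_cart)
  moreover have "(\<Sum>i\<in>(UNIV::3 set). \<bar>x $ i\<bar>) \<le> 3 * r" if "\<And>i. \<bar>x $ i\<bar> \<le> r"
    using sum_mono[of UNIV "\<lambda>i. \<bar>x $ i\<bar>" "\<lambda>_. r"] that by simp
  ultimately obtain i where "r < \<bar>x $ i\<bar>" using assms by (meson leD le_less_trans not_less)
  then have "r \<le> x $ i \<or> r + x $ i \<le> 0" by linarith
  then have "bump 1 (r - x $ i) * bump 1 (r + x $ i) = 0" using bump_1(3) by auto
  then show ?thesis unfolding kern_def by (intro prod_zero) auto
qed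

lemma kern_shift_bump_algebra: "(\<lambda>y. kern r (y - x)) \<in> bump_algebra"
proof -
  have "(\<lambda>y::real^3. bump 1 (y \<bullet> (- axis i 1) + (r + x $ i)) * bump 1 (y \<bullet> axis i 1 + (r - x $ i)))
    \<in> bump_algebra" for i
    by (intro bump_algebra.intros)
  then have "(\<lambda>y::real^3. bump 1 (r - (y - x) $ i) * bump 1 (r + (y - x) $ i)) \<in> bump_algebra" for i
    by (simp add: inner_axis algebra_simps)
  then show ?thesis unfolding kern_def by (intro bump_algebra_prod)
qed

lemma kern_Ck: "Ck_on k UNIV (kern r)"
  using bump_algebra_Ck[OF kern_shift_bump_algebra[of r 0]] by simp

lemma compact_support_ball:
  fixes f :: "'a::euclidean_space \<Rightarrow> real"
  assumes "\<And>y. r < dist y x \<Longrightarrow> f y = 0"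
  shows "compact (closure {y. f y \<noteq> 0})"
proof -
  have "{y. f y \<noteq> 0} \<subseteq> cball x r" using assms by (force simp: dist_commute not_le[symmetric])
  then have "bounded {y. f y \<noteq> 0}" using bounded_subset bounded_cball by blast
  then show ?thesis by (simp add: compact_closure)
qed

section \<open>Convolution\<close>

lemma integral_mult_bounded_support:
  fixes f :: "real^3 \<Rightarrow> real"
  assumes f: "f \<in> borel_measurable lebesgue" "AE y in lebesgue. \<bar>f y\<bar> \<le> M"
    and g: "continuous_on UNIV g" "\<And>y. r < dist y a \<Longrightarrow> g y = 0" "\<And>y. \<bar>g y\<bar> \<le> B"
  shows "integrable lebesgue (\<lambda>y. f y * g y)"
    and "\<bar>LINT y|lebesgue. f y * g y\<bar> \<le> M * B * measure lebesgue (cball a r)"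
proof -
  let ?C = "cball a r"
  have fin: "emeasure lebesgue ?C < \<infinity>"
    using emeasure_bounded_finite[of ?C] by simp
  have iw: "integrable lebesgue (\<lambda>y. (M * B) * indicator ?C y)"
    using fin by (intro integrable_mult_right integrable_real_indicator) auto
  have bound: "AE y in lebesgue. norm (f y * g y) \<le> (M * B) * indicator ?C y"
    using f(2)
  proof eventually_elim
    case (elim y)
    show ?case
    proof (cases "y \<in> ?C")
      case True
      then show ?thesis using mult_mono[OF elim g(3)[of y]] elim by (auto simp: abs_mult)
    next
      case False
      then show ?thesis using g(2)[of y] by (auto simp: dist_commute)
    qed
  qed
  have gm: "g \<in> borel_measurable lebesgue"
    using g(1) by (intro measurable_completion) (auto intro: borel_measurable_continuous_onI)
  show int: "integrable lebesgue (\<lambda>y. f y * g y)"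
    using bound
    by (intro Bochner_Integration.integrable_bound[OF iw] borel_measurable_times f gm)
       (auto elim!: eventually_mono)
  have "norm (LINT y|lebesgue. f y * g y) \<le> (LINT y|lebesgue. norm (f y * g y))"
    by (rule integral_norm_bound)
  also have "\<dots> \<le> (LINT y|lebesgue. (M * B) * indicator ?C y)"
    using int bound by (intro integral_mono_AE iw integrable_norm)
  also have "\<dots> = M * B * measure lebesgue ?C" by simp
  finally show "\<bar>LINT y|lebesgue. f y * g y\<bar> \<le> M * B * measure lebesgue ?C" by simp
qed

text \<open>With the argument \<open>y - x\<close> this is convolution with the reflected kernel: as
  a function of \<open>y\<close> the kernel is a translate that can directly serve as a test
  function. The price is a minus sign in the derivatives.\<close>

definition conv :: "(real^3 \<Rightarrow> real) \<Rightarrow> (real^3 \<Rightarrow> real) \<Rightarrow> real^3 \<Rightarrow> real" where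
  "conv f g x = (LINT y|lebesgue. f y * g (y - x))"

lemma continuous_support_bounded:
  fixes g :: "'a::euclidean_space \<Rightarrow> real"
  assumes "continuous_on UNIV g" "\<And>y. r < norm y \<Longrightarrow> g y = 0"
  shows "\<exists>B. \<forall>y. \<bar>g y\<bar> \<le> B"
proof -
  obtain B where "\<And>y. norm y \<le> r \<Longrightarrow> norm (g y) \<le> B"
    using continuous_bounded_on_ball[OF assms(1)] by blast
  then have "\<bar>g y\<bar> \<le> \<bar>B\<bar>" for y using assms(2)[of y] by (cases "norm y \<le> r") force+
  then show ?thesis by blast
qed

lemma conv_integrable:
  fixes f g :: "real^3 \<Rightarrow> real"
  assumes f: "f \<in> borel_measurable lebesgue" "AE y in lebesgue. \<bar>f y\<bar> \<le> M"
    and g: "continuous_on UNIV g" "\<And>y. r < norm y \<Longrightarrow> g y = 0"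
  shows "integrable lebesgue (\<lambda>y. f y * g (y - x))"
proof -
  obtain B where B: "\<And>y. \<bar>g y\<bar> \<le> B" using continuous_support_bounded[of g r] g by blast
  show ?thesis
    by (rule integral_mult_bounded_support(1)[OF f, of _ r x B])
       (use g B in \<open>auto simp: dist_norm intro!: continuous_on_compose2[OF g(1)] continuous_intros\<close>)
qed

text \<open>A first-order Taylor formula whose remainder is uniform in the base point: the mean
  value theorem on the segment is combined with uniform continuity of the partial derivatives on a
  compact ball.\<close>

lemma linearization_uniform:
  fixes g :: "'a::euclidean_space \<Rightarrow> real"
  assumes g: "Ck_on (Suc 0) UNIV g" and "e > 0"
  shows "\<exists>d>0. d \<le> 1 \<and> (\<forall>z h. norm z \<le> r \<longrightarrow> norm h < d \<longrightarrow>
    \<bar>g (z - h) - g z + (\<Sum>b\<in>Basis. (h \<bullet> b) * pd b g z)\<bar> \<le> e * norm h)"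
proof -
  have gd: "g differentiable (at x)" for x using g by (auto simp: Ck_on_UNIV_Suc simp del: Ck_on.simps)
  have gc: "continuous_on UNIV (pd b g)" if "b \<in> Basis" for b
    using g that by (auto simp: Ck_on_UNIV_Suc simp del: Ck_on.simps(2))
  let ?n = "real (DIM('a))"
  \<comment> \<open>The radius \<open>r + 1\<close> leaves room for the intermediate points, since
    \<open>norm h\<close> stays below 1. Each of the \<open>?n\<close> partial derivatives gets an
    equal share of the error \<open>e\<close>.\<close>
  have "uniformly_continuous_on (cball 0 (r + 1)) (pd b g)" if "b \<in> Basis" for b
    using gc[OF that] by (intro compact_uniformly_continuous) (auto intro: continuous_on_subset)
  moreover have "e / ?n > 0" using \<open>e > 0\<close> by simp
  ultimately have "\<forall>b\<in>Basis. \<exists>d>0. \<forall>z\<in>cball 0 (r + 1). \<forall>z'\<in>cball 0 (r + 1).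
      dist z' z < d \<longrightarrow> dist (pd b g z') (pd b g z) < e / ?n"
    unfolding uniformly_continuous_on_def by blast
  then obtain D where D: "\<And>b. b \<in> Basis \<Longrightarrow> D b > 0"
    "\<And>b z z'. b \<in> Basis \<Longrightarrow> z \<in> cball 0 (r + 1) \<Longrightarrow> z' \<in> cball 0 (r + 1) \<Longrightarrow> dist z' z < D b \<Longrightarrow>
      dist (pd b g z') (pd b g z) < e / ?n"
    by metis
  define d where "d = min 1 (Min (D ` Basis))"
  have d: "d > 0" "d \<le> 1" "\<And>b. b \<in> Basis \<Longrightarrow> d \<le> D b" using D(1) by (auto simp: d_def min.coboundedI2)
  have "\<bar>g (z - h) - g z + (\<Sum>b\<in>Basis. (h \<bullet> b) * pd b g z)\<bar> \<le> e * norm h"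
    if z: "norm z \<le> r" and h: "norm h < d" for z h
  proof -
    have "((\<lambda>u. g (z + u *\<^sub>R (- h))) has_real_derivative pd (- h) g (z + u *\<^sub>R (- h))) (at u)" for u
      by (rule pd_has_real_derivative[OF gd])
    then obtain u where u: "0 < u" "u < 1" "g (z - h) - g z = pd (- h) g (z + u *\<^sub>R (- h))"
      using MVT2[of 0 1 "\<lambda>u. g (z + u *\<^sub>R (- h))" "\<lambda>u. pd (- h) g (z + u *\<^sub>R (- h))"] by auto
    let ?z = "z + u *\<^sub>R (- h)"
    have nu: "norm (u *\<^sub>R h) \<le> norm h" using u by (simp add: mult_left_le_one_le)
    then have dz: "dist ?z z < d" using h by (simp add: dist_norm)
    have z': "?z \<in> cball 0 (r + 1)" "z \<in> cball 0 (r + 1)"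
      using norm_triangle_ineq4[of z "u *\<^sub>R h"] nu h d(2) z by auto
    have "g (z - h) - g z + (\<Sum>b\<in>Basis. (h \<bullet> b) * pd b g z) = (\<Sum>b\<in>Basis. (h \<bullet> b) * (pd b g z - pd b g
      ?z))"
      unfolding u(3) by (subst pd_direction_sum[OF gd]) (simp add: sum_negf sum.distrib[symmetric]
        sum_subtractf algebra_simps)
    also have "\<bar>\<dots>\<bar> \<le> (\<Sum>b\<in>(Basis::'a set). norm h * (e / ?n))"
    proof (rule order_trans[OF sum_abs sum_mono])
      fix b :: 'a assume b: "b \<in> Basis"
      have "dist (pd b g ?z) (pd b g z) < e / ?n"
        using D(2)[OF b z'(2,1)] dz d(3)[OF b] by auto
      then show "\<bar>(h \<bullet> b) * (pd b g z - pd b g ?z)\<bar> \<le> norm h * (e / ?n)"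
        unfolding abs_mult by (intro mult_mono Basis_le_norm[OF b]) (auto simp: dist_real_def
          abs_minus_commute)
    qed
    also have "\<dots> = e * norm h" by simp
    finally show ?thesis .
  qed
  with d show ?thesis by blast
qed

text \<open>All regularity comes from \<open>g\<close>. Its first-order remainder is uniformly small
  relative to \<open>norm h\<close> and, for increments below 1, vanishes outside a ball of radius
  \<open>r + 1\<close>, so it stays small after integration against the bounded function
  \<open>f\<close>.\<close>

lemma conv_has_derivative:
  assumes f: "f \<in> borel_measurable lebesgue" "AE y in lebesgue. \<bar>f y\<bar> \<le> M"
    and g: "Ck_on (Suc 0) UNIV g" "\<And>y. r < norm y \<Longrightarrow> g y = 0"
  shows "(conv f g has_derivative (\<lambda>h. - (\<Sum>b\<in>Basis. (h \<bullet> b) * conv f (pd b g) x))) (at x)"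
proof -
  have gc: "continuous_on UNIV g" using g(1) Ck_on_imp_continuous by blast
  have pc: "continuous_on UNIV (pd b g)" if "b \<in> Basis" for b
    using g that by (auto simp: Ck_on_UNIV_Suc simp del: Ck_on.simps(2))
  have p0: "r < norm y \<Longrightarrow> pd b g y = 0" for b y by (rule pd_eq_0_outside[OF g(2)])
  let ?V = "measure lebesgue (cball x (r + 1))"
  let ?r = "\<lambda>h z. g (z - h) - g z + (\<Sum>b\<in>Basis. (h \<bullet> b) * pd b g z)"
  let ?M = "\<bar>M\<bar>"
  have f': "AE y in lebesgue. \<bar>f y\<bar> \<le> ?M" using f(2) by eventually_elim simp
  show ?thesis
    unfolding has_derivative_at_alt
  proof (intro conjI allI impI)
    show "bounded_linear (\<lambda>h. - (\<Sum>b\<in>Basis. (h \<bullet> b) * conv f (pd b g) x))"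
      by (intro bounded_linear_minus bounded_linear_sum bounded_linear_mult_const
        bounded_linear_inner_left)
    fix e :: real assume "e > 0"
    \<comment> \<open>\<open>?M * ?V\<close> bounds the integral of the absolute value of
      \<open>f\<close> over the ball that carries the remainder; adding 1 keeps the denominator
      positive.\<close>
    define e' where "e' = e / (?M * ?V + 1)"
    have pos: "?M * ?V + 1 > 0" by (simp add: add_nonneg_pos)
    then have e': "e' > 0" using \<open>e > 0\<close> by (simp add: e'_def)
    obtain d where d: "d > 0" "d \<le> 1"
      "\<And>z h. norm z \<le> r + 1 \<Longrightarrow> norm h < d \<Longrightarrow> \<bar>?r h z\<bar> \<le> e' * norm h"
      using linearization_uniform[OF g(1) e'] by blast
    have main: "norm (conv f g (x + h) - conv f g x - - (\<Sum>b\<in>Basis. (h \<bullet> b) * conv f (pd b g) x)) \<le> e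
      * norm h"
      if h: "norm h < d" for h
    proof -
      have far: "?r h z = 0" if z: "r + 1 < norm z" for z
      proof -
        have "r < norm (z - h)" "r < norm z" using norm_triangle_ineq2[of z h] z h d(2) by auto
        then show ?thesis by (simp add: g(2) p0)
      qed
      have bnd: "\<bar>?r h z\<bar> \<le> e' * norm h" for z
        using d(3)[OF _ h, of z] far[of z] e' by (cases "norm z \<le> r + 1") auto
      have i: "integrable lebesgue (\<lambda>y. f y * g (y - (x + h)))" "integrable lebesgue (\<lambda>y. f y * g (y
        - x))"
        "b \<in> Basis \<Longrightarrow> integrable lebesgue (\<lambda>y. f y * pd b g (y - x))" for b
        using conv_integrable[OF f gc g(2)] conv_integrable[OF f pc p0] by blast+
      have "conv f g (x + h) - conv f g x - - (\<Sum>b\<in>Basis. (h \<bullet> b) * conv f (pd b g) x)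
          = (LINT y|lebesgue. f y * g (y - (x + h)) - f y * g (y - x) + (\<Sum>b\<in>Basis. (h \<bullet> b) * (f y *
            pd b g (y - x))))"
        unfolding conv_def using i
        by (subst Bochner_Integration.integral_add)
           (auto simp: Bochner_Integration.integral_diff Bochner_Integration.integral_sum)
      also have "\<dots> = (LINT y|lebesgue. f y * ?r h (y - x))"
        by (intro Bochner_Integration.integral_cong) (auto simp: algebra_simps sum_distrib_left)
      also have "\<bar>\<dots>\<bar> \<le> ?M * (e' * norm h) * ?V"
        by (rule integral_mult_bounded_support(2)[OF f(1) f'])
           (use bnd far in \<open>auto simp: dist_norm intro!: continuous_intros continuous_on_compose2[OF
             gc] continuous_on_compose2[OF pc]\<close>)
      also have "\<dots> = (?M * ?V) * e' * norm h" by simp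
      also have "\<dots> \<le> e * norm h"
        using pos \<open>e > 0\<close> by (intro mult_right_mono) (auto simp: e'_def field_simps)
      finally show ?thesis by simp
    qed
    show "\<exists>d>0. \<forall>y. norm (y - x) < d \<longrightarrow>
        norm (conv f g y - conv f g x - - (\<Sum>b\<in>Basis. ((y - x) \<bullet> b) * conv f (pd b g) x)) \<le> e * norm
          (y - x)"
      using d(1) main[of "_ - x"] by (intro exI[of _ d]) auto
  qed
qed

text \<open>Two derivatives of \<open>g\<close> are asked for because the continuity of
  \<open>conv f (pd b g)\<close> is read off its differentiability, by
  \<open>conv_has_derivative\<close> once more.\<close>

lemma conv_C1:
  assumes f: "f \<in> borel_measurable lebesgue" "AE y in lebesgue. \<bar>f y\<bar> \<le> M"
    and g: "Ck_on (Suc (Suc 0)) UNIV g" "\<And>y. r < norm y \<Longrightarrow> g y = 0"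
  shows "Ck_on (Suc 0) UNIV (conv f g)" and "c \<in> Basis \<Longrightarrow> pd c (conv f g) x = - conv f (pd c g) x"
proof -
  have g1: "Ck_on (Suc 0) UNIV g" using g(1) Ck_on_SucD by blast
  have pg: "Ck_on (Suc 0) UNIV (pd b g)" if "b \<in> Basis" for b
    using Ck_pd[OF g(1) _ that] by simp
  note d = conv_has_derivative[OF f g1 g(2)]
  have pd: "pd c (conv f g) x = - conv f (pd c g) x" if "c \<in> Basis" for c x
    using that by (subst pd_eqI[OF d]) (auto simp: inner_Basis if_distrib[of "\<lambda>u. u * _"] cong: if_cong)
  then show "c \<in> Basis \<Longrightarrow> pd c (conv f g) x = - conv f (pd c g) x" .
  have "continuous_on UNIV (pd b (conv f g))" if "b \<in> Basis" for b
  proof -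
    have "conv f (pd b g) differentiable (at x)" for x
      by (rule differentiableI, rule conv_has_derivative[OF f pg[OF that]], rule pd_eq_0_outside[OF
        g(2)])
    then have "continuous_on UNIV (conv f (pd b g))"
      by (intro continuous_at_imp_continuous_on) (auto intro: differentiable_imp_continuous_within)
    then have "continuous_on UNIV (\<lambda>x. - conv f (pd b g) x)" by (rule continuous_on_minus)
    then show ?thesis using pd[OF that] by presburger
  qed
  then show "Ck_on (Suc 0) UNIV (conv f g)"
    using d by (auto simp: Ck_on_UNIV_Suc simp del: Ck_on.simps(2) intro: differentiableI)
qed

section \<open>Mollification\<close>

lemma kern_integrable: "integrable lebesgue (\<lambda>y. kern r (y - x))"
  using conv_integrable[of "\<lambda>_. 1" 1 "kern r" "3 * r" x] kern_eq_0 Ck_on_imp_continuous[OF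
    kern_Ck[of 0]]
  by simp

text \<open>A nonnegative continuous function with integral zero vanishes on a closed set of full
  measure, hence everywhere, whereas \<open>kern r 0 > 0\<close>.\<close>

lemma kern_integral_pos:
  assumes "0 < r"
  shows "0 < (LINT y|lebesgue. kern r y)"
proof -
  have int: "integrable lebesgue (kern r)" using kern_integrable[of r 0] by simp
  have "(LINT y|lebesgue. kern r y) \<noteq> 0"
  proof
    assume "(LINT y|lebesgue. kern r y) = 0"
    then have "AE y in lebesgue. kern r y = 0"
      using integral_nonneg_eq_0_iff_AE[OF int] kern_nonneg by auto
    then have "AE y in lebesgue. y \<in> {y. kern r y = 0}" by simp
    moreover have "closed {y. kern r y = 0}"
      by (intro closed_Collect_eq continuous_on_const Ck_on_imp_continuous[OF kern_Ck[of 0]])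
    ultimately have "0 \<in> {y. kern r y = 0}" by (rule mem_closed_if_AE_lebesgue[rotated])
    then show False using kern_pos[OF assms] by simp
  qed
  moreover have "0 \<le> (LINT y|lebesgue. kern r y)" by (simp add: kern_nonneg)
  ultimately show ?thesis by simp
qed

definition mollifier :: "real \<Rightarrow> real^3 \<Rightarrow> real" where
  "mollifier r x = inverse (LINT y|lebesgue. kern r y) * kern r x"

lemma mollifier_Ck: "Ck_on k UNIV (mollifier r)"
  unfolding mollifier_def[abs_def] by (intro Ck_cmult kern_Ck)

lemma mollifier_eq_0: "3 * r < norm x \<Longrightarrow> mollifier r x = 0"
  by (simp add: mollifier_def kern_eq_0)

lemma mollifier_nonneg: "0 \<le> mollifier r x"
  by (simp add: mollifier_def kern_nonneg)

lemma test_function_mollifier: "test_function (\<lambda>y. mollifier r (y - x))"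
  unfolding test_function_def smooth_on_def
proof (intro conjI allI)
  show "Ck_on k UNIV (\<lambda>y. mollifier r (y - x))" for k
    unfolding mollifier_def by (intro Ck_cmult bump_algebra_Ck kern_shift_bump_algebra)
  show "compact (closure {y. mollifier r (y - x) \<noteq> 0})"
    by (rule compact_support_ball[of "3 * r" x]) (auto intro!: mollifier_eq_0 simp: dist_norm)
qed

lemma mollifier_integral:
  assumes "0 < r"
  shows "integrable lebesgue (\<lambda>y. mollifier r (y - x))" "(LINT y|lebesgue. mollifier r (y - x)) = 1"
proof -
  show "integrable lebesgue (\<lambda>y. mollifier r (y - x))"
    unfolding mollifier_def by (intro integrable_mult_right kern_integrable)
  have "(LINT y|lebesgue. kern r (y + (- x))) = (LINT y|lebesgue. kern r y)"
    by (rule lebesgue_integral_shift) (use kern_integrable[of r 0] in \<open>auto simp: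
      integrable_iff_bounded\<close>)
  then show "(LINT y|lebesgue. mollifier r (y - x)) = 1"
    unfolding mollifier_def using kern_integral_pos[OF assms] by simp
qed

text \<open>The mollifier is a probability density carried by the ball of radius
  \<open>3 * r\<close>, so the convolution is an average over that ball. A small \<open>e\<close>
  gives convergence to the value \<open>l\<close>, and \<open>l = 0\<close> gives uniform
  bounds.\<close>

lemma conv_mollifier_average:
  assumes r: "0 < r" and f: "f \<in> borel_measurable lebesgue" "AE y in lebesgue. \<bar>f y\<bar> \<le> M"
    and l: "AE y in lebesgue. dist y x \<le> 3 * r \<longrightarrow> \<bar>f y - l\<bar> \<le> e"
  shows "\<bar>conv f (mollifier r) x - l\<bar> \<le> e"
proof -
  let ?k = "\<lambda>y. mollifier r (y - x)"
  have int: "integrable lebesgue (\<lambda>y. f y * ?k y)"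
    by (rule conv_integrable[OF f Ck_on_imp_continuous[OF mollifier_Ck[of 0]] mollifier_eq_0])
  note k = mollifier_integral[OF r, of x]
  have "conv f (mollifier r) x - l = (LINT y|lebesgue. f y * ?k y) - l * (LINT y|lebesgue. ?k y)"
    by (simp add: conv_def k)
  also have "\<dots> = (LINT y|lebesgue. f y * ?k y - l * ?k y)"
    using int k by (simp add: Bochner_Integration.integral_diff)
  finally have "\<bar>conv f (mollifier r) x - l\<bar> \<le> (LINT y|lebesgue. norm (f y * ?k y - l * ?k y))"
    using integral_norm_bound[of lebesgue "\<lambda>y. f y * ?k y - l * ?k y"] by simp
  also have "\<dots> \<le> (LINT y|lebesgue. e * ?k y)"
  proof (rule integral_mono_AE)
    show "integrable lebesgue (\<lambda>y. norm (f y * ?k y - l * ?k y))" using int k by auto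
    show "integrable lebesgue (\<lambda>y. e * ?k y)" using k by auto
    show "AE y in lebesgue. norm (f y * ?k y - l * ?k y) \<le> e * ?k y"
      using l
    proof eventually_elim
      case (elim y)
      show ?case
      proof (cases "dist y x \<le> 3 * r")
        case True
        have "norm (f y * ?k y - l * ?k y) = \<bar>f y - l\<bar> * ?k y"
          by (simp add: left_diff_distrib[symmetric] abs_mult mollifier_nonneg)
        also have "\<dots> \<le> e * ?k y" using elim True by (intro mult_right_mono mollifier_nonneg) auto
        finally show ?thesis .
      next
        case False
        then show ?thesis using mollifier_eq_0[of r "y - x"] by (simp add: dist_norm)
      qed
    qed
  qed
  also have "\<dots> = e" using k by simp
  finally show ?thesis .
qed

lemma conv_periodic:
  assumes f: "f \<in> borel_measurable lebesgue" "periodic f" and g: "g \<in> borel_measurable borel"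
  shows "periodic (conv f g)"
  unfolding periodic_def
proof (intro allI ballI)
  fix x z assume z: "z \<in> lattice3"
  have gm: "(\<lambda>y. g (y - w)) \<in> borel_measurable lebesgue" for w
    using measurable_lebesgue_shift[OF measurable_completion[of g lborel borel], of "- w"] g by simp
  have "conv f g (x + z) = (LINT y|lebesgue. (\<lambda>y. f y * g (y - (x + z))) (y + z))"
    unfolding conv_def by (rule lebesgue_integral_shift[symmetric]) (intro borel_measurable_times f gm)
  also have "\<dots> = conv f g x"
    using f(2) z by (simp add: conv_def periodic_def algebra_simps)
  finally show "conv f g (x + z) = conv f g x" .
qed

section \<open>Essentially bounded fields on the torus\<close>

text \<open>Finite element fields are bounded only up to null sets. The class is closed under
  composition with continuous maps, so the integrability of the integrands below is read off their
  structure.\<close>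

definition ess_bounded :: "(real^3 \<Rightarrow> 'a::euclidean_space) \<Rightarrow> bool" where
  "ess_bounded f \<longleftrightarrow> f \<in> borel_measurable torus \<and> (\<exists>M. AE x in torus. norm (f x) \<le> M)"

lemma emeasure_torus: "emeasure torus (space torus) < \<infinity>"
  using emeasure_bounded_finite[of "cbox 0 (1::real^3)"]
  by (simp add: emeasure_restrict_space space_restrict_space)

lemma ess_bounded_const [intro]: "ess_bounded (\<lambda>x. c)"
  unfolding ess_bounded_def by (auto intro!: exI[of _ "norm c"])

lemma integrable_ess_bounded:
  fixes f :: "real^3 \<Rightarrow> 'a::euclidean_space"
  assumes "ess_bounded f"
  shows "integrable torus f"
proof -
  obtain M where M: "AE x in torus. norm (f x) \<le> M" "f \<in> borel_measurable torus"
    using assms unfolding ess_bounded_def by blast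
  have "integrable torus (\<lambda>x. M)"
    using emeasure_torus by (simp add: finite_measure.integrable_const finite_measureI
      less_top[symmetric])
  then show ?thesis
    by (rule Bochner_Integration.integrable_bound[OF _ M(2)]) (use M(1) in eventually_elim, auto)
qed

lemma ess_bounded_compose:
  fixes g :: "'a::euclidean_space \<Rightarrow> 'b::euclidean_space"
  assumes "ess_bounded f" and g: "continuous_on UNIV g"
  shows "ess_bounded (\<lambda>x. g (f x))"
proof -
  obtain M where M: "AE x in torus. norm (f x) \<le> M" "f \<in> borel_measurable torus"
    using assms(1) unfolding ess_bounded_def by blast
  obtain B where B: "\<And>y. norm y \<le> M \<Longrightarrow> norm (g y) \<le> B"
    using continuous_bounded_on_ball[OF g] by blast
  have "AE x in torus. norm (g (f x)) \<le> B" using M(1) by eventually_elim (rule B)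
  moreover have "(\<lambda>x. g (f x)) \<in> borel_measurable torus"
    by (rule measurable_compose[OF M(2) borel_measurable_continuous_onI[OF g]])
  ultimately show ?thesis unfolding ess_bounded_def by blast
qed

lemma ess_bounded_Pair:
  assumes "ess_bounded f" "ess_bounded g"
  shows "ess_bounded (\<lambda>x. (f x, g x))"
proof -
  obtain M N where M: "AE x in torus. norm (f x) \<le> M" "AE x in torus. norm (g x) \<le> N"
    using assms unfolding ess_bounded_def by blast
  then have "AE x in torus. norm (f x, g x) \<le> M + N"
    by eventually_elim (meson add_mono norm_Pair_le order_trans)
  moreover have "(\<lambda>x. (f x, g x)) \<in> borel_measurable torus"
    using assms unfolding ess_bounded_def borel_prod[symmetric] by (intro measurable_Pair) auto
  ultimately show ?thesis unfolding ess_bounded_def by blast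
qed

lemma ess_bounded_compose2:
  fixes h :: "'a::euclidean_space \<times> 'b::euclidean_space \<Rightarrow> 'c::euclidean_space"
  assumes "ess_bounded f" "ess_bounded g" "continuous_on UNIV h"
  shows "ess_bounded (\<lambda>x. h (f x, g x))"
  by (rule ess_bounded_compose[OF ess_bounded_Pair[OF assms(1,2)] assms(3)])

lemma ess_bounded_add: "ess_bounded f \<Longrightarrow> ess_bounded g \<Longrightarrow> ess_bounded (\<lambda>x. f x + g x)"
  using ess_bounded_compose2[of f g "\<lambda>z. fst z + snd z"]
  by (simp add: continuous_on_add continuous_on_fst continuous_on_snd continuous_on_id)

lemma ess_bounded_diff: "ess_bounded f \<Longrightarrow> ess_bounded g \<Longrightarrow> ess_bounded (\<lambda>x. f x - g x)"
  using ess_bounded_compose2[of f g "\<lambda>z. fst z - snd z"]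
  by (simp add: continuous_on_diff continuous_on_fst continuous_on_snd continuous_on_id)

lemma ess_bounded_mult:
  fixes f g :: "real^3 \<Rightarrow> real"
  shows "ess_bounded f \<Longrightarrow> ess_bounded g \<Longrightarrow> ess_bounded (\<lambda>x. f x * g x)"
  using ess_bounded_compose2[of f g "\<lambda>z. fst z * snd z"]
  by (simp add: continuous_on_mult continuous_on_fst continuous_on_snd continuous_on_id)

lemma ess_bounded_sum:
  "(\<And>i. i \<in> I \<Longrightarrow> ess_bounded (f i)) \<Longrightarrow> ess_bounded (\<lambda>x. \<Sum>i\<in>I. f i x)"
  by (induction I rule: infinite_finite_induct) (auto intro: ess_bounded_add)

lemma torus_norm_le: "x \<in> cbox 0 (1::real^3) \<Longrightarrow> norm x \<le> 3"
  using norm_le_l1_cart[of x] sum_mono[of UNIV "\<lambda>i. \<bar>x $ i\<bar>" "\<lambda>_. 1"]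
  by (auto simp: mem_box_cart)

lemma ess_bounded_lebesgue:
  assumes "f \<in> borel_measurable lebesgue" "AE x in lebesgue. norm x \<le> 3 \<longrightarrow> norm (f x) \<le> M"
  shows "ess_bounded f"
  unfolding ess_bounded_def
proof (intro conjI exI)
  show "f \<in> borel_measurable torus" using assms(1) by (rule measurable_restrict_space1)
  show "AE x in torus. norm (f x) \<le> M"
    using assms(2) by (subst AE_restrict_space_iff) (auto elim!: eventually_mono intro: torus_norm_le)
qed

lemma ess_bounded_continuous:
  assumes "continuous_on UNIV f"
  shows "ess_bounded f"
proof -
  obtain B where "\<And>x. norm x \<le> 3 \<Longrightarrow> norm (f x) \<le> B" using continuous_bounded_on_ball[OF assms] by blast
  moreover have "f \<in> borel_measurable lebesgue"
    using assms by (intro measurable_completion) (auto intro: borel_measurable_continuous_onI)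
  ultimately show ?thesis by (intro ess_bounded_lebesgue[of f B]) auto
qed

lemma ess_bounded_pd:
  assumes "admissible f"
  shows "ess_bounded (pd b f)"
proof -
  obtain L where "AE x in lebesgue. norm x \<le> 3 \<longrightarrow> \<bar>pd b f x\<bar> \<le> L"
    using admissible_pd_bounded[OF assms] by blast
  then show ?thesis
    by (intro ess_bounded_lebesgue[where M = L] admissible_pd_measurable assms) simp
qed

section \<open>Null Lagrangians\<close>

text \<open>The weak form of \<open>F\<close> being a gradient that does not mention a potential. It passes to
  mollifications and is preserved both by the scheme and by the evolution equation for \<open>F\<close>.\<close>

definition curl_free :: "(real^3 \<Rightarrow> mat3) \<Rightarrow> bool" where
  "curl_free F \<longleftrightarrow> (\<forall>\<phi> i \<alpha> \<beta>. test_function \<phi> \<longrightarrow>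
     (LINT x|lebesgue. F x $ i $ \<alpha> * pd (axis \<beta> 1) \<phi> x) = (LINT x|lebesgue. F x $ i $ \<beta> * pd (axis \<alpha>
       1) \<phi> x))"

lemma test_function_support:
  assumes "test_function \<phi>"
  obtains r where "0 < r" "\<And>y. r < norm y \<Longrightarrow> \<phi> y = 0"
proof -
  have "bounded {x. \<phi> x \<noteq> 0}"
    by (rule bounded_subset[OF compact_imp_bounded closure_subset]) (use assms in \<open>simp add:
      test_function_def\<close>)
  then obtain r where r: "0 < r" "\<forall>x\<in>{x. \<phi> x \<noteq> 0}. norm x \<le> r" unfolding bounded_pos by blast
  have "\<phi> y = 0" if "r < norm y" for y using r(2) that by (meson leD mem_Collect_eq)
  with r(1) show ?thesis by (rule that)
qed

lemma test_function_pd: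
  assumes "test_function \<phi>" "b \<in> Basis"
  shows "test_function (pd b \<phi>)"
proof -
  obtain r where r: "\<And>y. r < norm y \<Longrightarrow> \<phi> y = 0" using test_function_support[OF assms(1)] by metis
  have "Ck_on k UNIV (pd b \<phi>)" for k
    using Ck_pd[of "Suc k" \<phi> b] assms unfolding test_function_def smooth_on_def by simp
  moreover have "compact (closure {x. pd b \<phi> x \<noteq> 0})"
    by (rule compact_support_ball[of r 0]) (use pd_eq_0_outside[OF r] in auto)
  ultimately show ?thesis unfolding test_function_def smooth_on_def by blast
qed

lemma test_function_Ck: "test_function \<phi> \<Longrightarrow> Ck_on k UNIV \<phi>"
  by (simp add: test_function_def smooth_on_def)

lemma axis_Basis: "axis i 1 \<in> (Basis :: (real^'n) set)"
  by (auto simp: Basis_vec_def)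

text \<open>The weak derivative of the potential is tested with a derivative of the test function,
  whose mixed second derivatives commute.\<close>

lemma gradient_curl_free:
  assumes "is_gradient F"
  shows "curl_free F"
  unfolding curl_free_def
proof (intro allI impI)
  fix \<phi> i \<alpha> \<beta> assume \<phi>: "test_function \<phi>"
  obtain y :: "real^3 \<Rightarrow> real^3" where y: "\<And>i \<alpha>. has_weak_pd \<alpha> (\<lambda>x. y x $ i) (\<lambda>x. F x $ i $ \<alpha>)"
    using assms unfolding is_gradient_def by blast
  have w: "(LINT x|lebesgue. y x $ i * pd (axis \<alpha> 1) (pd (axis \<beta> 1) \<phi>) x) = - (LINT x|lebesgue. F x
    $ i $ \<alpha> * pd (axis \<beta> 1) \<phi> x)"
    for \<alpha> \<beta>
    using y[of \<alpha> i] test_function_pd[OF \<phi> axis_Basis] unfolding has_weak_pd_def by blast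
  have "pd (axis \<alpha> 1) (pd (axis \<beta> 1) \<phi>) x = pd (axis \<beta> 1) (pd (axis \<alpha> 1) \<phi>) x" for x
    by (rule pd_commute[OF test_function_Ck[OF \<phi>] axis_Basis axis_Basis])
  then show "(LINT x|lebesgue. F x $ i $ \<alpha> * pd (axis \<beta> 1) \<phi> x) = (LINT x|lebesgue. F x $ i $ \<beta> * pd
    (axis \<alpha> 1) \<phi> x)"
    using w[of \<alpha> \<beta>] w[of \<beta> \<alpha>] by simp
qed

section \<open>Algebra of cofactor and determinant, and the pointwise Piola identity\<close>

lemma levi_civita_values [simp]:
  "levi_civita 1 2 3 = 1" "levi_civita 2 3 1 = 1" "levi_civita 3 1 2 = 1"
  "levi_civita 3 2 1 = -1" "levi_civita 1 3 2 = -1" "levi_civita 2 1 3 = -1"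
  "levi_civita i i j = 0" "levi_civita i j i = 0" "levi_civita j i i = 0"
  by (auto simp: levi_civita_def)

lemma levi_civita_swap: "levi_civita i k j = - levi_civita i j k"
  using exhaust_3[of i] exhaust_3[of j] exhaust_3[of k] by (elim disjE) simp_all

text \<open>The symmetric bilinear form behind the quadratic map \<open>cof\<close>, normalized so
  that \<open>cof\<close> is half of it on the diagonal.\<close>

definition cof_bilinear :: "mat3 \<Rightarrow> mat3 \<Rightarrow> 3 \<Rightarrow> 3 \<Rightarrow> real" where
  "cof_bilinear X Y i \<alpha> = (\<Sum>j\<in>UNIV. \<Sum>k\<in>UNIV. \<Sum>\<beta>\<in>UNIV. \<Sum>\<gamma>\<in>UNIV.
     levi_civita i j k * levi_civita \<alpha> \<beta> \<gamma> * X $ j $ \<beta> * Y $ k $ \<gamma>)"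

lemma cof_bilinear_commute: "cof_bilinear X Y i \<alpha> = cof_bilinear Y X i \<alpha>"
proof -
  have "cof_bilinear X Y i \<alpha> = (\<Sum>j\<in>UNIV. \<Sum>k\<in>UNIV. \<Sum>\<gamma>\<in>UNIV. \<Sum>\<beta>\<in>UNIV.
     levi_civita i j k * levi_civita \<alpha> \<beta> \<gamma> * X $ j $ \<beta> * Y $ k $ \<gamma>)"
    unfolding cof_bilinear_def by (intro sum.cong sum.swap refl)
  also have "\<dots> = (\<Sum>k\<in>UNIV. \<Sum>j\<in>UNIV. \<Sum>\<gamma>\<in>UNIV. \<Sum>\<beta>\<in>UNIV.
     levi_civita i j k * levi_civita \<alpha> \<beta> \<gamma> * X $ j $ \<beta> * Y $ k $ \<gamma>)"
    by (rule sum.swap)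
  also have "\<dots> = cof_bilinear Y X i \<alpha>"
    unfolding cof_bilinear_def
    by (intro sum.cong refl, subst levi_civita_swap, subst (2) levi_civita_swap) (simp add: mult_ac)
  finally show ?thesis .
qed

lemma cof_eq_bilinear: "cof F $ i $ \<alpha> = 1 / 2 * cof_bilinear F F i \<alpha>"
  by (simp add: cof_def cof_bilinear_def)

lemma cof_bilinear_add:
  "cof_bilinear (X + X') Y i \<alpha> = cof_bilinear X Y i \<alpha> + cof_bilinear X' Y i \<alpha>"
  "cof_bilinear X (Y + Y') i \<alpha> = cof_bilinear X Y i \<alpha> + cof_bilinear X Y' i \<alpha>"
  "cof_bilinear (c *\<^sub>R X) Y i \<alpha> = c * cof_bilinear X Y i \<alpha>"
  "cof_bilinear X (c *\<^sub>R Y) i \<alpha> = c * cof_bilinear X Y i \<alpha>"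
  by (simp_all add: cof_bilinear_def sum.distrib sum_distrib_left algebra_simps)

lemma cof_axis_line:
  "cof (F + u *\<^sub>R E) $ i $ \<alpha> = cof F $ i $ \<alpha> + u * cof_bilinear E F i \<alpha> + u\<^sup>2 * (1 / 2 *
    cof_bilinear E E i \<alpha>)"
  using cof_bilinear_commute[of E F i \<alpha>]
  by (simp add: cof_eq_bilinear cof_bilinear_add power2_eq_square algebra_simps)

lemma det_axis_line:
  "det (F + u *\<^sub>R axis i (axis \<alpha> 1) :: mat3) = det F + u * cof F $ i $ \<alpha>"
  using exhaust_3[of i] exhaust_3[of \<alpha>]
  by (elim disjE) (simp_all add: det_3 cof_def sum_3 axis_def algebra_simps)

lemma linear_Ck:
  assumes "bounded_linear L"
  shows "Ck_on k UNIV L"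
proof (cases k)
  case 0
  then show ?thesis using linear_continuous_on[OF assms] by simp
next
  case (Suc m)
  have d: "(L has_derivative L) (at x)" for x by (rule bounded_linear_imp_has_derivative[OF assms])
  then have "pd b L = (\<lambda>_. L b)" for b by (intro ext pd_eqI)
  with d Suc show ?thesis
    by (auto simp: Ck_on_UNIV_Suc simp del: Ck_on.simps intro: differentiableI Ck_const)
qed

lemma bounded_linear_entry: "bounded_linear (\<lambda>F::mat3. F $ i $ \<alpha>)"
  by (rule bounded_linear_compose[OF bounded_linear_vec_nth bounded_linear_vec_nth])

lemma Ck_cof:
  assumes "\<And>i \<alpha>. Ck_on k UNIV (\<lambda>x. F x $ i $ \<alpha>)"
  shows "Ck_on k UNIV (\<lambda>x. cof (F x) $ i $ \<alpha>)"
  unfolding cof_def by (simp only: vec_lambda_beta) (intro Ck_cmult Ck_sum Ck_mult Ck_const assms)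

lemma Ck_det:
  fixes F :: "'a::euclidean_space \<Rightarrow> mat3"
  assumes "\<And>i \<alpha>. Ck_on k UNIV (\<lambda>x. F x $ i $ \<alpha>)"
  shows "Ck_on k UNIV (\<lambda>x. det (F x))"
  unfolding det_3 by (intro Ck_add Ck_diff Ck_mult assms)

lemma inner_mat3: "(X::mat3) \<bullet> Y = (\<Sum>i\<in>UNIV. \<Sum>\<alpha>\<in>UNIV. X $ i $ \<alpha> * Y $ i $ \<alpha>)"
  by (simp add: inner_vec_def)

lemma Phi_inner_Ck: "Ck_on k UNIV (\<lambda>F. Phi F \<bullet> A)"
proof -
  have "(\<lambda>F. Phi F \<bullet> A) = (\<lambda>F. (F \<bullet> fst A + (\<Sum>i\<in>UNIV. \<Sum>\<alpha>\<in>UNIV. cof F $ i $ \<alpha> * fst (snd A) $ i $ \<alpha>))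
      + det F * snd (snd A))"
    by (cases A) (auto simp: Phi_def inner_mat3[of "cof _"])
  then show ?thesis
    by (simp only:)
      (intro Ck_add Ck_sum Ck_mult Ck_const Ck_cof Ck_det linear_Ck bounded_linear_entry
        bounded_linear_inner_left)
qed

text \<open>Along a line in the direction of one entry, each component of \<open>Phi\<close> is a
  polynomial of degree at most two in \<open>u\<close>, so the partial derivative is the coefficient
  \<open>?L\<close> of \<open>u\<close>. What remains is to collapse the sums against the unit
  matrix \<open>?E\<close>.\<close>

lemma dPhi_eq:
  "dPhi (a, b, c) i \<alpha> F = a $ i $ \<alpha>
     + (\<Sum>j\<in>UNIV. \<Sum>\<beta>\<in>UNIV. b $ j $ \<beta> * (\<Sum>k\<in>UNIV. \<Sum>\<gamma>\<in>UNIV. levi_civita j i k * levi_civita \<beta> \<alpha> \<gamma> * F $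
       k $ \<gamma>))
     + c * cof F $ i $ \<alpha>"
proof -
  let ?E = "axis i (axis \<alpha> 1) :: mat3"
  let ?f = "\<lambda>F. Phi F \<bullet> (a, b, c)"
  let ?L = "?E \<bullet> a + (\<Sum>j\<in>UNIV. \<Sum>\<beta>\<in>UNIV. cof_bilinear ?E F j \<beta> * b $ j $ \<beta>) + cof F $ i $ \<alpha> * c"
  let ?K = "\<Sum>j\<in>UNIV. \<Sum>\<beta>\<in>UNIV. 1 / 2 * cof_bilinear ?E ?E j \<beta> * b $ j $ \<beta>"
  have line: "?f (F + u *\<^sub>R ?E) = ?f F + u * ?L + u\<^sup>2 * ?K" for u
    unfolding Phi_def
    by (simp add: inner_mat3[of "cof _"] cof_axis_line det_axis_line inner_add_left
          sum.distrib sum_distrib_left algebra_simps)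
  have "((\<lambda>u. ?f (F + u *\<^sub>R ?E)) has_real_derivative pd ?E ?f (F + 0 *\<^sub>R ?E)) (at 0)"
    by (intro pd_has_real_derivative Ck_differentiable[OF Phi_inner_Ck[of 1]]) simp
  moreover have "((\<lambda>u. ?f F + u * ?L + u\<^sup>2 * ?K) has_real_derivative ?L) (at 0)"
    by (auto intro!: derivative_eq_intros)
  ultimately have "pd ?E ?f F = ?L" unfolding line using DERIV_unique by fastforce
  moreover have "cof_bilinear ?E F j \<beta> = (\<Sum>k\<in>UNIV. \<Sum>\<gamma>\<in>UNIV. levi_civita j i k * levi_civita \<beta> \<alpha> \<gamma> *
    F $ k $ \<gamma>)" for j \<beta>
  proof -
    have E: "?E $ i' $ \<alpha>' = (if i' = i \<and> \<alpha>' = \<alpha> then 1 else 0)" for i' \<alpha>' by (auto simp: axis_def)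
    have "(\<Sum>\<alpha>'\<in>UNIV. \<Sum>\<gamma>\<in>UNIV. levi_civita j i' k * levi_civita \<beta> \<alpha>' \<gamma> * ?E $ i' $ \<alpha>' * F $ k $ \<gamma>)
        = (if i' = i then \<Sum>\<gamma>\<in>UNIV. levi_civita j i k * levi_civita \<beta> \<alpha> \<gamma> * F $ k $ \<gamma> else 0)" for i' k
    proof -
      have "(\<Sum>\<gamma>\<in>UNIV. levi_civita j i' k * levi_civita \<beta> \<alpha>' \<gamma> * ?E $ i' $ \<alpha>' * F $ k $ \<gamma>)
          = (if \<alpha>' = \<alpha> then (if i' = i then \<Sum>\<gamma>\<in>UNIV. levi_civita j i k * levi_civita \<beta> \<alpha> \<gamma> * F $ k $
            \<gamma> else 0) else 0)"
        for \<alpha>' unfolding E by (cases "i' = i"; cases "\<alpha>' = \<alpha>") simp_all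
      then show ?thesis by simp
    qed
    then have "cof_bilinear ?E F j \<beta>
        = (\<Sum>i'\<in>UNIV. \<Sum>k\<in>UNIV. if i' = i then \<Sum>\<gamma>\<in>UNIV. levi_civita j i k * levi_civita \<beta> \<alpha> \<gamma> * F $ k
          $ \<gamma> else 0)"
      unfolding cof_bilinear_def by simp
    also have "\<dots> = (\<Sum>k\<in>UNIV. \<Sum>i'\<in>UNIV. if i' = i then \<Sum>\<gamma>\<in>UNIV. levi_civita j i k * levi_civita \<beta> \<alpha> \<gamma>
      * F $ k $ \<gamma> else 0)"
      by (rule sum.swap)
    finally show ?thesis by simp
  qed
  moreover have "?E \<bullet> a = a $ i $ \<alpha>" by (simp add: inner_axis_axis inner_axis')
  ultimately show ?thesis unfolding dPhi_def by (simp add: mult.commute)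
qed

lemma Ck_dPhi:
  assumes "\<And>i \<alpha>. Ck_on k UNIV (\<lambda>x. F x $ i $ \<alpha>)"
  shows "Ck_on k UNIV (\<lambda>x. dPhi A i \<alpha> (F x))"
  by (cases A) (simp only: dPhi_eq, intro Ck_add Ck_sum Ck_cmult Ck_const Ck_cof assms)

lemma continuous_dPhi: "continuous_on UNIV (dPhi A i \<alpha>)"
  using Ck_on_imp_continuous[OF Ck_dPhi[of 0 "\<lambda>x. x" A i \<alpha>]] linear_Ck[OF bounded_linear_entry] by simp

text \<open>The derivatives \<open>D k \<gamma> \<alpha>\<close> are symmetric in the last two
  indices and are contracted with Levi-Civita symbols that are antisymmetric in them. The hypothesis
  speaks of this symmetry and of no potential, so that mollified fields qualify.\<close>

lemma div_dPhi_eq_0: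
  assumes d: "\<And>i \<alpha>. (\<lambda>x. F x $ i $ \<alpha>) differentiable (at x)"
    and sym: "\<And>i \<alpha> \<beta>. pd (axis \<beta> 1) (\<lambda>x. F x $ i $ \<alpha>) x = pd (axis \<alpha> 1) (\<lambda>x. F x $ i $ \<beta>) x"
  shows "(\<Sum>\<alpha>\<in>UNIV. pd (axis \<alpha> 1) (\<lambda>x. dPhi A i \<alpha> (F x)) x) = 0"
proof -
  obtain a b c where A: "A = (a, b, c)" by (cases A)
  define D where "D k \<gamma> \<alpha> = pd (axis \<alpha> 1) (\<lambda>x. F x $ k $ \<gamma>) x" for k \<gamma> \<alpha>
  have D: "D k \<gamma> \<alpha> = D k \<alpha> \<gamma>" for k \<gamma> \<alpha> using sym by (simp add: D_def)
  have dm: "(\<lambda>x. r * F x $ k $ \<gamma>) differentiable (at x)" for r k \<gamma>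
    by (intro differentiable_mult differentiable_const d)
  have pm: "pd b (\<lambda>x. r * f x) x = r * pd b f x" if "f differentiable (at x)" for r b and f :: "_ \<Rightarrow>
    real"
    using that by (subst pd_mult) auto
  have cof: "pd (axis \<alpha> 1) (\<lambda>x. cof (F x) $ i $ \<alpha>) x
      = 1 / 2 * (\<Sum>j\<in>UNIV. \<Sum>k\<in>UNIV. \<Sum>\<beta>\<in>UNIV. \<Sum>\<gamma>\<in>UNIV. levi_civita i j k * levi_civita \<alpha> \<beta> \<gamma> *
          (D j \<beta> \<alpha> * F x $ k $ \<gamma> + F x $ j $ \<beta> * D k \<gamma> \<alpha>))" for \<alpha>
  proof -
    have eq: "(\<lambda>x. cof (F x) $ i $ \<alpha>) = (\<lambda>x. 1 / 2 * (\<Sum>j\<in>UNIV. \<Sum>k\<in>UNIV. \<Sum>\<beta>\<in>UNIV. \<Sum>\<gamma>\<in>UNIV.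
        levi_civita i j k * levi_civita \<alpha> \<beta> \<gamma> * (F x $ j $ \<beta> * F x $ k $ \<gamma>)))"
      by (simp add: cof_def mult.assoc)
    show ?thesis
      unfolding eq D_def
      by (subst pm) (auto simp: pd_sum pm pd_mult d intro!: differentiable_sum differentiable_mult
        differentiable_const d)
  qed
  have cofd: "(\<lambda>x. cof (F x) $ i $ \<alpha>) differentiable (at x)" for \<alpha>
    unfolding cof_def
    by (simp add: mult.assoc d differentiable_sum differentiable_mult differentiable_const)
  have "pd (axis \<alpha> 1) (\<lambda>x. dPhi A i \<alpha> (F x)) x
      = (\<Sum>j\<in>UNIV. \<Sum>\<beta>\<in>UNIV. b $ j $ \<beta> * (\<Sum>k\<in>UNIV. \<Sum>\<gamma>\<in>UNIV. levi_civita j i k * levi_civita \<beta> \<alpha> \<gamma> * D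
        k \<gamma> \<alpha>))
        + c * pd (axis \<alpha> 1) (\<lambda>x. cof (F x) $ i $ \<alpha>) x" for \<alpha>
    unfolding A dPhi_eq D_def
    by (simp add: pd_add pd_sum pm cofd d dm differentiable_sum differentiable_mult
      differentiable_const differentiable_add)
  then have "(\<Sum>\<alpha>\<in>UNIV. pd (axis \<alpha> 1) (\<lambda>x. dPhi A i \<alpha> (F x)) x)
      = (\<Sum>\<alpha>\<in>UNIV. \<Sum>j\<in>UNIV. \<Sum>\<beta>\<in>UNIV. b $ j $ \<beta> * (\<Sum>k\<in>UNIV. \<Sum>\<gamma>\<in>UNIV. levi_civita j i k * levi_civita \<beta>
        \<alpha> \<gamma> * D k \<gamma> \<alpha>))
       + c * (\<Sum>\<alpha>\<in>UNIV. pd (axis \<alpha> 1) (\<lambda>x. cof (F x) $ i $ \<alpha>) x)"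
    by (simp add: sum.distrib sum_distrib_left)
  moreover have "(\<Sum>\<alpha>\<in>UNIV. \<Sum>j\<in>UNIV. \<Sum>\<beta>\<in>UNIV. b $ j $ \<beta> * (\<Sum>k\<in>UNIV. \<Sum>\<gamma>\<in>UNIV. levi_civita j i k *
    levi_civita \<beta> \<alpha> \<gamma> * D k \<gamma> \<alpha>)) = 0"
    using D[of _ 1 2] D[of _ 1 3] D[of _ 2 3] exhaust_3[of i] by (elim disjE) (simp_all add: sum_3)
  moreover have "(\<Sum>\<alpha>\<in>UNIV. pd (axis \<alpha> 1) (\<lambda>x. cof (F x) $ i $ \<alpha>) x) = 0"
    unfolding cof using D[of _ 1 2] D[of _ 1 3] D[of _ 2 3] exhaust_3[of i]
    by (elim disjE) (simp_all add: sum_3 algebra_simps)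
  ultimately show ?thesis by simp
qed

section \<open>Integration by parts against test functions and propagation of
  \<open>curl_free\<close>\<close>

lemma continuous_compact_support_integrable:
  fixes f :: "real^3 \<Rightarrow> real"
  assumes "continuous_on UNIV f" "\<And>y. r < norm y \<Longrightarrow> f y = 0"
  shows "integrable lebesgue f"
  using conv_integrable[of "\<lambda>_. 1" 1 f r 0] assms by simp

lemma bounded_measurable_mult_test_integrable:
  assumes f: "f \<in> borel_measurable lebesgue" "AE y in lebesgue. \<bar>f y\<bar> \<le> M" and \<phi>: "test_function \<phi>"
  shows "integrable lebesgue (\<lambda>y. f y * \<phi> y)"
proof -
  obtain r where "\<And>y. r < norm y \<Longrightarrow> \<phi> y = 0" using test_function_support[OF \<phi>] by metis
  then show ?thesis
    using conv_integrable[OF f Ck_on_imp_continuous[OF test_function_Ck[OF \<phi>, of 0]], of r 0] by simp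
qed

lemma integration_by_parts:
  assumes f: "admissible f" and \<phi>: "test_function \<phi>" and b: "b \<in> Basis"
  shows "integrable lebesgue (\<lambda>x. pd b f x * \<phi> x)" "integrable lebesgue (\<lambda>x. f x * pd b \<phi> x)"
    and "(LINT x|lebesgue. f x * pd b \<phi> x) = - (LINT x|lebesgue. pd b f x * \<phi> x)"
proof -
  obtain r where r: "\<And>y. r < norm y \<Longrightarrow> \<phi> y = 0" using test_function_support[OF \<phi>] by metis
  have r': "r < norm y \<Longrightarrow> pd b \<phi> y = 0" for y by (rule pd_eq_0_outside[OF r])
  have cont: "continuous_on UNIV f" "continuous_on UNIV \<phi>" "continuous_on UNIV (pd b \<phi>)"
    using admissible_continuous[OF f] test_function_Ck[OF \<phi>, of 0] test_function_Ck[OF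
      test_function_pd[OF \<phi> b], of 0]
    by auto
  show 1: "integrable lebesgue (\<lambda>x. f x * pd b \<phi> x)"
    by (rule continuous_compact_support_integrable[of _ r]) (auto intro!: continuous_intros cont
      simp: r')
  obtain L where L: "AE x in lebesgue. norm x \<le> r \<longrightarrow> \<bar>pd b f x\<bar> \<le> L"
    using admissible_pd_bounded[OF f] by blast
  \<comment> \<open>\<open>pd b f\<close> is bounded only locally, hence the cut-off to a ball that
    contains the support of \<open>\<phi>\<close>.\<close>
  let ?p = "\<lambda>x. indicator (cball 0 r) x * pd b f x"
  have "integrable lebesgue (\<lambda>x. ?p x * \<phi> x)"
  proof (rule bounded_measurable_mult_test_integrable[OF _ _ \<phi>])
    show "?p \<in> borel_measurable lebesgue"
      by (intro borel_measurable_times borel_measurable_indicator admissible_pd_measurable f) auto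
    show "AE y in lebesgue. \<bar>?p y\<bar> \<le> \<bar>L\<bar>" using L by eventually_elim (auto simp: indicator_def)
  qed
  moreover have "(\<lambda>x. ?p x * \<phi> x) = (\<lambda>x. pd b f x * \<phi> x)"
    using r by (force simp: indicator_def)
  ultimately show 2: "integrable lebesgue (\<lambda>x. pd b f x * \<phi> x)" by simp
  have adm: "admissible (\<lambda>x. f x * \<phi> x)"
    by (intro admissible_mult f C1_imp_admissible test_function_Ck \<phi>)
  have "AE x in lebesgue. pd b (\<lambda>x. f x * \<phi> x) x = pd b f x * \<phi> x + f x * pd b \<phi> x"
    using f[unfolded admissible_def, THEN conjunct2]
    by eventually_elim (rule pd_mult, assumption, rule Ck_differentiable[OF test_function_Ck[OF \<phi>,
      of 1]], simp)
  then have "(LINT x|lebesgue. pd b (\<lambda>x. f x * \<phi> x) x) = (LINT x|lebesgue. pd b f x * \<phi> x + f x * pd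
    b \<phi> x)"
    using 1 2 by (intro integral_cong_AE admissible_pd_measurable adm) auto
  also have "(LINT x|lebesgue. pd b (\<lambda>x. f x * \<phi> x) x) = 0"
    by (rule lebesgue_integral_pd[OF adm, of r]) (simp add: r)
  finally show "(LINT x|lebesgue. f x * pd b \<phi> x) = - (LINT x|lebesgue. pd b f x * \<phi> x)"
    using 1 2 by simp
qed

lemma mat3_entry_le_norm: "\<bar>(X::mat3) $ i $ \<alpha>\<bar> \<le> norm X"
  using component_le_norm_cart[of "X $ i" \<alpha>] Finite_Cartesian_Product.norm_nth_le[of X i] by simp

text \<open>The increment is a gradient: once its derivative is moved onto the test function, the
  extra term contains a mixed second derivative of \<open>\<phi>\<close>, which is symmetric in
  \<open>\<alpha>\<close> and \<open>\<beta>\<close>. Equality almost everywhere is what the scheme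
  provides.\<close>

lemma curl_free_add_gradient:
  assumes F: "curl_free F" "F \<in> borel_measurable lebesgue" "AE x in lebesgue. norm (F x) \<le> M"
    and v: "\<And>i. admissible (\<lambda>x. v x $ i)"
    and F': "F' \<in> borel_measurable lebesgue"
      "AE x in lebesgue. \<forall>i \<alpha>. F' x $ i $ \<alpha> = F x $ i $ \<alpha> + c * pd (axis \<alpha> 1) (\<lambda>x. v x $ i) x"
  shows "curl_free F'"
  unfolding curl_free_def
proof (intro allI impI)
  fix \<phi> i \<alpha> \<beta> assume \<phi>: "test_function \<phi>"
  have m: "(\<lambda>x. H x $ i $ \<alpha>) \<in> borel_measurable lebesgue" if "H \<in> borel_measurable lebesgue" for H
    :: "real^3 \<Rightarrow> mat3" and i \<alpha>
    by (rule measurable_compose[OF that]) (intro borel_measurable_continuous_onI continuous_intros)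
  have bnd: "AE x in lebesgue. \<bar>F x $ i $ \<alpha>\<bar> \<le> M" for i \<alpha>
    using F(3) by eventually_elim (rule order_trans[OF mat3_entry_le_norm])
  have pm: "pd (axis \<beta> 1) \<phi> \<in> borel_measurable lebesgue" for \<beta>
    by (intro admissible_pd_measurable C1_imp_admissible test_function_Ck \<phi>)
  have *: "(LINT x|lebesgue. F' x $ i $ \<alpha> * pd (axis \<beta> 1) \<phi> x)
      = (LINT x|lebesgue. F x $ i $ \<alpha> * pd (axis \<beta> 1) \<phi> x) - c * (LINT x|lebesgue. v x $ i * pd
        (axis \<alpha> 1) (pd (axis \<beta> 1) \<phi>) x)"
    for \<alpha> \<beta>
  proof -
    note t = test_function_pd[OF \<phi> axis_Basis[of \<beta>]]
    have i1: "integrable lebesgue (\<lambda>x. F x $ i $ \<alpha> * pd (axis \<beta> 1) \<phi> x)"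
      by (rule bounded_measurable_mult_test_integrable[OF m[OF F(2)] bnd t])
    note i2 = integration_by_parts[OF v[of i] t axis_Basis[of \<alpha>]]
    have "(LINT x|lebesgue. F' x $ i $ \<alpha> * pd (axis \<beta> 1) \<phi> x)
      = (LINT x|lebesgue. F x $ i $ \<alpha> * pd (axis \<beta> 1) \<phi> x + c * (pd (axis \<alpha> 1) (\<lambda>x. v x $ i) x * pd
        (axis \<beta> 1) \<phi> x))"
    proof (rule integral_cong_AE)
      show "(\<lambda>x. F' x $ i $ \<alpha> * pd (axis \<beta> 1) \<phi> x) \<in> borel_measurable lebesgue"
        by (intro borel_measurable_times m F' pm)
      show "(\<lambda>x. F x $ i $ \<alpha> * pd (axis \<beta> 1) \<phi> x + c * (pd (axis \<alpha> 1) (\<lambda>x. v x $ i) x * pd (axis \<beta>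
        1) \<phi> x)) \<in> borel_measurable lebesgue"
        using i1 i2(1) by auto
      show "AE x in lebesgue. F' x $ i $ \<alpha> * pd (axis \<beta> 1) \<phi> x =
          F x $ i $ \<alpha> * pd (axis \<beta> 1) \<phi> x + c * (pd (axis \<alpha> 1) (\<lambda>x. v x $ i) x * pd (axis \<beta> 1) \<phi> x)"
        using F'(2) by eventually_elim (simp add: algebra_simps)
    qed
    also have "\<dots> = (LINT x|lebesgue. F x $ i $ \<alpha> * pd (axis \<beta> 1) \<phi> x) + c * (LINT x|lebesgue. pd
      (axis \<alpha> 1) (\<lambda>x. v x $ i) x * pd (axis \<beta> 1) \<phi> x)"
      using i1 i2(1) by simp
    finally show ?thesis using i2(3) by simp
  qed
  have "pd (axis \<alpha> 1) (pd (axis \<beta> 1) \<phi>) x = pd (axis \<beta> 1) (pd (axis \<alpha> 1) \<phi>) x" for x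
    by (rule pd_commute[OF test_function_Ck[OF \<phi>] axis_Basis axis_Basis])
  then show "(LINT x|lebesgue. F' x $ i $ \<alpha> * pd (axis \<beta> 1) \<phi> x) = (LINT x|lebesgue. F' x $ i $ \<beta> *
    pd (axis \<alpha> 1) \<phi> x)"
    using * F(1)[unfolded curl_free_def, rule_format, OF \<phi>, of i \<alpha> \<beta>] by simp
qed

lemma integral_cbox_eq_lebesgue:
  fixes f :: "real^3 \<Rightarrow> real"
  assumes "integrable lebesgue f" "\<And>x. x \<notin> S \<Longrightarrow> f x = 0"
  shows "integral S f = (LINT x|lebesgue. f x)"
proof -
  have "(f has_integral (LINT x|lebesgue. f x)) UNIV" by (rule has_integral_integral_lebesgue[OF
    assms(1)])
  moreover have "f = (\<lambda>x. if x \<in> S then f x else 0)" using assms(2) by auto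
  ultimately have "((\<lambda>x. if x \<in> S then f x else 0) has_integral (LINT x|lebesgue. f x)) UNIV" by simp
  then show ?thesis unfolding has_integral_restrict_UNIV by (rule integral_unique)
qed

text \<open>Integrated against a derivative of \<open>\<phi>\<close>, the time derivative of
  \<open>F\<close> turns into an integral of \<open>v\<close> against a mixed second derivative of
  \<open>\<phi>\<close>. So \<open>J \<alpha> \<beta> - J \<beta> \<alpha>\<close> is constant in
  time, and it vanishes initially.\<close>

lemma curl_free_evolution:
  fixes F :: "real \<Rightarrow> real^3 \<Rightarrow> mat3" and v :: "real \<Rightarrow> real^3 \<Rightarrow> real^3"
  assumes deriv: "\<And>t x i \<alpha>. t \<in> {0..T} \<Longrightarrow>
      ((\<lambda>s. F s x $ i $ \<alpha>) has_real_derivative pd (axis \<alpha> 1) (\<lambda>y. v t y $ i) x) (at t within {0..T})"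
    and cont: "\<And>i \<alpha>. continuous_on ({0..T} \<times> UNIV) (\<lambda>(t, x). pd (axis \<alpha> 1) (\<lambda>y. v t y $ i) x)"
    and contF: "\<And>t. t \<in> {0..T} \<Longrightarrow> continuous_on UNIV (F t)"
    and adm: "\<And>t i. t \<in> {0..T} \<Longrightarrow> admissible (\<lambda>x. v t x $ i)"
    and F0: "curl_free (F 0)" and t: "t \<in> {0..T}"
  shows "curl_free (F t)"
  unfolding curl_free_def
proof (intro allI impI)
  fix \<phi> i \<alpha> \<beta> assume \<phi>: "test_function \<phi>"
  obtain r where r: "\<And>y. r < norm y \<Longrightarrow> \<phi> y = 0" using test_function_support[OF \<phi>] by metis
  have r': "r < norm y \<Longrightarrow> pd b \<phi> y = 0" for y b by (rule pd_eq_0_outside[OF r])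
  \<comment> \<open>Differentiation under the integral is carried out over a compact box. It
    contains the support of \<open>\<phi>\<close>, so \<open>J\<close> is still the integral over
    the whole space.\<close>
  obtain a where a: "cball 0 r \<subseteq> cbox (- a) (a::real^3)"
    using bounded_subset_cbox_symmetric[OF bounded_cball] by metis
  have out: "pd b \<phi> x = 0" if "x \<notin> cbox (- a) a" for x b
    using r'[of x b] a that by (cases "norm x \<le> r") auto
  have pc: "continuous_on UNIV (pd (axis \<beta> 1) \<phi>)" for \<beta>
    using test_function_Ck[OF test_function_pd[OF \<phi> axis_Basis], of 0] by simp
  have Fc: "continuous_on UNIV (\<lambda>x. F t x $ i $ \<alpha> * pd (axis \<beta> 1) \<phi> x)" if "t \<in> {0..T}" for t \<alpha> \<beta>
    by (intro continuous_intros pc contF that)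
  define J where "J \<alpha> \<beta> s = integral (cbox (- a) a) (\<lambda>x. F s x $ i $ \<alpha> * pd (axis \<beta> 1) \<phi> x)" for \<alpha> \<beta> s
  have J: "J \<alpha> \<beta> s = (LINT x|lebesgue. F s x $ i $ \<alpha> * pd (axis \<beta> 1) \<phi> x)" if "s \<in> {0..T}" for \<alpha> \<beta> s
    unfolding J_def
    by (intro integral_cbox_eq_lebesgue continuous_compact_support_integrable[of _ r] Fc that) (auto
      simp: r' out)
  have dJ: "(J \<alpha> \<beta> has_real_derivative - (LINT x|lebesgue. v s x $ i * pd (axis \<alpha> 1) (pd (axis \<beta> 1)
    \<phi>) x)) (at s within {0..T})"
    if s: "s \<in> {0..T}" for \<alpha> \<beta> s
  proof -
    let ?fx = "\<lambda>s x. pd (axis \<alpha> 1) (\<lambda>y. v s y $ i) x * pd (axis \<beta> 1) \<phi> x"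
    note ibp = integration_by_parts[OF adm[OF s, of i] test_function_pd[OF \<phi> axis_Basis[of \<beta>]]
      axis_Basis[of \<alpha>]]
    have "(J \<alpha> \<beta> has_real_derivative integral (cbox (- a) a) (?fx s)) (at s within {0..T})"
      unfolding J_def[abs_def]
    proof (rule leibniz_rule_field_derivative[OF _ _ _ s])
      fix u x assume "u \<in> {0..T}"
      then show "((\<lambda>u. F u x $ i $ \<alpha> * pd (axis \<beta> 1) \<phi> x) has_field_derivative ?fx u x) (at u within
        {0..T})"
        by (intro DERIV_cmult_right deriv)
    next
      fix u assume "u \<in> {0..T}"
      then show "(\<lambda>x. F u x $ i $ \<alpha> * pd (axis \<beta> 1) \<phi> x) integrable_on cbox (- a) a"
        by (intro integrable_continuous continuous_on_subset[OF Fc]) auto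
    next
      have "continuous_on ({0..T} \<times> cbox (- a) a) (\<lambda>z. pd (axis \<alpha> 1) (\<lambda>y. v (fst z) y $ i) (snd z))"
        using continuous_on_subset[OF cont[of \<alpha> i] Sigma_mono[OF order_refl subset_UNIV], of "\<lambda>_.
          cbox (- a) a"]
        by (simp add: split_beta)
      moreover have "continuous_on ({0..T} \<times> cbox (- a) a) (\<lambda>z. pd (axis \<beta> 1) \<phi> (snd z))"
        by (rule continuous_on_compose2[OF pc]) (auto intro: continuous_on_snd continuous_on_id)
      ultimately show "continuous_on ({0..T} \<times> cbox (- a) a) (\<lambda>(s, x). ?fx s x)"
        by (simp add: split_beta continuous_on_mult)
    qed simp
    also have "integral (cbox (- a) a) (?fx s) = (LINT x|lebesgue. ?fx s x)"
      by (intro integral_cbox_eq_lebesgue ibp(1)) (simp add: out)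
    also have "\<dots> = - (LINT x|lebesgue. v s x $ i * pd (axis \<alpha> 1) (pd (axis \<beta> 1) \<phi>) x)"
      using ibp(3) by simp
    finally show ?thesis .
  qed
  have com: "pd (axis \<alpha> 1) (pd (axis \<beta> 1) \<phi>) x = pd (axis \<beta> 1) (pd (axis \<alpha> 1) \<phi>) x" for x
    by (rule pd_commute[OF test_function_Ck[OF \<phi>] axis_Basis axis_Basis])
  have "((\<lambda>s. J \<alpha> \<beta> s - J \<beta> \<alpha> s) has_real_derivative 0) (at s within {0..T})" if "s \<in> {0..T}" for s
    using DERIV_diff[OF dJ[OF that, of \<alpha> \<beta>] dJ[OF that, of \<beta> \<alpha>]] by (simp add: com)
  then obtain c where c: "\<And>s. s \<in> {0..T} \<Longrightarrow> J \<alpha> \<beta> s - J \<beta> \<alpha> s = c"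
    using has_field_derivative_zero_constant[of "{0..T}" "\<lambda>s. J \<alpha> \<beta> s - J \<beta> \<alpha> s"] by auto
  have 0: "0 \<in> {0..T}" using t by auto
  then have "J \<alpha> \<beta> 0 - J \<beta> \<alpha> 0 = 0"
    using F0[unfolded curl_free_def, rule_format, OF \<phi>, of i \<alpha> \<beta>] by (simp only: J)
  then have "J \<alpha> \<beta> t = J \<beta> \<alpha> t" using c[OF 0] c[OF t] by simp
  then show "(LINT x|lebesgue. F t x $ i $ \<alpha> * pd (axis \<beta> 1) \<phi> x) = (LINT x|lebesgue. F t x $ i $ \<beta>
    * pd (axis \<alpha> 1) \<phi> x)"
    using t by (simp only: J)
qed

section \<open>From weak to pointwise symmetry, and the weak Piola identity\<close>

lemma lattice_translate_unit_cube: "\<exists>z\<in>lattice3. x - z \<in> cbox 0 1"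
proof (intro bexI)
  show "x - (\<chi> i. of_int \<lfloor>x $ i\<rfloor>) \<in> cbox 0 1"
    unfolding mem_box_cart by (simp, intro allI conjI, linarith+)
qed (auto simp: lattice3_def)

lemma lattice3_uminus: "z \<in> lattice3 \<Longrightarrow> - z \<in> lattice3"
  by (simp add: lattice3_def)

lemma periodic_diff: "periodic f \<Longrightarrow> z \<in> lattice3 \<Longrightarrow> f (x - z) = f x"
  using lattice3_uminus[of z] unfolding periodic_def by (metis diff_conv_add_uminus)

lemma periodic_continuous_bounded:
  fixes f :: "real^3 \<Rightarrow> 'a::real_normed_vector"
  assumes "continuous_on UNIV f" "periodic f"
  shows "\<exists>M. \<forall>x. norm (f x) \<le> M"
proof -
  obtain B where B: "\<And>x. norm x \<le> 3 \<Longrightarrow> norm (f x) \<le> B" using continuous_bounded_on_ball[OF assms(1)]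
    by blast
  have "norm (f x) \<le> B" for x
  proof -
    obtain z where z: "z \<in> lattice3" "x - z \<in> cbox 0 1" using lattice_translate_unit_cube by blast
    then have "norm (f (x - z)) \<le> B" by (intro B torus_norm_le)
    then show ?thesis using periodic_diff[OF assms(2) z(1)] by simp
  qed
  then show ?thesis by blast
qed

lemma pd_shift: "g differentiable (at (x + c)) \<Longrightarrow> pd b (\<lambda>y. g (y + c)) x = pd b g (x + c)"
  by (rule pd_eqI, rule has_derivative_compose[of "\<lambda>y. y + c" "\<lambda>h. h", OF _ has_derivative_pd])
    (auto intro!: derivative_eq_intros)

text \<open>No differentiability is needed: \<open>frechet_derivative\<close> chooses from the set of all derivatives at a
  point, which is the same set at a translate of that point.\<close>

lemma periodic_pd:
  assumes "periodic f"
  shows "periodic (pd b f)"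
proof -
  have "(f has_derivative D) (at (x + z)) \<longleftrightarrow> (f has_derivative D) (at x)" if z: "z \<in> lattice3" for x z D
  proof
    assume D: "(f has_derivative D) (at (x + z))"
    have "((\<lambda>y. y + z) has_derivative (\<lambda>h. h)) (at x)" by (auto intro!: derivative_eq_intros)
    from has_derivative_compose[OF this D] show "(f has_derivative D) (at x)" using assms z by (simp
      add: periodic_def)
  next
    assume D: "(f has_derivative D) (at x)"
    have 1: "((\<lambda>y. y - z) has_derivative (\<lambda>h. h)) (at (x + z))" by (auto intro!: derivative_eq_intros)
    have "(f has_derivative D) (at (x + z - z))" using D by simp
    from has_derivative_compose[OF 1 this] show "(f has_derivative D) (at (x + z))" using
      periodic_diff[OF assms z] by simp
  qed
  then show ?thesis unfolding periodic_def pd_def frechet_derivative_def by simp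
qed

text \<open>The fundamental lemma of the calculus of variations: the mollifications of the curl
  entry \<open>g\<close> vanish because \<open>F\<close> is weakly curl-free, and they approximate
  the continuous function \<open>g\<close> at every point.\<close>

lemma curl_free_C1_symmetric:
  assumes F: "curl_free F" "periodic F" and C1: "\<And>i \<alpha>. Ck_on (Suc 0) UNIV (\<lambda>x. F x $ i $ \<alpha>)"
  shows "pd (axis \<beta> 1) (\<lambda>x. F x $ i $ \<alpha>) x = pd (axis \<alpha> 1) (\<lambda>x. F x $ i $ \<beta>) x"
proof -
  define g where "g y = pd (axis \<beta> 1) (\<lambda>x. F x $ i $ \<alpha>) y - pd (axis \<alpha> 1) (\<lambda>x. F x $ i $ \<beta>) y" for y
  have adm: "admissible (\<lambda>x. F x $ i $ \<alpha>)" for i \<alpha> by (rule C1_imp_admissible[OF C1])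
  have "continuous_on UNIV (pd (axis \<beta> 1) (\<lambda>x. F x $ i $ \<alpha>))" for i \<alpha> \<beta>
    using Ck_pd[OF C1 _ axis_Basis, of \<beta> i \<alpha>] by simp
  then have gc: "continuous_on UNIV g" unfolding g_def[abs_def] by (intro continuous_intros)
  have "periodic (pd (axis \<beta> 1) (\<lambda>x. F x $ i $ \<alpha>))" for i \<alpha> \<beta>
    using F(2) by (intro periodic_pd) (simp add: periodic_def)
  then have "periodic g" unfolding g_def[abs_def] periodic_def by simp
  \<comment> \<open>Periodicity makes the continuous function \<open>g\<close> bounded on the whole
    space, as the averaging lemma asks.\<close>
  then obtain M where M: "\<And>x. norm (g x) \<le> M" using periodic_continuous_bounded[OF gc] by blast
  have gm: "g \<in> borel_measurable lebesgue"
    using gc by (intro measurable_completion) (auto intro: borel_measurable_continuous_onI)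
  have conv0: "conv g (mollifier r) x = 0" for r
  proof -
    let ?\<phi> = "\<lambda>y. mollifier r (y - x)"
    note t = test_function_mollifier[of r x]
    have "conv g (mollifier r) x = (LINT y|lebesgue. pd (axis \<beta> 1) (\<lambda>x. F x $ i $ \<alpha>) y * ?\<phi> y)
        - (LINT y|lebesgue. pd (axis \<alpha> 1) (\<lambda>x. F x $ i $ \<beta>) y * ?\<phi> y)"
      unfolding conv_def g_def left_diff_distrib
      by (intro Bochner_Integration.integral_diff integration_by_parts(1)[OF adm t axis_Basis])
    also have "\<dots> = (LINT y|lebesgue. F y $ i $ \<beta> * pd (axis \<alpha> 1) ?\<phi> y) - (LINT y|lebesgue. F y $ i $
      \<alpha> * pd (axis \<beta> 1) ?\<phi> y)"
      by (simp add: integration_by_parts(3)[OF adm t axis_Basis])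
    also have "\<dots> = 0" using F(1)[unfolded curl_free_def, rule_format, OF t, of i \<alpha> \<beta>] by simp
    finally show ?thesis .
  qed
  have "\<bar>g x\<bar> \<le> e" if "e > 0" for e
  proof -
    obtain d where d: "d > 0" "\<And>y. dist y x < d \<Longrightarrow> dist (g y) (g x) < e"
      using gc \<open>e > 0\<close> unfolding continuous_on_iff by (metis UNIV_I)
    \<comment> \<open>The kernel with parameter \<open>d / 6\<close> reaches as far as
      \<open>d / 2\<close>, inside the neighbourhood on which \<open>g\<close> varies by less than
      \<open>e\<close>.\<close>
    have "\<bar>conv g (mollifier (d / 6)) x - g x\<bar> \<le> e"
    proof (rule conv_mollifier_average[OF _ gm])
      show "AE y in lebesgue. \<bar>g y\<bar> \<le> M" using M by simp
      have "\<bar>g y - g x\<bar> \<le> e" if "dist y x \<le> 3 * (d / 6)" for y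
        using d(2)[of y] d(1) that by (auto simp: dist_real_def)
      then show "AE y in lebesgue. dist y x \<le> 3 * (d / 6) \<longrightarrow> \<bar>g y - g x\<bar> \<le> e" by simp
    qed (use d in simp)
    then show ?thesis by (simp add: conv0)
  qed
  then have "g x = 0" by (metis abs_le_zero_iff dense_ge)
  then show ?thesis by (simp add: g_def)
qed

lemma norm_mat3_le: "norm (X::mat3) \<le> (\<Sum>i\<in>UNIV. \<Sum>\<alpha>\<in>UNIV. \<bar>X $ i $ \<alpha>\<bar>)"
proof -
  have "norm X \<le> (\<Sum>i\<in>UNIV. norm (X $ i))" unfolding norm_vec_def[of X] by (rule L2_set_le_sum) simp
  also have "\<dots> \<le> (\<Sum>i\<in>UNIV. \<Sum>\<alpha>\<in>UNIV. \<bar>X $ i $ \<alpha>\<bar>)" by (intro sum_mono norm_le_l1_cart)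
  finally show ?thesis .
qed

text \<open>For mollified \<open>F\<close> the divergence of \<open>dPhi A i\<close> vanishes pointwise. The last hypothesis on \<open>F\<close>
  makes the mollifications converge almost everywhere.\<close>

lemma weak_piola:
  fixes F :: "real^3 \<Rightarrow> mat3"
  assumes Fm: "F \<in> borel_measurable lebesgue" and bnd: "AE x in lebesgue. norm (F x) \<le> M"
    and per: "periodic F" and cf: "curl_free F"
    and loc: "AE x in lebesgue. \<exists>q e. isCont q x \<and> q x = F x \<and> 0 < e \<and>
      (AE y in lebesgue. dist y x < e \<longrightarrow> F y = q y)"
    and \<psi>: "admissible \<psi>" "periodic \<psi>"
  shows "(LINT x|torus. (\<Sum>\<alpha>\<in>UNIV. dPhi A i \<alpha> (F x) * pd (axis \<alpha> 1) \<psi> x)) = 0"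
proof -
  define m where "m n = mollifier (inverse (real (Suc n)))" for n
  define Fn where "Fn n x = (\<chi> i \<alpha>. conv (\<lambda>y. F y $ i $ \<alpha>) (m n) x)" for n x
  have em: "(\<lambda>x. F x $ i $ \<alpha>) \<in> borel_measurable lebesgue" for i \<alpha>
    by (rule measurable_compose[OF Fm]) (intro borel_measurable_continuous_onI continuous_intros)
  have ebnd: "AE x in lebesgue. \<bar>F x $ i $ \<alpha>\<bar> \<le> M" for i \<alpha>
    using bnd by eventually_elim (rule order_trans[OF mat3_entry_le_norm])
  have entry: "(\<lambda>x. Fn n x $ i $ \<alpha>) = conv (\<lambda>y. F y $ i $ \<alpha>) (m n)" for n i \<alpha>
    by (simp add: Fn_def fun_eq_iff)
  have C1: "Ck_on (Suc 0) UNIV (\<lambda>x. Fn n x $ i $ \<alpha>)" for n i \<alpha>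
    unfolding entry m_def by (rule conv_C1(1)[OF em ebnd mollifier_Ck mollifier_eq_0])
  have pdF: "pd (axis \<beta> 1) (\<lambda>x. Fn n x $ i $ \<alpha>) x = - (LINT y|lebesgue. F y $ i $ \<alpha> * pd (axis \<beta> 1)
    (\<lambda>y. m n (y - x)) y)"
    for n i \<alpha> \<beta> x
  proof -
    have "pd (axis \<beta> 1) (\<lambda>y. m n (y - x)) y = pd (axis \<beta> 1) (m n) (y - x)" for y
      using pd_shift[of "m n" y "- x"] Ck_differentiable[OF mollifier_Ck[of 1]] by (simp add: m_def)
    then show ?thesis
      unfolding entry m_def
      by (subst conv_C1(2)[OF em ebnd mollifier_Ck mollifier_eq_0 axis_Basis]) (auto simp: conv_def
        m_def)
  qed
  \<comment> \<open>The derivative of a mollification falls on the kernel, a translate of which is a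
    test function; \<open>curl_free\<close> is then exactly the pointwise symmetry.\<close>
  have sym: "pd (axis \<beta> 1) (\<lambda>x. Fn n x $ i $ \<alpha>) x = pd (axis \<alpha> 1) (\<lambda>x. Fn n x $ i $ \<beta>) x" for n i \<alpha> \<beta> x
    unfolding pdF m_def using cf test_function_mollifier unfolding curl_free_def by (metis (no_types))
  have mm: "m n \<in> borel_measurable borel" for n
    unfolding m_def by (intro borel_measurable_continuous_onI Ck_on_imp_continuous[OF
      mollifier_Ck[of 0]])
  have perF: "periodic (Fn n)" for n
  proof -
    have "periodic (conv (\<lambda>y. F y $ i $ \<alpha>) (m n))" for i \<alpha>
      using per by (intro conv_periodic em mm) (simp add: periodic_def)
    then show ?thesis by (simp add: Fn_def periodic_def)
  qed
  \<comment> \<open>Averages of entries bounded by \<open>M\<close> are bounded by \<open>M\<close>,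
    and there are nine entries. Uniformity in \<open>n\<close> confines the arguments of
    \<open>dPhi\<close> to one ball, which yields the dominating constant.\<close>
  have FnM: "norm (Fn n x) \<le> 9 * M" for n x
  proof -
    have "\<bar>conv (\<lambda>y. F y $ i $ \<alpha>) (m n) x - 0\<bar> \<le> M" for i \<alpha>
      unfolding m_def
      by (rule conv_mollifier_average[OF _ em ebnd]) (use ebnd[of i \<alpha>] in \<open>auto elim!: eventually_mono\<close>)
    then have "(\<Sum>i\<in>UNIV. \<Sum>\<alpha>\<in>UNIV. \<bar>Fn n x $ i $ \<alpha>\<bar>) \<le> (\<Sum>i\<in>(UNIV::3 set). \<Sum>\<alpha>\<in>(UNIV::3 set). M)"
      by (intro sum_mono) (simp add: Fn_def)
    then show ?thesis using norm_mat3_le[of "Fn n x"] by simp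
  qed
  have lim: "AE x in lebesgue. (\<lambda>n. Fn n x) \<longlonglongrightarrow> F x"
    using loc
  proof eventually_elim
    case (elim x)
    then obtain q d where q: "isCont q x" "q x = F x" "0 < d" "AE y in lebesgue. dist y x < d \<longrightarrow> F y
      = q y"
      by blast
    have "(\<lambda>n. Fn n x $ i $ \<alpha>) \<longlonglongrightarrow> F x $ i $ \<alpha>" for i \<alpha>
    proof (rule LIMSEQ_I)
      fix e :: real assume e: "e > 0"
      have "isCont (\<lambda>y. q y $ i $ \<alpha>) x" using q(1) by (intro continuous_intros)
      then obtain s where s: "s > 0" "\<And>y. dist y x < s \<Longrightarrow> dist (q y $ i $ \<alpha>) (q x $ i $ \<alpha>) < e / 2"
        using e unfolding continuous_at_eps_delta by (metis dist_commute half_gt_zero)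
      \<comment> \<open>Three times the kernel parameter bounds its reach. For large
        \<open>n\<close> the average at \<open>x\<close> sees only points where \<open>q\<close> is
        close to \<open>q x\<close> (radius \<open>s\<close>) and where \<open>F\<close> coincides
        with \<open>q\<close> almost everywhere (radius \<open>d\<close>).\<close>
      have "eventually (\<lambda>n. inverse (real (Suc n)) < min s d / 3) sequentially"
        using order_tendstoD(2)[OF LIMSEQ_inverse_real_of_nat, of "min s d / 3"] s q by simp
      then obtain N where N: "\<And>n. n \<ge> N \<Longrightarrow> inverse (real (Suc n)) < min s d / 3"
        unfolding eventually_sequentially by blast
      have "norm (Fn n x $ i $ \<alpha> - F x $ i $ \<alpha>) < e" if "n \<ge> N" for n
      proof -
        have "\<bar>conv (\<lambda>y. F y $ i $ \<alpha>) (m n) x - F x $ i $ \<alpha>\<bar> \<le> e / 2"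
          unfolding m_def
        proof (rule conv_mollifier_average[OF _ em ebnd])
          show "AE y in lebesgue. dist y x \<le> 3 * inverse (real (Suc n)) \<longrightarrow> \<bar>F y $ i $ \<alpha> - F x $ i $
            \<alpha>\<bar> \<le> e / 2"
            using q(4)
          proof eventually_elim
            case (elim y)
            show ?case
            proof
              assume "dist y x \<le> 3 * inverse (real (Suc n))"
              then have "dist y x < s" "dist y x < d" using N[OF that] by linarith+
              then show "\<bar>F y $ i $ \<alpha> - F x $ i $ \<alpha>\<bar> \<le> e / 2"
                using elim s(2)[of y] q(2) by (simp add: dist_real_def)
            qed
          qed
        qed simp
        then show ?thesis using e by (simp add: Fn_def)
      qed
      then show "\<exists>N. \<forall>n\<ge>N. norm (Fn n x $ i $ \<alpha> - F x $ i $ \<alpha>) < e" by blast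
    qed
    then show ?case by (intro vec_tendstoI)
  qed
  let ?h = "\<lambda>n x. \<Sum>\<alpha>\<in>UNIV. dPhi A i \<alpha> (Fn n x) * pd (axis \<alpha> 1) \<psi> x"
  have dC1: "Ck_on (Suc 0) UNIV (\<lambda>x. dPhi A i \<alpha> (Fn n x))" for n \<alpha>
    by (rule Ck_dPhi[OF C1])
  have dadm: "admissible (\<lambda>x. dPhi A i \<alpha> (Fn n x) * \<psi> x)" for n \<alpha>
    by (intro admissible_mult C1_imp_admissible dC1 \<psi>)
  have hb: "ess_bounded (?h n)" for n
    by (intro ess_bounded_sum ess_bounded_mult ess_bounded_pd \<psi> ess_bounded_continuous
      Ck_on_imp_continuous[OF dC1])
  \<comment> \<open>By the product rule \<open>?h n\<close> is a sum of derivatives of periodic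
    admissible functions minus \<open>\<psi>\<close> times the divergence of \<open>dPhi\<close>.
    The divergence vanishes for the mollified field, and the derivatives integrate to zero over the
    torus.\<close>
  have zero: "(LINT x|torus. ?h n x) = 0" for n
  proof -
    have "AE x in torus. ?h n x = (\<Sum>\<alpha>\<in>UNIV. pd (axis \<alpha> 1) (\<lambda>x. dPhi A i \<alpha> (Fn n x) * \<psi> x) x)"
      using torus_AE[OF \<psi>(1)[unfolded admissible_def, THEN conjunct2]]
    proof eventually_elim
      case (elim x)
      have d: "(\<lambda>x. dPhi A i \<alpha> (Fn n x)) differentiable (at x)" for \<alpha> by (rule Ck_differentiable[OF
        dC1]) simp
      have "(\<Sum>\<alpha>\<in>UNIV. pd (axis \<alpha> 1) (\<lambda>x. dPhi A i \<alpha> (Fn n x) * \<psi> x) x)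
          = (\<Sum>\<alpha>\<in>UNIV. pd (axis \<alpha> 1) (\<lambda>x. dPhi A i \<alpha> (Fn n x)) x) * \<psi> x + ?h n x"
        by (simp add: pd_mult[OF d elim] sum.distrib sum_distrib_right)
      also have "(\<Sum>\<alpha>\<in>UNIV. pd (axis \<alpha> 1) (\<lambda>x. dPhi A i \<alpha> (Fn n x)) x) = 0"
        by (rule div_dPhi_eq_0[OF Ck_differentiable[OF C1] sym]) simp
      finally show ?case by simp
    qed
    then have "(LINT x|torus. ?h n x) = (LINT x|torus. (\<Sum>\<alpha>\<in>UNIV. pd (axis \<alpha> 1) (\<lambda>x. dPhi A i \<alpha> (Fn n
      x) * \<psi> x) x))"
      by (intro integral_cong_AE[OF hb[of n, unfolded ess_bounded_def, THEN conjunct1]]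
          borel_measurable_sum measurable_restrict_space1 admissible_pd_measurable dadm)
    also have "\<dots> = (\<Sum>\<alpha>\<in>UNIV. LINT x|torus. pd (axis \<alpha> 1) (\<lambda>x. dPhi A i \<alpha> (Fn n x) * \<psi> x) x)"
      by (intro Bochner_Integration.integral_sum integrable_ess_bounded ess_bounded_pd dadm)
    also have "\<dots> = 0"
    proof (intro sum.neutral ballI torus_integral_pd dadm)
      show "periodic (\<lambda>x. dPhi A i \<alpha> (Fn n x) * \<psi> x)" for \<alpha>
        using perF[of n] \<psi>(2) by (simp add: periodic_def)
    qed
    finally show ?thesis .
  qed
  have "\<exists>L. AE x in torus. \<bar>pd (axis \<alpha> 1) \<psi> x\<bar> \<le> L" for \<alpha>
    using ess_bounded_pd[OF \<psi>(1), of "axis \<alpha> 1"] by (auto simp: ess_bounded_def)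
  then obtain L where L: "\<And>\<alpha>. AE x in torus. \<bar>pd (axis \<alpha> 1) \<psi> x\<bar> \<le> L \<alpha>" by metis
  have "\<exists>B. \<forall>X. norm X \<le> 9 * M \<longrightarrow> \<bar>dPhi A i \<alpha> X\<bar> \<le> B" for \<alpha>
    using continuous_bounded_on_ball[OF continuous_dPhi[of A i \<alpha>], of "9 * M"] by simp
  then obtain B where B: "\<And>\<alpha> X. norm X \<le> 9 * M \<Longrightarrow> \<bar>dPhi A i \<alpha> X\<bar> \<le> B \<alpha>" by metis
  have "(\<lambda>n. LINT x|torus. ?h n x) \<longlonglongrightarrow> (LINT x|torus. (\<Sum>\<alpha>\<in>UNIV. dPhi A i \<alpha> (F x) * pd (axis \<alpha> 1) \<psi> x))"
  proof (rule integral_dominated_convergence[where w = "\<lambda>_. \<Sum>\<alpha>\<in>UNIV. \<bar>B \<alpha>\<bar> * \<bar>L \<alpha>\<bar>"])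
    have "(\<lambda>x. dPhi A i \<alpha> (F x)) \<in> borel_measurable lebesgue" for \<alpha>
      by (rule measurable_compose[OF Fm borel_measurable_continuous_onI[OF continuous_dPhi]])
    then show "(\<lambda>x. \<Sum>\<alpha>\<in>UNIV. dPhi A i \<alpha> (F x) * pd (axis \<alpha> 1) \<psi> x) \<in> borel_measurable torus"
      by (intro measurable_restrict_space1 borel_measurable_sum borel_measurable_times
        admissible_pd_measurable \<psi>)
    show "?h n \<in> borel_measurable torus" for n using hb by (simp add: ess_bounded_def)
    show "integrable torus (\<lambda>_. \<Sum>\<alpha>\<in>UNIV. \<bar>B \<alpha>\<bar> * \<bar>L \<alpha>\<bar>)" by (intro integrable_ess_bounded
      ess_bounded_const)
    show "AE x in torus. (\<lambda>n. ?h n x) \<longlonglongrightarrow> (\<Sum>\<alpha>\<in>UNIV. dPhi A i \<alpha> (F x) * pd (axis \<alpha> 1) \<psi> x)"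
      using torus_AE[OF lim]
    proof eventually_elim
      case (elim x)
      have "(\<lambda>n. dPhi A i \<alpha> (Fn n x)) \<longlonglongrightarrow> dPhi A i \<alpha> (F x)" for \<alpha>
        using continuous_dPhi[of A i \<alpha>] elim by (metis UNIV_I continuous_on_eq_continuous_at
          isCont_tendsto_compose open_UNIV)
      then show ?case by (intro tendsto_sum tendsto_mult tendsto_const)
    qed
    have "AE x in torus. \<forall>\<alpha>\<in>UNIV. \<bar>pd (axis \<alpha> 1) \<psi> x\<bar> \<le> L \<alpha>" using L by (intro AE_finite_allI) auto
    then show "AE x in torus. norm (?h n x) \<le> (\<Sum>\<alpha>\<in>UNIV. \<bar>B \<alpha>\<bar> * \<bar>L \<alpha>\<bar>)" for n
    proof eventually_elim
      case (elim x)
      have "norm (?h n x) \<le> (\<Sum>\<alpha>\<in>UNIV. norm (dPhi A i \<alpha> (Fn n x) * pd (axis \<alpha> 1) \<psi> x))" by (rule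
        norm_sum)
      also have "\<dots> \<le> (\<Sum>\<alpha>\<in>UNIV. \<bar>B \<alpha>\<bar> * \<bar>L \<alpha>\<bar>)"
      proof (rule sum_mono)
        fix \<alpha> :: 3
        have "\<bar>dPhi A i \<alpha> (Fn n x)\<bar> \<le> \<bar>B \<alpha>\<bar>" "\<bar>pd (axis \<alpha> 1) \<psi> x\<bar> \<le> \<bar>L \<alpha>\<bar>"
          using B[OF FnM, of \<alpha> n x] bspec[OF elim, of \<alpha>] by simp_all
        then show "norm (dPhi A i \<alpha> (Fn n x) * pd (axis \<alpha> 1) \<psi> x) \<le> \<bar>B \<alpha>\<bar> * \<bar>L \<alpha>\<bar>"
          by (simp add: abs_mult mult_mono)
      qed
      finally show ?case .
    qed
  qed
  then show ?thesis by (simp add: zero LIMSEQ_const_iff)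
qed

section \<open>Polynomials\<close>

definition monomial3 :: "nat^3 \<Rightarrow> real^3 \<Rightarrow> real" where
  "monomial3 a x = (\<Prod>i\<in>UNIV. (x $ i) ^ (a $ i))"

definition exponents :: "nat \<Rightarrow> (nat^3) set" where
  "exponents m = {a. (\<Sum>i\<in>UNIV. a $ i) \<le> m}"

lemma finite_vec_box: "finite A \<Longrightarrow> finite {a :: 'b^'n. \<forall>i. a $ i \<in> A}"
  by (rule finite_subset[of _ "vec_lambda ` (Pi\<^sub>E UNIV (\<lambda>_. A))"], force intro: image_eqI[of _ _
    "vec_nth _"])
     (intro finite_imageI finite_PiE, auto)

lemma finite_exponents: "finite (exponents m)"
proof (rule finite_subset)
  show "exponents m \<subseteq> {a. \<forall>i. a $ i \<in> {..m}}"
  proof (clarsimp simp: exponents_def)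
    fix a :: "nat^3" and i assume "(\<Sum>i\<in>UNIV. a $ i) \<le> m"
    then show "a $ i \<le> m" using member_le_sum[of i UNIV "\<lambda>i. a $ i"] by simp
  qed
qed (rule finite_vec_box, simp)

lemma polys_eq: "polys m = {q. \<exists>c. \<forall>x. q x = (\<Sum>a\<in>exponents m. c a * monomial3 a x)}"
  by (simp add: polys_def exponents_def monomial3_def)

lemma polys_add: "p \<in> polys m \<Longrightarrow> q \<in> polys m \<Longrightarrow> (\<lambda>x. p x + q x) \<in> polys m"
  unfolding polys_eq mem_Collect_eq by (elim exE, rule_tac x = "\<lambda>a. c a + ca a" in exI) (simp add:
    distrib_right sum.distrib)

lemma polys_cmult: "p \<in> polys m \<Longrightarrow> (\<lambda>x. r * p x) \<in> polys m"
  unfolding polys_eq mem_Collect_eq by (elim exE, rule_tac x = "\<lambda>a. r * c a" in exI) (simp add: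
    sum_distrib_left mult.assoc)

lemma polys_zero: "(\<lambda>x. 0) \<in> polys m"
  unfolding polys_eq mem_Collect_eq by (rule exI[of _ "\<lambda>_. 0"]) simp

lemma polys_sum: "(\<And>i. i \<in> I \<Longrightarrow> f i \<in> polys m) \<Longrightarrow> (\<lambda>x. \<Sum>i\<in>I. f i x) \<in> polys m"
  by (induction I rule: infinite_finite_induct) (auto intro: polys_add polys_zero)

lemma polys_monomial3: "a \<in> exponents m \<Longrightarrow> monomial3 a \<in> polys m"
  unfolding polys_eq mem_Collect_eq
  by (rule exI[of _ "\<lambda>b. if b = a then 1 else 0"])
     (simp add: if_distrib[of "\<lambda>u. u * _"] finite_exponents cong: if_cong)

lemma polys_const: "(\<lambda>x. r) \<in> polys m"
proof -
  have "monomial3 0 \<in> polys m" by (rule polys_monomial3) (simp add: exponents_def)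
  then have "(\<lambda>x. r * monomial3 0 x) \<in> polys m" by (rule polys_cmult)
  then show ?thesis by (simp add: monomial3_def)
qed

lemma polys_mult:
  assumes "p \<in> polys m" "q \<in> polys n"
  shows "(\<lambda>x. p x * q x) \<in> polys (m + n)"
proof -
  obtain c d where c: "p = (\<lambda>x. \<Sum>a\<in>exponents m. c a * monomial3 a x)"
    and d: "q = (\<lambda>x. \<Sum>a\<in>exponents n. d a * monomial3 a x)"
    using assms by (auto simp: polys_eq fun_eq_iff)
  have "(\<lambda>x. p x * q x) = (\<lambda>x. \<Sum>a\<in>exponents m. \<Sum>b\<in>exponents n. (c a * d b) * monomial3 (a + b) x)"
    by (simp add: c d sum_product monomial3_def power_add prod.distrib mult_ac)
  also have "\<dots> \<in> polys (m + n)"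
    by (intro polys_sum polys_cmult polys_monomial3) (auto simp: exponents_def sum.distrib intro:
      add_mono)
  finally show ?thesis .
qed

lemma Ck_power:
  fixes f :: "'a::euclidean_space \<Rightarrow> real"
  shows "Ck_on k UNIV f \<Longrightarrow> Ck_on k UNIV (\<lambda>x. f x ^ n)"
  by (induction n) (auto intro: Ck_const Ck_mult)

lemma Ck_prod:
  fixes f :: "'i \<Rightarrow> 'a::euclidean_space \<Rightarrow> real"
  shows "(\<And>i. i \<in> I \<Longrightarrow> Ck_on k UNIV (f i)) \<Longrightarrow> Ck_on k UNIV (\<lambda>x. \<Prod>i\<in>I. f i x)"
  by (induction I rule: infinite_finite_induct) (auto intro: Ck_const Ck_mult)

lemma Ck_monomial3: "Ck_on k UNIV (monomial3 a)"
  unfolding monomial3_def[abs_def] by (intro Ck_prod Ck_power linear_Ck bounded_linear_vec_nth)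

lemma Ck_polys:
  assumes "q \<in> polys m"
  shows "Ck_on k UNIV q"
proof -
  obtain c where c: "q = (\<lambda>x. \<Sum>a\<in>exponents m. c a * monomial3 a x)"
    using assms by (auto simp: polys_eq fun_eq_iff)
  show ?thesis unfolding c by (intro Ck_sum Ck_cmult Ck_monomial3)
qed

lemma continuous_polys: "q \<in> polys m \<Longrightarrow> continuous_on UNIV q"
  using Ck_polys[of q m 0] by simp

text \<open>For \<open>a $ \<alpha> = 0\<close> the truncated subtraction leaves the exponent at 0,
  which is harmless because of the zero prefactor.\<close>

lemma pd_monomial3:
  "pd (axis \<alpha> 1) (monomial3 a) x = real (a $ \<alpha>) * monomial3 (\<chi> i. if i = \<alpha> then a $ \<alpha> - 1 else a $ i) x"
proof -
  let ?P = "\<Prod>i\<in>UNIV - {\<alpha>}. (x $ i) ^ (a $ i)"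
  have split: "monomial3 b y = (y $ \<alpha>) ^ (b $ \<alpha>) * (\<Prod>i\<in>UNIV - {\<alpha>}. (y $ i) ^ (b $ i))" for b y
    unfolding monomial3_def by (rule prod.remove) auto
  have line: "monomial3 a (x + u *\<^sub>R axis \<alpha> 1) = (x $ \<alpha> + u) ^ (a $ \<alpha>) * ?P" for u
    unfolding split by (intro arg_cong2[of _ _ _ _ "(*)"] prod.cong) (auto simp: axis_def)
  have "((\<lambda>u. monomial3 a (x + u *\<^sub>R axis \<alpha> 1)) has_real_derivative pd (axis \<alpha> 1) (monomial3 a) (x +
    0 *\<^sub>R axis \<alpha> 1)) (at 0)"
    by (intro pd_has_real_derivative Ck_differentiable[OF Ck_monomial3[of 1]]) simp
  moreover have "((\<lambda>u. (x $ \<alpha> + u) ^ (a $ \<alpha>) * ?P) has_real_derivative real (a $ \<alpha>) * (x $ \<alpha>) ^ (a $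
    \<alpha> - 1) * ?P) (at 0)"
    by (auto intro!: derivative_eq_intros)
  ultimately have "pd (axis \<alpha> 1) (monomial3 a) x = real (a $ \<alpha>) * (x $ \<alpha>) ^ (a $ \<alpha> - 1) * ?P"
    unfolding line using DERIV_unique by fastforce
  also have "?P = (\<Prod>i\<in>UNIV - {\<alpha>}. (x $ i) ^ ((\<chi> i. if i = \<alpha> then a $ \<alpha> - 1 else a $ i) $ i))"
    by (intro prod.cong) auto
  finally show ?thesis unfolding split[of "vec_lambda _"] by simp
qed

lemma polys_pd:
  assumes "q \<in> polys m"
  shows "pd (axis \<alpha> 1) q \<in> polys (m - 1)"
proof -
  obtain c where c: "q = (\<lambda>x. \<Sum>a\<in>exponents m. c a * monomial3 a x)"
    using assms by (auto simp: polys_eq fun_eq_iff)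
  have d: "monomial3 a differentiable (at x)" for a x by (rule Ck_differentiable[OF Ck_monomial3[of
    1]]) simp
  have "pd (axis \<alpha> 1) q = (\<lambda>x. \<Sum>a\<in>exponents m. c a * (real (a $ \<alpha>) * monomial3 (\<chi> i. if i = \<alpha> then a
    $ \<alpha> - 1 else a $ i) x))"
    unfolding c by (rule ext) (subst pd_sum, auto simp: pd_mult d pd_monomial3 intro!:
      differentiable_mult d)
  also have "\<dots> \<in> polys (m - 1)"
  proof (rule polys_sum, rule polys_cmult)
    fix a assume a: "a \<in> exponents m"
    show "(\<lambda>x. real (a $ \<alpha>) * monomial3 (\<chi> i. if i = \<alpha> then a $ \<alpha> - 1 else a $ i) x) \<in> polys (m - 1)"
    \<comment> \<open>For exponent 0 the multi-index keeps its degree, possibly \<open>m\<close>,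
      and the zero factor removes the term; otherwise the degree really drops by one.\<close>
    proof (cases "a $ \<alpha> = 0")
      case True
      then show ?thesis by (simp add: polys_zero)
    next
      case False
      have "(\<Sum>i\<in>UNIV. (\<chi> i. if i = \<alpha> then a $ \<alpha> - 1 else a $ i) $ i) = (a $ \<alpha> - 1) + (\<Sum>i\<in>UNIV - {\<alpha>}.
        a $ i)"
        by (subst sum.remove[of _ \<alpha>]) (auto intro: sum.cong)
      also have "\<dots> = (\<Sum>i\<in>UNIV. a $ i) - 1" using False by (subst (2) sum.remove[of _ \<alpha>]) auto
      finally have "(\<chi> i. if i = \<alpha> then a $ \<alpha> - 1 else a $ i) \<in> exponents (m - 1)"
        using a by (simp add: exponents_def)
      then show ?thesis by (intro polys_cmult polys_monomial3)
    qed
  qed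
  finally show ?thesis .
qed

section \<open>The mesh\<close>

lemma lattice3_countable: "countable lattice3"
proof (rule countable_subset)
  show "lattice3 \<subseteq> range (\<lambda>n::int^3. \<chi> i. of_int (n $ i))"
  proof
    fix z assume "z \<in> lattice3"
    then have "z = (\<chi> i. of_int ((\<chi> i. \<lfloor>z $ i\<rfloor>) $ i))" by (auto simp: lattice3_def vec_eq_iff)
    then show "z \<in> range (\<lambda>n::int^3. \<chi> i. of_int (n $ i))" by (rule range_eqI)
  qed
qed simp

lemma lattice3_locally_finite: "finite {z \<in> lattice3. norm z \<le> r}"
proof (rule finite_subset)
  show "{z \<in> lattice3. norm z \<le> r} \<subseteq> {z. \<forall>i. z $ i \<in> {y \<in> \<int>. \<bar>y\<bar> \<le> r}}"
    using component_le_norm_cart order_trans by (fastforce simp: lattice3_def)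
  have "{y \<in> \<int>. \<bar>y\<bar> \<le> r} \<subseteq> of_int ` {\<lfloor>- r\<rfloor>..\<lceil>r\<rceil>}"
  proof clarsimp
    fix y :: real assume "y \<in> \<int>" "\<bar>y\<bar> \<le> r"
    then obtain n where "y = of_int n" by (auto elim: Ints_cases)
    moreover have "\<lfloor>- r\<rfloor> \<le> n" "n \<le> \<lceil>r\<rceil>" using \<open>\<bar>y\<bar> \<le> r\<close> \<open>y = of_int n\<close> by linarith+
    ultimately show "y \<in> real_of_int ` {\<lfloor>- r\<rfloor>..\<lceil>r\<rceil>}" by auto
  qed
  then have "finite {y \<in> \<int>. \<bar>y :: real\<bar> \<le> r}" by (rule finite_subset) simp
  then show "finite {z::real^3. \<forall>i. z $ i \<in> {y \<in> \<int>. \<bar>y\<bar> \<le> r}}" by (rule finite_vec_box)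
qed

locale torus_mesh =
  fixes \<T> :: "(real^3) set set"
  assumes mesh: "torus_triangulation \<T>"
begin

lemma element: "K \<in> \<T> \<Longrightarrow> compact K" "K \<in> \<T> \<Longrightarrow> convex K" "\<Union>\<T> = UNIV"
proof -
  have "\<forall>K\<in>\<T>. 3 simplex K" and "\<Union>\<T> = UNIV" using mesh by (simp_all add: torus_triangulation_def)
  then show "K \<in> \<T> \<Longrightarrow> compact K" "K \<in> \<T> \<Longrightarrow> convex K" "\<Union>\<T> = UNIV"
    using compact_simplex convex_simplex by blast+
qed

lemma element_measurable: "K \<in> \<T> \<Longrightarrow> K \<in> sets lebesgue"
  using lmeasurable_compact[OF element(1)] by (simp add: fmeasurable_def)

lemma representatives:
  obtains \<S> where "finite \<S>" "\<T> = {(+) z ` K | z K. z \<in> lattice3 \<and> K \<in> \<S>}" "\<S> \<subseteq> \<T>"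
proof -
  obtain \<S> where S: "finite \<S>" "\<T> = {(+) z ` K | z K. z \<in> lattice3 \<and> K \<in> \<S>}"
    using mesh unfolding torus_triangulation_def by (elim conjE exE) (rule that)
  have "K \<in> \<T>" if "K \<in> \<S>" for K
  proof -
    have "0 \<in> lattice3" by (simp add: lattice3_def)
    moreover have "K = (+) 0 ` K" by simp
    ultimately show ?thesis using that unfolding S(2) by blast
  qed
  then have "\<S> \<subseteq> \<T>" by blast
  with S show ?thesis by (rule that)
qed

lemma countable_mesh: "countable \<T>"
proof -
  obtain \<S> where S: "finite \<S>" "\<T> = {(+) z ` K | z K. z \<in> lattice3 \<and> K \<in> \<S>}" "\<S> \<subseteq> \<T>" by (rule
    representatives)
  have "\<T> = (\<lambda>(z, K). (+) z ` K) ` (lattice3 \<times> \<S>)" unfolding S(2) by auto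
  then show ?thesis using S(1) lattice3_countable by (simp add: countable_finite)
qed

text \<open>Elements are convex, so their frontiers are null sets, and there are only countably many
  of them.\<close>

lemma AE_interior: "AE x in lebesgue. \<exists>K\<in>\<T>. x \<in> interior K"
proof -
  have "AE x in lebesgue. x \<notin> frontier K" if "K \<in> \<T>" for K :: "(real^3) set"
  proof -
    have "frontier K \<in> null_sets lebesgue"
      using negligible_convex_frontier[OF element(2)[OF that]] negligible_iff_null_sets by blast
    then show ?thesis by (rule AE_I') auto
  qed
  then have "AE x in lebesgue. \<forall>K\<in>\<T>. x \<notin> frontier K" by (simp add: AE_ball_countable[OF countable_mesh])
  then show ?thesis
  proof eventually_elim
    case (elim x)
    obtain K where K: "K \<in> \<T>" "x \<in> K" using element(3) by blast
    then have "x \<in> interior K" using elim closure_subset by (auto simp: frontier_def)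
    with K show ?case by blast
  qed
qed

text \<open>Only finitely many lattice vectors move one of the finitely many bounded representatives
  into a given ball. Finiteness is what the gluing of Lipschitz bounds along a segment
  requires.\<close>

lemma locally_finite: "finite {K \<in> \<T>. K \<inter> cball 0 r \<noteq> {}}"
proof -
  obtain \<S> where S: "finite \<S>" "\<T> = {(+) z ` K | z K. z \<in> lattice3 \<and> K \<in> \<S>}" "\<S> \<subseteq> \<T>" by (rule
    representatives)
  have "bounded (\<Union>\<S>)" using S element(1) by (intro bounded_Union) (auto intro: compact_imp_bounded)
  then obtain R where R: "\<And>x K. x \<in> K \<Longrightarrow> K \<in> \<S> \<Longrightarrow> norm x \<le> R" unfolding bounded_iff by blast
  have "{K \<in> \<T>. K \<inter> cball 0 r \<noteq> {}} \<subseteq> (\<lambda>(z, K). (+) z ` K) ` ({z \<in> lattice3. norm z \<le> r + R} \<times> \<S>)"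
  proof
    fix K assume "K \<in> {K \<in> \<T>. K \<inter> cball 0 r \<noteq> {}}"
    then obtain x where "K \<in> \<T>" "x \<in> K" "x \<in> cball 0 r" by blast
    then obtain z L y where z: "z \<in> lattice3" "L \<in> \<S>" "K = (+) z ` L" "x = z + y" "y \<in> L" unfolding
      S(2) by blast
    have "norm z \<le> norm x + norm y" using norm_triangle_ineq4[of x y] z(4) by simp
    also have "\<dots> \<le> r + R" using R[OF z(5,2)] \<open>x \<in> cball 0 r\<close> by simp
    finally show "K \<in> (\<lambda>(z, K). (+) z ` K) ` ({z \<in> lattice3. norm z \<le> r + R} \<times> \<S>)" using z by force
  qed
  then show ?thesis by (rule finite_subset) (intro finite_imageI finite_cartesian_product
    lattice3_locally_finite S)
qed

text \<open>The Lipschitz constant is uniform, since the finitely many representatives determine the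
  function up to lattice translation. Polynomials are prescribed on closed elements and so agree on
  common faces. Along a segment the elements cut out finitely many closed sets of parameters, and
  the bounds on these combine to one on the whole interval.\<close>

lemma piecewise_polynomial_admissible:
  fixes f :: "real^3 \<Rightarrow> real"
  assumes per: "periodic f" and poly: "\<And>K. K \<in> \<T> \<Longrightarrow> \<exists>q\<in>polys m. \<forall>x\<in>K. f x = q x"
  shows "admissible f"
proof -
  obtain \<S> where S: "finite \<S>" "\<T> = {(+) z ` K | z K. z \<in> lattice3 \<and> K \<in> \<S>}" "\<S> \<subseteq> \<T>" by (rule
    representatives)
  have "\<exists>L. L-lipschitz_on K f" if K: "K \<in> \<T>" for K
  proof -
    obtain q where q: "q \<in> polys m" "\<And>x. x \<in> K \<Longrightarrow> f x = q x" using poly[OF K] by blast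
    obtain R where R: "K \<subseteq> cball 0 R"
      using bounded_subset_ballD[OF compact_imp_bounded[OF element(1)[OF K]], of 0]
        ball_subset_cball by blast
    have "admissible q" by (rule C1_imp_admissible[OF Ck_polys[OF q(1)]])
    then obtain L where "L-lipschitz_on (cball 0 R) q" unfolding admissible_def by blast
    then have "L-lipschitz_on K q" using R lipschitz_on_subset by blast
    then have "L-lipschitz_on K f" by (rule lipschitz_on_transform) (rule q(2))
    then show ?thesis ..
  qed
  then obtain L where L: "\<And>K. K \<in> \<T> \<Longrightarrow> (L K)-lipschitz_on K f" by metis
  define M where "M = (\<Sum>K\<in>\<S>. L K)"
  have Lnn: "0 \<le> L K" if "K \<in> \<S>" for K using L S(3) that lipschitz_on_nonneg by blast
  have M: "M-lipschitz_on K f" if "K \<in> \<T>" for K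
  proof -
    obtain z K' where z: "z \<in> lattice3" "K' \<in> \<S>" "K = (+) z ` K'" using \<open>K \<in> \<T>\<close> unfolding S(2) by blast
    have "L K' \<le> M" unfolding M_def using S(1) z(2) Lnn by (intro member_le_sum) auto
    then have M': "M-lipschitz_on K' f" using L[of K'] S(3) z(2) lipschitz_on_mono by blast
    have shift: "f (z + x) = f x" for x using per z(1) by (simp add: periodic_def add.commute)
    show ?thesis
      unfolding z(3)
    proof (rule lipschitz_onI)
      fix x y assume "x \<in> (+) z ` K'" "y \<in> (+) z ` K'"
      then show "dist (f x) (f y) \<le> M * dist x y" using lipschitz_onD[OF M'] by (auto simp: shift)
    qed (rule lipschitz_on_nonneg[OF M'])
  qed
  have M0: "0 \<le> M" unfolding M_def using Lnn by (rule sum_nonneg)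
  have global: "dist (f x) (f y) \<le> M * dist x y" for x y
  proof -
    define g where "g t = x + t *\<^sub>R (y - x)" for t :: real
    have gc: "continuous_on UNIV g" unfolding g_def by (intro continuous_intros)
    have gd: "dist (g s) (g t) = dist s t * dist x y" for s t
      by (simp add: g_def dist_norm left_diff_distrib[symmetric] scaleR_diff_left[symmetric]
        norm_minus_commute)
    define r where "r = max (norm x) (norm y)"
    have seg: "g t \<in> cball 0 r" if "t \<in> {0..1}" for t
    proof -
      have "g t = (1 - t) *\<^sub>R x + t *\<^sub>R y" by (simp add: g_def algebra_simps)
      also have "\<dots> \<in> cball 0 r" using that by (intro convexD[OF convex_cball]) (auto simp: r_def)
      finally show ?thesis .
    qed
    let ?I = "{K \<in> \<T>. K \<inter> cball 0 r \<noteq> {}}"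
    have "(M * dist x y)-lipschitz_on {0..1} (\<lambda>t. f (g t))"
    proof (rule lipschitz_on_closed_Union[where I = ?I and U = "\<lambda>K. g -` K"])
      fix K assume K: "K \<in> ?I"
      show "closed (g -` K)"
        using K element(1) continuous_closed_vimage[OF compact_imp_closed] gc by (auto simp:
          continuous_on_eq_continuous_at)
      show "(M * dist x y)-lipschitz_on (g -` K) (\<lambda>t. f (g t))"
      proof (rule lipschitz_onI)
        fix s t assume "s \<in> g -` K" "t \<in> g -` K"
        then have "dist (f (g s)) (f (g t)) \<le> M * dist (g s) (g t)" using lipschitz_onD[OF M[of K]]
          K by auto
        then show "dist (f (g s)) (f (g t)) \<le> M * dist x y * dist s t" by (simp add: gd mult_ac)
      qed (simp add: M0)
    next
      show "{0..1} \<subseteq> (\<Union>K\<in>?I. g -` K)"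
      proof
        fix t :: real assume "t \<in> {0..1}"
        moreover obtain K where "K \<in> \<T>" "g t \<in> K" using element(3) by blast
        ultimately show "t \<in> (\<Union>K\<in>?I. g -` K)" using seg[of t] by blast
      qed
    qed (auto simp: M0 locally_finite)
    from lipschitz_onD[OF this, of 0 1] show ?thesis by (simp add: g_def)
  qed
  show ?thesis
    unfolding admissible_def
  proof (intro conjI allI)
    show "\<exists>L. L-lipschitz_on (cball 0 r) f" for r
      using global M0 by (intro exI[of _ M] lipschitz_onI)
    show "AE x in lebesgue. f differentiable (at x)"
      using AE_interior
    proof eventually_elim
      case (elim x)
      then obtain K where K: "K \<in> \<T>" "x \<in> interior K" by blast
      obtain q where q: "q \<in> polys m" "\<And>x. x \<in> K \<Longrightarrow> f x = q x" using poly[OF K(1)] by blast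
      have "eventually (\<lambda>y. y \<in> interior K) (nhds x)" using K(2) by (intro eventually_nhds_in_open) auto
      then have "eventually (\<lambda>y. q y = f y) (nhds x)"
        by eventually_elim (metis q(2) interior_subset subsetD)
      then show ?case using differentiable_cong_ev(1)[OF Ck_differentiable[OF Ck_polys[OF q(1), of
        1]]] by simp
    qed
  qed
qed

lemma pd_piecewise_polynomial:
  assumes "x \<in> interior K" "q \<in> polys m" "\<And>x. x \<in> K \<Longrightarrow> f x = q x"
  shows "pd b f x = pd b q x"
proof -
  have "eventually (\<lambda>y. y \<in> interior K) (nhds x)" using assms(1) by (intro eventually_nhds_in_open) auto
  then have "eventually (\<lambda>y. q y = f y) (nhds x)"
    by eventually_elim (metis assms(3) interior_subset subsetD)
  then show ?thesis by (rule differentiable_cong_ev(2)[rotated]) (rule Ck_differentiable[OF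
    Ck_polys[OF assms(2), of 1]], simp)
qed

lemma AE_element: "(AE x in lebesgue_on K. P x) \<longleftrightarrow> (AE x in lebesgue. x \<in> K \<longrightarrow> P x)" if "K \<in> \<T>"
  using element_measurable[OF that] by (subst AE_restrict_space_iff) auto

section \<open>Functions in the finite element spaces\<close>

lemma U_space_periodic: "\<phi> \<in> U_space \<T> k \<Longrightarrow> periodic \<phi>"
  and U_space_continuous: "\<phi> \<in> U_space \<T> k \<Longrightarrow> continuous_on UNIV \<phi>"
  by (auto simp: U_space_def)

lemma U_space_admissible:
  assumes "\<phi> \<in> U_space \<T> k"
  shows "admissible (\<lambda>x. \<phi> x $ i)"
  by (rule piecewise_polynomial_admissible[of _ k]) (use assms in \<open>auto simp: U_space_def periodic_def\<close>)

lemma U_space_add: "\<phi> \<in> U_space \<T> k \<Longrightarrow> \<psi> \<in> U_space \<T> k \<Longrightarrow> (\<lambda>x. \<phi> x + \<psi> x) \<in> U_space \<T> k"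
  unfolding U_space_def
proof (clarsimp, intro conjI ballI allI)
  fix K i assume "K \<in> \<T>" "\<forall>K\<in>\<T>. \<forall>i. \<exists>q\<in>polys k. \<forall>x\<in>K. \<phi> x $ i = q x" "\<forall>K\<in>\<T>. \<forall>i. \<exists>q\<in>polys k. \<forall>x\<in>K. \<psi>
    x $ i = q x"
  then obtain p q where "p \<in> polys k" "q \<in> polys k" "\<forall>x\<in>K. \<phi> x $ i = p x" "\<forall>x\<in>K. \<psi> x $ i = q x" by meson
  then show "\<exists>q\<in>polys k. \<forall>x\<in>K. \<phi> x $ i + \<psi> x $ i = q x" by (intro bexI[OF _ polys_add[of p k q]]) auto
qed (auto simp: periodic_def intro: continuous_on_add)

lemma U_space_scale: "\<phi> \<in> U_space \<T> k \<Longrightarrow> (\<lambda>x. c *\<^sub>R \<phi> x) \<in> U_space \<T> k"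
  unfolding U_space_def
proof (clarsimp, intro conjI ballI allI)
  fix K i assume "K \<in> \<T>" "\<forall>K\<in>\<T>. \<forall>i. \<exists>q\<in>polys k. \<forall>x\<in>K. \<phi> x $ i = q x"
  then obtain p where "p \<in> polys k" "\<forall>x\<in>K. \<phi> x $ i = p x" by meson
  then show "\<exists>q\<in>polys k. \<forall>x\<in>K. c * \<phi> x $ i = q x" by (intro bexI[OF _ polys_cmult[of p]]) auto
qed (auto simp: periodic_def intro: continuous_intros)

lemma U_space_diff: "\<phi> \<in> U_space \<T> k \<Longrightarrow> \<psi> \<in> U_space \<T> k \<Longrightarrow> (\<lambda>x. \<phi> x - \<psi> x) \<in> U_space \<T> k"
  using U_space_add[of \<phi> k "\<lambda>x. (-1) *\<^sub>R \<psi> x"] U_space_scale[of \<psi> k "-1"] by simp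

lemma U_space_zero: "(\<lambda>x. 0) \<in> U_space \<T> k"
  unfolding U_space_def using polys_zero by (auto simp: periodic_def intro!: bexI[of _ "\<lambda>x. 0"])

lemma DG_space_polys:
  assumes "f \<in> DG_space \<T> m" "K \<in> \<T>" "b \<in> Basis"
  obtains q where "q \<in> polys m" "AE x in lebesgue. x \<in> K \<longrightarrow> f x \<bullet> b = q x"
  using assms that unfolding DG_space_def AE_element[OF assms(2), symmetric] by blast

lemma DG_space_periodic: "f \<in> DG_space \<T> m \<Longrightarrow> periodic f"
  by (auto simp: DG_space_def L2_torus_def)

text \<open>Membership in \<open>L2_torus\<close> gives measurability over the unit cube. Over the
  whole space it is pieced together from the countably many elements, on which every component is a
  polynomial up to a null set.\<close>

lemma DG_space_measurable:
  fixes f :: "real^3 \<Rightarrow> 'a::euclidean_space"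
  assumes f: "f \<in> DG_space \<T> m"
  shows "f \<in> borel_measurable lebesgue"
proof (rule measurable_piecewise_restrict[OF countable_mesh])
  show "K \<inter> space lebesgue \<in> sets lebesgue" if "K \<in> \<T>" for K using element_measurable[OF that] by simp
  show "space lebesgue \<subseteq> \<Union>\<T>" using element(3) by simp
  show "f \<in> borel_measurable (lebesgue_on K)" if K: "K \<in> \<T>" for K
    unfolding borel_measurable_euclidean_space[of f]
  proof
    fix b :: 'a assume b: "b \<in> Basis"
    obtain q where q: "q \<in> polys m" "AE x in lebesgue. x \<in> K \<longrightarrow> f x \<bullet> b = q x"
      using DG_space_polys[OF f K b] by blast
    have "q \<in> borel_measurable lebesgue"
      using continuous_polys[OF q(1)] by (intro measurable_completion) (auto intro:
        borel_measurable_continuous_onI)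
    then have "(\<lambda>x. indicator K x *\<^sub>R q x) \<in> borel_measurable lebesgue"
      using element_measurable[OF K] by (intro borel_measurable_scaleR borel_measurable_indicator)
    moreover have "AE x in lebesgue. indicator K x *\<^sub>R q x = indicator K x *\<^sub>R (f x \<bullet> b)"
      using q(2) by eventually_elim (auto simp: indicator_def)
    ultimately have "(\<lambda>x. indicator K x *\<^sub>R (f x \<bullet> b)) \<in> borel_measurable lebesgue" by (rule
      borel_measurable_AE)
    then show "(\<lambda>x. f x \<bullet> b) \<in> borel_measurable (lebesgue_on K)"
      using element_measurable[OF K] by (subst borel_measurable_restrict_space_iff) auto
  qed
qed

text \<open>Polynomials are bounded on the finitely many compact representatives; periodicity covers
  the translates, and countability of the mesh keeps the exceptional set null.\<close>

lemma DG_space_bounded: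
  fixes f :: "real^3 \<Rightarrow> 'a::euclidean_space"
  assumes f: "f \<in> DG_space \<T> m"
  shows "\<exists>M. AE x in lebesgue. norm (f x) \<le> M"
proof -
  obtain \<S> where S: "finite \<S>" "\<T> = {(+) z ` K | z K. z \<in> lattice3 \<and> K \<in> \<S>}" "\<S> \<subseteq> \<T>" by (rule
    representatives)
  have "\<exists>B\<ge>0. AE x in lebesgue. x \<in> K \<longrightarrow> norm (f x) \<le> B" if "K \<in> \<S>" for K
  proof -
    have K: "K \<in> \<T>" using S(3) that by blast
    obtain R where R: "K \<subseteq> cball 0 R"
      using bounded_subset_ballD[OF compact_imp_bounded[OF element(1)[OF K]], of 0]
        ball_subset_cball by blast
    have "\<exists>B. AE x in lebesgue. x \<in> K \<longrightarrow> \<bar>f x \<bullet> b\<bar> \<le> B" if b: "b \<in> Basis" for b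
    proof -
      obtain q where q: "q \<in> polys m" "AE x in lebesgue. x \<in> K \<longrightarrow> f x \<bullet> b = q x"
        using DG_space_polys[OF f K b] by blast
      obtain B where B: "\<And>x. norm x \<le> R \<Longrightarrow> norm (q x) \<le> B"
        using continuous_bounded_on_ball[OF continuous_polys[OF q(1)]] by blast
      have "AE x in lebesgue. x \<in> K \<longrightarrow> \<bar>f x \<bullet> b\<bar> \<le> B"
        using q(2) by eventually_elim (use B R in auto)
      then show ?thesis ..
    qed
    then have "\<forall>b\<in>Basis. \<exists>B. AE x in lebesgue. x \<in> K \<longrightarrow> \<bar>f x \<bullet> b\<bar> \<le> B" by blast
    from bchoice[OF this] obtain B where "\<forall>b\<in>Basis. AE x in lebesgue. x \<in> K \<longrightarrow> \<bar>f x \<bullet> b\<bar> \<le> B b"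
      by (elim exE) (rule that)
    then have "AE x in lebesgue. \<forall>b\<in>Basis. x \<in> K \<longrightarrow> \<bar>f x \<bullet> b\<bar> \<le> B b" by (intro AE_finite_allI) auto
    then have "AE x in lebesgue. x \<in> K \<longrightarrow> norm (f x) \<le> (\<Sum>b\<in>Basis. \<bar>B b\<bar>)"
    proof eventually_elim
      case (elim x)
      show ?case
      proof
        assume "x \<in> K"
        then have "(\<Sum>b\<in>Basis. \<bar>f x \<bullet> b\<bar>) \<le> (\<Sum>b\<in>Basis. \<bar>B b\<bar>)"
          using elim by (intro sum_mono) (meson abs_ge_self order_trans)
        then show "norm (f x) \<le> (\<Sum>b\<in>Basis. \<bar>B b\<bar>)" using norm_le_l1[of "f x"] by simp
      qed
    qed
    then show ?thesis by (intro exI[of _ "\<Sum>b\<in>Basis. \<bar>B b\<bar>"]) (simp add: sum_nonneg)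
  qed
  then have "\<forall>K\<in>\<S>. \<exists>B. 0 \<le> B \<and> (AE x in lebesgue. x \<in> K \<longrightarrow> norm (f x) \<le> B)" by blast
  from bchoice[OF this]
  obtain B where "\<forall>K\<in>\<S>. 0 \<le> B K \<and> (AE x in lebesgue. x \<in> K \<longrightarrow> norm (f x) \<le> B K)"
    by (elim exE) (rule that)
  then have B: "\<And>K. K \<in> \<S> \<Longrightarrow> 0 \<le> B K" "\<And>K. K \<in> \<S> \<Longrightarrow> AE x in lebesgue. x \<in> K \<longrightarrow> norm (f x) \<le> B K"
    by blast+
  have le: "B K \<le> (\<Sum>K\<in>\<S>. B K)" if "K \<in> \<S>" for K using that S(1) B(1) by (intro member_le_sum) auto
  have "AE x in lebesgue. x \<in> K \<longrightarrow> norm (f x) \<le> (\<Sum>K\<in>\<S>. B K)" if "K \<in> \<T>" for K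
  proof -
    obtain z K' where z: "z \<in> lattice3" "K' \<in> \<S>" "K = (+) z ` K'" using \<open>K \<in> \<T>\<close> unfolding S(2) by blast
    have "AE x in lebesgue. x + (- z) \<in> K' \<longrightarrow> norm (f (x + (- z))) \<le> B K'"
      by (rule AE_lebesgue_shift[OF B(2)[OF z(2)]])
    then show ?thesis
    proof eventually_elim
      case (elim x)
      show ?case
      proof
        assume "x \<in> K"
        then have "x + (- z) \<in> K'" unfolding z(3) by auto
        then have "norm (f (x + (- z))) \<le> B K'" using elim by simp
        moreover have "f (x + (- z)) = f x" using periodic_diff[OF DG_space_periodic[OF f] z(1)] by simp
        ultimately show "norm (f x) \<le> (\<Sum>K\<in>\<S>. B K)" using le[OF z(2)] by simp
      qed
    qed
  qed
  then have "AE x in lebesgue. \<forall>K\<in>\<T>. x \<in> K \<longrightarrow> norm (f x) \<le> (\<Sum>K\<in>\<S>. B K)"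
    by (subst AE_ball_countable[OF countable_mesh]) blast
  then have "AE x in lebesgue. norm (f x) \<le> (\<Sum>K\<in>\<S>. B K)"
    by eventually_elim (use element(3) in blast)
  then show ?thesis by blast
qed

text \<open>Supplies the local hypothesis of \<open>weak_piola\<close>. Almost every point is
  interior to an element, where one continuous polynomial field agrees with \<open>f\<close> almost
  everywhere nearby and also at the point itself.\<close>

lemma DG_space_locally_continuous:
  fixes f :: "real^3 \<Rightarrow> 'a::euclidean_space"
  assumes f: "f \<in> DG_space \<T> m"
  shows "AE x in lebesgue. \<exists>q e. isCont q x \<and> q x = f x \<and> 0 < e \<and> (AE y in lebesgue. dist y x < e \<longrightarrow>
    f y = q y)"
proof -
  have "\<exists>q. continuous_on UNIV q \<and> (AE x in lebesgue. x \<in> K \<longrightarrow> f x = q x)" if K: "K \<in> \<T>" for K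
  proof -
    have "\<forall>b\<in>Basis. \<exists>q. q \<in> polys m \<and> (AE x in lebesgue. x \<in> K \<longrightarrow> f x \<bullet> b = q x)"
      using DG_space_polys[OF f K] by blast
    from bchoice[OF this]
    obtain q where q: "\<forall>b\<in>Basis. q b \<in> polys m \<and> (AE x in lebesgue. x \<in> K \<longrightarrow> f x \<bullet> b = q b x)"
      by (elim exE) (rule that)
    then have "AE x in lebesgue. \<forall>b\<in>Basis. x \<in> K \<longrightarrow> f x \<bullet> b = q b x" by (intro AE_finite_allI) auto
    then have "AE x in lebesgue. x \<in> K \<longrightarrow> f x = (\<Sum>b\<in>Basis. q b x *\<^sub>R b)"
    proof eventually_elim
      case (elim x)
      then show ?case by (metis (no_types, lifting) euclidean_representation sum.cong)
    qed
    moreover have "continuous_on UNIV (\<lambda>x. \<Sum>b\<in>Basis. q b x *\<^sub>R b)"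
      by (intro continuous_intros continuous_polys[of _ m]) (use q in blast)
    ultimately show ?thesis by blast
  qed
  then have "\<forall>K\<in>\<T>. \<exists>q. continuous_on UNIV q \<and> (AE x in lebesgue. x \<in> K \<longrightarrow> f x = q x)" by blast
  from bchoice[OF this]
  obtain q where "\<forall>K\<in>\<T>. continuous_on UNIV (q K) \<and> (AE x in lebesgue. x \<in> K \<longrightarrow> f x = q K x)"
    by (elim exE) (rule that)
  then have q: "\<And>K. K \<in> \<T> \<Longrightarrow> continuous_on UNIV (q K)"
    "\<And>K. K \<in> \<T> \<Longrightarrow> AE x in lebesgue. x \<in> K \<longrightarrow> f x = q K x" by blast+
  have "AE x in lebesgue. \<forall>K\<in>\<T>. x \<in> K \<longrightarrow> f x = q K x"
    using q(2) by (simp add: AE_ball_countable[OF countable_mesh])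
  with AE_interior show ?thesis
  proof eventually_elim
    case (elim x)
    then obtain K where K: "K \<in> \<T>" "x \<in> interior K" by blast
    then obtain e where e: "0 < e" "ball x e \<subseteq> interior K" using open_contains_ball open_interior by
      blast
    have sub: "y \<in> K" if "dist y x < e" for y using that e(2) interior_subset by (force simp:
      dist_commute)
    have "isCont (q K) x" using q(1)[OF K(1)] by (simp add: continuous_on_eq_continuous_at)
    moreover have "q K x = f x" using elim(2) K interior_subset by fastforce
    moreover have "AE y in lebesgue. dist y x < e \<longrightarrow> f y = q K y"
      using q(2)[OF K(1)] by eventually_elim (use sub in blast)
    ultimately show ?case using e(1) by blast
  qed
qed

lemma DG_spaceI:
  fixes f :: "real^3 \<Rightarrow> 'a::euclidean_space"
  assumes per: "periodic f" and bnd: "ess_bounded f"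
    and poly: "\<And>K b. K \<in> \<T> \<Longrightarrow> b \<in> Basis \<Longrightarrow> \<exists>q\<in>polys m. AE x in lebesgue. x \<in> K \<longrightarrow> f x \<bullet> b = q x"
  shows "f \<in> DG_space \<T> m"
proof -
  have "ess_bounded (\<lambda>x. (norm (f x))\<^sup>2)"
    by (rule ess_bounded_compose[OF bnd]) (intro continuous_intros)
  then have "integrable torus (\<lambda>x. (norm (f x))\<^sup>2)" by (rule integrable_ess_bounded)
  with per bnd poly show ?thesis
    by (auto simp: DG_space_def L2_torus_def ess_bounded_def AE_element)
qed

lemma H_space_facts:
  assumes "\<xi> \<in> H_space \<T> k"
  shows "\<xi> \<in> borel_measurable lebesgue" "\<exists>M. AE x in lebesgue. norm (\<xi> x) \<le> M" "periodic \<xi>"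
    "ess_bounded \<xi>"
proof -
  have d: "(\<lambda>x. fst (\<xi> x)) \<in> DG_space \<T> (k - 1)" "(\<lambda>x. fst (snd (\<xi> x))) \<in> DG_space \<T> (2 * (k - 1))"
    "(\<lambda>x. snd (snd (\<xi> x))) \<in> DG_space \<T> (3 * (k - 1))"
    using assms by (auto simp: H_space_def)
  have "(\<lambda>x. (fst (\<xi> x), fst (snd (\<xi> x)), snd (snd (\<xi> x)))) \<in> borel_measurable lebesgue"
    by (intro borel_measurable_Pair d[THEN DG_space_measurable])
  then show m: "\<xi> \<in> borel_measurable lebesgue" by simp
  obtain M1 M2 M3 where M: "AE x in lebesgue. norm (fst (\<xi> x)) \<le> M1" "AE x in lebesgue. norm (fst
    (snd (\<xi> x))) \<le> M2"
    "AE x in lebesgue. norm (snd (snd (\<xi> x))) \<le> M3"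
    using d[THEN DG_space_bounded] by metis
  then have b: "AE x in lebesgue. norm (\<xi> x) \<le> M1 + (M2 + M3)"
  proof eventually_elim
    case (elim x)
    have "norm (\<xi> x) \<le> norm (fst (\<xi> x)) + (norm (fst (snd (\<xi> x))) + norm (snd (snd (\<xi> x))))"
      using norm_Pair_le[of "fst (\<xi> x)" "snd (\<xi> x)"] norm_Pair_le[of "fst (snd (\<xi> x))" "snd (snd (\<xi>
        x))"] by simp
    then show ?case using elim by simp
  qed
  then show "\<exists>M. AE x in lebesgue. norm (\<xi> x) \<le> M" by blast
  show "periodic \<xi>"
    using d[THEN DG_space_periodic] unfolding periodic_def by (metis prod.collapse)
  show "ess_bounded \<xi>"
    by (rule ess_bounded_lebesgue[OF m]) (use b in eventually_elim, auto)
qed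

end

section \<open>The orthogonal projection\<close>

definition torus_inner :: "(real^3 \<Rightarrow> real^3) \<Rightarrow> (real^3 \<Rightarrow> real^3) \<Rightarrow> real" where
  "torus_inner f g = (LINT x|torus. f x \<bullet> g x)"

lemma ess_bounded_inner:
  fixes f g :: "real^3 \<Rightarrow> 'a::euclidean_space"
  shows "ess_bounded f \<Longrightarrow> ess_bounded g \<Longrightarrow> ess_bounded (\<lambda>x. f x \<bullet> g x)"
  using ess_bounded_compose2[of f g "\<lambda>z. fst z \<bullet> snd z"]
  by (simp add: continuous_on_inner continuous_on_fst continuous_on_snd continuous_on_id)

lemma torus_inner_integrable:
  fixes f g :: "real^3 \<Rightarrow> 'a::euclidean_space"
  assumes "continuous_on UNIV f" "continuous_on UNIV g"
  shows "integrable torus (\<lambda>x. f x \<bullet> g x)"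
  by (intro integrable_ess_bounded ess_bounded_inner ess_bounded_continuous assms)

lemma torus_inner_linear:
  assumes "continuous_on UNIV f" "continuous_on UNIV g" "continuous_on UNIV h"
  shows "torus_inner (\<lambda>x. f x + g x) h = torus_inner f h + torus_inner g h"
    and "torus_inner (\<lambda>x. f x - g x) h = torus_inner f h - torus_inner g h"
    and "torus_inner h (\<lambda>x. f x + g x) = torus_inner h f + torus_inner h g"
    and "torus_inner (\<lambda>x. c *\<^sub>R f x) h = c * torus_inner f h"
    and "torus_inner h (\<lambda>x. c *\<^sub>R f x) = c * torus_inner h f"
  by (simp_all add: torus_inner_def inner_add_left inner_add_right inner_diff_left
      torus_inner_integrable[OF assms(1,3)] torus_inner_integrable[OF assms(2,3)]
      torus_inner_integrable[OF assms(3,1)] torus_inner_integrable[OF assms(3,2)])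

lemma torus_inner_commute: "torus_inner f g = torus_inner g f"
  by (simp add: torus_inner_def inner_commute)

text \<open>The zero set is closed and contains almost every point of the open cube; hence it
  contains the open cube, its closure and, by periodicity, everything.\<close>

lemma torus_inner_definite:
  assumes c: "continuous_on UNIV f" and per: "periodic f" and 0: "torus_inner f f = 0"
  shows "f = (\<lambda>x. 0)"
proof -
  have "AE x in torus. f x \<bullet> f x = 0"
    using 0 integral_nonneg_eq_0_iff_AE[OF torus_inner_integrable[OF c c]] by (simp add:
      torus_inner_def)
  then have ae: "AE x in lebesgue. x \<in> cbox 0 1 \<longrightarrow> f x = 0"
    by (subst (asm) AE_restrict_space_iff) auto
  then have ae': "AE x in lebesgue. x \<in> box 0 1 \<longrightarrow> x \<in> {x. f x = 0}"
    by eventually_elim (use box_subset_cbox in blast)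
  have cl: "closed {x. f x = 0}" by (intro closed_Collect_eq c continuous_on_const)
  have "box 0 1 \<subseteq> {x. f x = 0}"
    using mem_closed_if_AE_lebesgue_open[OF open_box cl ae'] by blast
  then have "closure (box 0 1) \<subseteq> {x. f x = 0}" using cl by (rule closure_minimal)
  moreover have "closure (box 0 (1::real^3)) = cbox 0 1"
    by (rule closure_box) (simp add: interval_ne_empty_cart)
  ultimately have z: "x \<in> cbox 0 1 \<Longrightarrow> f x = 0" for x by blast
  show ?thesis
  proof
    fix x
    obtain w where w: "w \<in> lattice3" "x - w \<in> cbox 0 1" using lattice_translate_unit_cube by blast
    then show "f x = 0" using z[OF w(2)] periodic_diff[OF per w(1)] by simp
  qed
qed

text \<open>A field \<open>\<phi>\<close> is represented by the numbers \<open>\<phi> (X p) $ I p\<close> for \<open>p \<in> P\<close>, which are combinations of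
  the finitely many \<open>t j\<close>. A further generator enlarges the space by at most one dimension, which is
  made orthogonal to the rest as in the Gram-Schmidt process.\<close>

lemma finite_dimensional_projection:
  fixes U :: "(real^3 \<Rightarrow> real^3) set" and t :: "'j \<Rightarrow> 'p \<Rightarrow> real"
    and X :: "'p \<Rightarrow> real^3" and I :: "'p \<Rightarrow> 3"
  assumes "finite J"
    and "\<And>\<phi>. \<phi> \<in> U \<Longrightarrow> \<exists>c. \<forall>p\<in>P. \<phi> (X p) $ I p = (\<Sum>j\<in>J. c j * t j p)"
    and "\<And>\<phi> \<psi>. \<phi> \<in> U \<Longrightarrow> \<psi> \<in> U \<Longrightarrow> (\<lambda>x. \<phi> x + \<psi> x) \<in> U" and "\<And>c \<phi>. \<phi> \<in> U \<Longrightarrow> (\<lambda>x. c *\<^sub>R \<phi> x) \<in> U"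
    and "(\<lambda>x. 0) \<in> U"
    and "\<And>\<phi>. \<phi> \<in> U \<Longrightarrow> continuous_on UNIV \<phi>" and "\<And>\<phi>. \<phi> \<in> U \<Longrightarrow> periodic \<phi>"
    and "\<And>\<phi>. \<phi> \<in> U \<Longrightarrow> \<forall>p\<in>P. \<phi> (X p) $ I p = 0 \<Longrightarrow> \<phi> = (\<lambda>x. 0)"
    and "continuous_on UNIV f"
  shows "\<exists>u\<in>U. \<forall>\<phi>\<in>U. torus_inner (\<lambda>x. f x - u x) \<phi> = 0"
  using assms
proof (induction J arbitrary: U f rule: finite_induct)
  case empty
  have z: "\<phi> = (\<lambda>x. 0)" if \<phi>: "\<phi> \<in> U" for \<phi>
  proof (rule empty.prems(7)[OF \<phi>])
    obtain c where "\<forall>p\<in>P. \<phi> (X p) $ I p = (\<Sum>j\<in>{}. c j * t j p)" using empty.prems(1)[OF \<phi>] by (elim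
      exE) (rule that)
    then show "\<forall>p\<in>P. \<phi> (X p) $ I p = 0" by simp
  qed
  then have "torus_inner (\<lambda>x. f x - 0) \<phi> = 0" if "\<phi> \<in> U" for \<phi>
    using z[OF that] by (simp add: torus_inner_def)
  then show ?case by (intro bexI[of _ "\<lambda>x. 0"] ballI) (auto intro: empty.prems(4))
next
  case (insert j J)
  note add = insert.prems(2) and scale = insert.prems(3) and zero = insert.prems(4)
    and cont = insert.prems(5) and fc = insert.prems(8)
  \<comment> \<open>\<open>gen\<close> singles out the fields whose samples do without the new
    generator \<open>j\<close>; they form the subspace \<open>U'\<close> to which the induction
    hypothesis applies.\<close>
  define gen where "gen \<phi> \<longleftrightarrow> (\<exists>c. \<forall>p\<in>P. \<phi> (X p) $ I p = (\<Sum>j\<in>J. c j * t j p))" for \<phi> :: "real^3 \<Rightarrow> real^3"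
  define U' where "U' = {\<phi> \<in> U. gen \<phi>}"
  have gadd: "gen (\<lambda>x. \<phi> x + \<psi> x)" if g: "gen \<phi>" "gen \<psi>" for \<phi> \<psi>
  proof -
    obtain c d where "\<forall>p\<in>P. \<phi> (X p) $ I p = (\<Sum>j\<in>J. c j * t j p)" "\<forall>p\<in>P. \<psi> (X p) $ I p = (\<Sum>j\<in>J. d j *
      t j p)"
      using g unfolding gen_def by blast
    then show ?thesis
      unfolding gen_def by (intro exI[of _ "\<lambda>j. c j + d j"]) (simp add: distrib_right sum.distrib)
  qed
  have gscale: "gen (\<lambda>x. s *\<^sub>R \<phi> x)" if g: "gen \<phi>" for s \<phi>
  proof -
    obtain c where "\<forall>p\<in>P. \<phi> (X p) $ I p = (\<Sum>j\<in>J. c j * t j p)" using g unfolding gen_def by blast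
    then show ?thesis
      unfolding gen_def by (intro exI[of _ "\<lambda>j. s * c j"]) (simp add: sum_distrib_left mult.assoc)
  qed
  have gzero: "gen (\<lambda>x. 0)" unfolding gen_def by (intro exI[of _ "\<lambda>j. 0"]) simp
  have add': "\<phi> \<in> U' \<Longrightarrow> \<psi> \<in> U' \<Longrightarrow> (\<lambda>x. \<phi> x + \<psi> x) \<in> U'" for \<phi> \<psi>
    unfolding U'_def using add gadd by simp
  have scale': "\<phi> \<in> U' \<Longrightarrow> (\<lambda>x. s *\<^sub>R \<phi> x) \<in> U'" for s \<phi>
    unfolding U'_def using scale gscale by simp
  have IH: "\<exists>u\<in>U'. \<forall>\<phi>\<in>U'. torus_inner (\<lambda>x. g x - u x) \<phi> = 0" if "continuous_on UNIV g" for g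
  proof (rule insert.IH[of U'])
    show "\<exists>c. \<forall>p\<in>P. \<phi> (X p) $ I p = (\<Sum>j\<in>J. c j * t j p)" if "\<phi> \<in> U'" for \<phi>
      using that by (simp add: U'_def gen_def)
    show "(\<lambda>x. 0) \<in> U'" using zero gzero by (simp add: U'_def)
  qed (use add' scale' that insert.prems(5,6,7) in \<open>auto simp: U'_def\<close>)
  show ?case
  proof (cases "\<forall>\<phi>\<in>U. gen \<phi>")
    case True
    then have "U' = U" by (auto simp: U'_def)
    with IH[OF fc] show ?thesis by simp
  next
    case False
    then obtain b where b: "b \<in> U" "\<not> gen b" by blast
    obtain c where c: "\<forall>p\<in>P. b (X p) $ I p = (\<Sum>i\<in>insert j J. c i * t i p)" using insert.prems(1)[OF
      b(1)] by blast
    \<comment> \<open>Since \<open>b\<close> does involve \<open>j\<close>, a multiple of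
      \<open>b\<close> can remove \<open>j\<close> from any other field.\<close>
    have cj: "c j \<noteq> 0"
    proof
      assume "c j = 0"
      then have "gen b" unfolding gen_def using c insert.hyps by (intro exI[of _ c]) simp
      with b show False by simp
    qed
    obtain w where w: "w \<in> U'" "\<And>\<phi>. \<phi> \<in> U' \<Longrightarrow> torus_inner (\<lambda>x. b x - w x) \<phi> = 0"
      using IH[OF cont[OF b(1)]] by blast
    obtain u0 where u0: "u0 \<in> U'" "\<And>\<phi>. \<phi> \<in> U' \<Longrightarrow> torus_inner (\<lambda>x. f x - u0 x) \<phi> = 0"
      using IH[OF fc] by blast
    \<comment> \<open>The part of \<open>b\<close> orthogonal to \<open>U'\<close>. It is not zero,
      because otherwise \<open>b = w\<close> would lie in \<open>U'\<close>.\<close>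
    define b' where "b' x = b x - w x" for x
    have wU: "w \<in> U" "u0 \<in> U" using w u0 by (auto simp: U'_def)
    have b'U: "b' \<in> U"
      using add[OF b(1) scale[OF wU(1), of "-1"]] by (simp add: b'_def[abs_def])
    note cs = cont[OF wU(1)] cont[OF wU(2)] cont[OF b'U] fc
    define N where "N = torus_inner b' b'"
    have N: "N \<noteq> 0"
    proof
      assume "N = 0"
      then have "b' = (\<lambda>x. 0)"
        using torus_inner_definite[OF cont[OF b'U] insert.prems(6)[OF b'U]] by (simp add: N_def)
      then have "b = w" by (auto simp: b'_def[abs_def] fun_eq_iff)
      then show False using w(1) b(2) by (simp add: U'_def)
    qed
    \<comment> \<open>The Fourier coefficient of \<open>f\<close> along \<open>b'\<close>; the part
      \<open>u0\<close> contributes nothing to it, being orthogonal to \<open>b'\<close>.\<close>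
    define s where "s = torus_inner f b' / N"
    define u where "u x = u0 x + s *\<^sub>R b' x" for x
    have uU: "u \<in> U" using add[OF wU(2) scale[OF b'U, of s]] by (simp add: u_def[abs_def])
    have "torus_inner (\<lambda>x. f x - u x) \<phi> = 0" if \<phi>: "\<phi> \<in> U" for \<phi>
    proof -
      obtain d where d: "\<forall>p\<in>P. \<phi> (X p) $ I p = (\<Sum>i\<in>insert j J. d i * t i p)" using
        insert.prems(1)[OF \<phi>] by blast
      \<comment> \<open>Chosen so that the coefficient \<open>d j - r * c j\<close> of the generator
        \<open>j\<close> in \<open>\<phi>1\<close> is zero.\<close>
      define r where "r = d j / c j"
      define \<phi>1 where "\<phi>1 x = \<phi> x + (- r) *\<^sub>R b x" for x
      have "gen \<phi>1"
        unfolding gen_def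
      proof (intro exI[of _ "\<lambda>i. d i - r * c i"] ballI)
        fix p assume p: "p \<in> P"
        have "\<phi>1 (X p) $ I p = (\<Sum>i\<in>insert j J. d i * t i p) - r * (\<Sum>i\<in>insert j J. c i * t i p)"
          using c d p by (simp add: \<phi>1_def)
        also have "\<dots> = (\<Sum>i\<in>insert j J. (d i - r * c i) * t i p)"
          by (simp add: sum_subtractf sum_distrib_left algebra_simps)
        also have "\<dots> = (\<Sum>i\<in>J. (d i - r * c i) * t i p)"
          using insert.hyps cj by (simp add: r_def)
        finally show "\<phi>1 (X p) $ I p = (\<Sum>i\<in>J. (d i - r * c i) * t i p)" .
      qed
      moreover have "\<phi>1 \<in> U" using add[OF \<phi> scale[OF b(1), of "- r"]] by (simp add: \<phi>1_def[abs_def])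
      ultimately have \<phi>1: "\<phi>1 \<in> U'" by (simp add: U'_def)
      define \<phi>2 where "\<phi>2 x = \<phi>1 x + r *\<^sub>R w x" for x
      have \<phi>2: "\<phi>2 \<in> U'" using add'[OF \<phi>1 scale'[OF w(1), of r]] by (simp add: \<phi>2_def[abs_def])
      have c2: "continuous_on UNIV \<phi>2" using \<phi>2 cont by (simp add: U'_def)
      \<comment> \<open>The orthogonal splitting of \<open>\<phi>\<close> into a member of
        \<open>U'\<close> and a multiple of \<open>b'\<close>. The residual of \<open>f\<close> is
        tested against each part.\<close>
      have \<phi>eq: "\<phi> = (\<lambda>x. \<phi>2 x + r *\<^sub>R b' x)"
        by (simp add: fun_eq_iff \<phi>2_def \<phi>1_def b'_def algebra_simps)
      have ueq: "(\<lambda>x. f x - u x) = (\<lambda>x. (f x - u0 x) - s *\<^sub>R b' x)" by (simp add: u_def fun_eq_iff)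
      have e1: "torus_inner b' \<phi>2 = 0" using w(2)[OF \<phi>2] by (simp add: b'_def[abs_def])
      have e2: "torus_inner u0 b' = 0" using w(2)[OF u0(1)] torus_inner_commute by (simp add:
        b'_def[abs_def])
      have cfu: "continuous_on UNIV (\<lambda>x. f x - u0 x)" "continuous_on UNIV (\<lambda>x. s *\<^sub>R b' x)"
        "continuous_on UNIV (\<lambda>x. r *\<^sub>R b' x)"
        using cs by (auto intro!: continuous_intros)
      have "torus_inner (\<lambda>x. f x - u x) \<phi>
          = torus_inner (\<lambda>x. f x - u0 x) \<phi> - s * torus_inner b' \<phi>"
        unfolding ueq using torus_inner_linear(2)[OF cfu(1,2) cont[OF \<phi>]] torus_inner_linear(4)[OF
          cs(3) cs(3) cont[OF \<phi>]]
        by simp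
      also have "torus_inner (\<lambda>x. f x - u0 x) \<phi> = r * torus_inner f b'"
        unfolding \<phi>eq torus_inner_linear(3)[OF c2 cfu(3) cfu(1)] torus_inner_linear(5)[OF cs(3)
          cs(3) cfu(1)]
        using u0(2)[OF \<phi>2] torus_inner_linear(2)[OF fc cs(2) cs(3)] e2 by simp
      also have "torus_inner b' \<phi> = r * N"
        unfolding \<phi>eq torus_inner_linear(3)[OF c2 cfu(3) cs(3)] torus_inner_linear(5)[OF cs(3) cs(3)
          cs(3)]
        using e1 by (simp add: N_def)
      finally show ?thesis using N by (simp add: s_def)
    qed
    with uU show ?thesis by blast
  qed
qed

context torus_mesh
begin

text \<open>\<open>L2_proj\<close> is a definite description, so existence and uniqueness have to be
  shown together. Existence rests on finite dimension: a field in \<open>U_space\<close> is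
  determined by its polynomial coefficients on the finitely many representatives.\<close>

lemma L2_proj_U_space:
  assumes f: "continuous_on UNIV f"
  shows "L2_proj (U_space \<T> k) f \<in> U_space \<T> k"
    and "\<And>\<phi>. \<phi> \<in> U_space \<T> k \<Longrightarrow> torus_inner (\<lambda>x. f x - L2_proj (U_space \<T> k) f x) \<phi> = 0"
proof -
  let ?U = "U_space \<T> k"
  obtain \<S> where S: "finite \<S>" "\<T> = {(+) z ` K | z K. z \<in> lattice3 \<and> K \<in> \<S>}" "\<S> \<subseteq> \<T>" by (rule
    representatives)
  \<comment> \<open>Samples carry their element, because a point on a common face lies in several
    elements with possibly different polynomials. A generator is one monomial in one component on
    one element.\<close>
  let ?P = "{(K, x, i::3) | K x i. K \<in> \<S> \<and> x \<in> K}"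
  let ?J = "\<S> \<times> (UNIV :: 3 set) \<times> exponents k"
  let ?t = "\<lambda>(K', i', a) (K, x, i). if K' = K \<and> i' = i then monomial3 a x else 0"
  have "\<exists>u\<in>?U. \<forall>\<phi>\<in>?U. torus_inner (\<lambda>x. f x - u x) \<phi> = 0"
  proof (rule finite_dimensional_projection[where J = ?J and P = ?P and t = ?t
        and X = "\<lambda>(K, x, i). x" and I = "\<lambda>(K, x, i). i"])
    show "finite ?J" by (intro finite_cartesian_product S(1) finite_exponents finite)
    fix \<phi> assume \<phi>: "\<phi> \<in> ?U"
    have "\<forall>K\<in>\<T>. \<forall>i. \<exists>c. \<forall>x\<in>K. \<phi> x $ i = (\<Sum>a\<in>exponents k. c a * monomial3 a x)"
      using \<phi> unfolding U_space_def polys_eq by fastforce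
    then obtain c where c: "\<And>K i x. K \<in> \<T> \<Longrightarrow> x \<in> K \<Longrightarrow> \<phi> x $ i = (\<Sum>a\<in>exponents k. c K i a * monomial3 a x)"
      by metis
    have "\<phi> x $ i = (\<Sum>(K', i', a)\<in>?J. c K' i' a * ?t (K', i', a) (K, x, i))" if "K \<in> \<S>" "x \<in> K" for
      K x i
    proof -
      have "(\<Sum>(K', i', a)\<in>?J. c K' i' a * ?t (K', i', a) (K, x, i))
          = (\<Sum>K'\<in>\<S>. \<Sum>i'\<in>UNIV. \<Sum>a\<in>exponents k. c K' i' a * (if K' = K \<and> i' = i then monomial3 a x
            else 0))"
        by (simp add: sum.cartesian_product split_beta cong: if_cong)
      also have "\<dots> = (\<Sum>K'\<in>\<S>. if K' = K then \<Sum>i'\<in>UNIV. if i' = i then \<Sum>a\<in>exponents k. c K i a *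
        monomial3 a x else 0 else 0)"
      proof (rule sum.cong[OF refl])
        fix K' assume "K' \<in> \<S>"
        have "(\<Sum>a\<in>exponents k. c K' i' a * (if K' = K \<and> i' = i then monomial3 a x else 0))
            = (if i' = i then if K' = K then \<Sum>a\<in>exponents k. c K i a * monomial3 a x else 0 else 0)"
              for i'
          by (cases "K' = K"; cases "i' = i") simp_all
        then show "(\<Sum>i'\<in>UNIV. \<Sum>a\<in>exponents k. c K' i' a * (if K' = K \<and> i' = i then monomial3 a x
          else 0))
            = (if K' = K then \<Sum>i'\<in>UNIV. if i' = i then \<Sum>a\<in>exponents k. c K i a * monomial3 a x else
              0 else 0)"
          by simp
      qed
      also have "\<dots> = (\<Sum>a\<in>exponents k. c K i a * monomial3 a x)" using S(1) that by simp
      finally show ?thesis using c[of K x i] that S(3) by auto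
    qed
    then show "\<exists>c. \<forall>p\<in>?P. \<phi> (case p of (K, x, i) \<Rightarrow> x) $ (case p of (K, x, i) \<Rightarrow> i) = (\<Sum>j\<in>?J. c j * ?t
      j p)"
      by (intro exI[of _ "\<lambda>(K, i, a). c K i a"]) (auto simp: split_beta cong: if_cong)
  next
    \<comment> \<open>The samples separate fields: what vanishes on all representatives vanishes on
      every translate by periodicity.\<close>
    fix \<phi> assume \<phi>: "\<phi> \<in> ?U" and z: "\<forall>p\<in>?P. \<phi> (case p of (K, x, i) \<Rightarrow> x) $ (case p of (K, x, i) \<Rightarrow> i) = 0"
    have "\<phi> x $ i = 0" if "x \<in> K" "K \<in> \<S>" for x K i using z that by auto
    then have zS: "\<phi> x = 0" if "x \<in> K" "K \<in> \<S>" for x K using that by (simp add: vec_eq_iff)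
    show "\<phi> = (\<lambda>x. 0)"
    proof
      fix x
      obtain K where "K \<in> \<T>" "x \<in> K" using element(3) by blast
      then obtain w L y where "w \<in> lattice3" "L \<in> \<S>" "x = w + y" "y \<in> L" unfolding S(2) by blast
      then show "\<phi> x = 0" using zS[of y L] U_space_periodic[OF \<phi>] by (simp add: periodic_def
        add.commute[of w])
    qed
  qed (use f in \<open>auto intro: U_space_add U_space_scale U_space_zero U_space_continuous
    U_space_periodic\<close>)
  then obtain u where u: "u \<in> ?U" "\<And>\<phi>. \<phi> \<in> ?U \<Longrightarrow> torus_inner (\<lambda>x. f x - u x) \<phi> = 0" by blast
  have uniq: "u' = u" if u': "u' \<in> ?U" "\<forall>\<phi>\<in>?U. torus_inner (\<lambda>x. f x - u' x) \<phi> = 0" for u'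
  proof -
    let ?d = "\<lambda>x. u x - u' x"
    have d: "?d \<in> ?U" by (rule U_space_diff[OF u(1) u'(1)])
    note cu = U_space_continuous[OF u(1)] U_space_continuous[OF u'(1)]
    have eq: "?d = (\<lambda>x. (f x - u' x) - (f x - u x))" by auto
    have cc: "continuous_on UNIV (\<lambda>x. f x - u' x)" "continuous_on UNIV (\<lambda>x. f x - u x)"
      using f cu by (auto intro!: continuous_intros)
    have "torus_inner ?d ?d = torus_inner (\<lambda>x. f x - u' x) ?d - torus_inner (\<lambda>x. f x - u x) ?d"
      by (subst eq) (rule torus_inner_linear(2)[OF cc U_space_continuous[OF d]])
    also have "\<dots> = 0" using u'(2) u(2) d by simp
    finally have "?d = (\<lambda>x. 0)"
      by (intro torus_inner_definite U_space_continuous[OF d] U_space_periodic[OF d])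
    then have "u x - u' x = 0" for x by (rule fun_cong)
    then show ?thesis by (simp add: fun_eq_iff)
  qed
  have p: "L2_proj ?U f = u"
    unfolding L2_proj_def torus_inner_def[symmetric]
  proof (rule the_equality)
    show "u \<in> ?U \<and> (\<forall>\<phi>\<in>?U. torus_inner (\<lambda>x. f x - u x) \<phi> = 0)" using u by blast
  qed (rule uniq, simp_all)
  show "L2_proj ?U f \<in> ?U" unfolding p by (rule u(1))
  show "\<And>\<phi>. \<phi> \<in> ?U \<Longrightarrow> torus_inner (\<lambda>x. f x - L2_proj ?U f x) \<phi> = 0" unfolding p by (rule u(2))
qed

end

section \<open>Slices of space-time fields\<close>

lemma has_derivative_within_cong:
  assumes "x \<in> S" "\<And>y. y \<in> S \<Longrightarrow> f y = g y"
  shows "(f has_derivative D) (at x within S) \<longleftrightarrow> (g has_derivative D) (at x within S)"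
  using assms has_derivative_transform[of x S f g D] has_derivative_transform[of x S g f D] by auto

lemma Ck_on_cong:
  assumes "\<And>y. y \<in> S \<Longrightarrow> f y = g y"
  shows "Ck_on k S f \<longleftrightarrow> Ck_on k S g"
  using assms
proof (induction k arbitrary: f g)
  case 0
  then show ?case by (simp cong: continuous_on_cong)
next
  case (Suc k)
  have hd: "(f has_derivative D) (at x within S) \<longleftrightarrow> (g has_derivative D) (at x within S)" if "x \<in> S"
    for D x
    by (rule has_derivative_within_cong[OF that Suc.prems])
  have "f differentiable_on S \<longleftrightarrow> g differentiable_on S"
    unfolding differentiable_on_def differentiable_def using hd by blast
  moreover have "frechet_derivative f (at x within S) = frechet_derivative g (at x within S)" if "x
    \<in> S" for x
    unfolding frechet_derivative_def using hd[OF that] by simp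
  then have "Ck_on k S (\<lambda>x. frechet_derivative f (at x within S) b) \<longleftrightarrow> Ck_on k S (\<lambda>x.
    frechet_derivative g (at x within S) b)" for b
    by (intro Suc.IH) simp
  ultimately show ?case by simp
qed

text \<open>The derivative within the strip is restricted to the slice at time \<open>t\<close>,
  along which the strip imposes no constraint in \<open>x\<close>. End times are thereby
  included.\<close>

lemma slice_has_derivative:
  fixes f :: "real \<Rightarrow> 'a::euclidean_space \<Rightarrow> 'b::real_normed_vector"
  assumes "(\<lambda>(t, x). f t x) differentiable (at (t, x) within {0..T} \<times> UNIV)" "t \<in> {0..T}"
  shows "(f t has_derivative (\<lambda>h. frechet_derivative (\<lambda>(t, x). f t x) (at (t, x) within {0..T} \<times>
    UNIV) (0, h))) (at x)"
proof -
  let ?g = "\<lambda>(t, x). f t x" and ?S = "{0..T} \<times> (UNIV :: 'a set)"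
  have "(?g has_derivative frechet_derivative ?g (at (t, x) within ?S)) (at (t, x) within ?S)"
    using assms(1) frechet_derivative_works by blast
  then have "(?g has_derivative frechet_derivative ?g (at (t, x) within ?S)) (at (t, x) within Pair
    t ` UNIV)"
    by (rule has_derivative_subset) (use assms(2) in auto)
  moreover have "(Pair t has_derivative (\<lambda>h. (0, h))) (at x within UNIV)"
    by (auto intro!: derivative_eq_intros)
  ultimately show ?thesis
    using has_derivative_in_compose[of "Pair t" "\<lambda>h. (0, h)" x UNIV ?g] by simp
qed

text \<open>\<open>(0, b)\<close> is a basis vector of space-time, so spatial partial derivatives
  are among the derivatives that \<open>Ck_on\<close> controls.\<close>

lemma slice_Ck_pd:
  fixes f :: "real \<Rightarrow> 'a::euclidean_space \<Rightarrow> 'b::real_normed_vector"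
  assumes "Ck_on (Suc k) ({0..T} \<times> UNIV) (\<lambda>(t, x). f t x)" "b \<in> Basis"
  shows "Ck_on k ({0..T} \<times> UNIV) (\<lambda>(t, x). pd b (f t) x)"
proof -
  let ?g = "\<lambda>(t, x). f t x" and ?S = "{0..T} \<times> (UNIV :: 'a set)"
  have "(0, b) \<in> (Basis :: (real \<times> 'a) set)" using assms(2) by (simp add: Basis_prod_def)
  then have "Ck_on k ?S (\<lambda>z. frechet_derivative ?g (at z within ?S) (0, b))"
    using assms(1) by simp
  moreover have "frechet_derivative ?g (at z within ?S) (0, b) = (\<lambda>(t, x). pd b (f t) x) z" if "z \<in>
    ?S" for z
  proof -
    obtain t x where z: "z = (t, x)" "t \<in> {0..T}" using \<open>z \<in> ?S\<close> by (cases z) auto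
    have "?g differentiable (at (t, x) within ?S)" using assms(1) that z by (auto simp:
      differentiable_on_def)
    from pd_eqI[OF slice_has_derivative[OF this z(2)]] show ?thesis using z by simp
  qed
  then have "Ck_on k ?S (\<lambda>z. frechet_derivative ?g (at z within ?S) (0, b)) \<longleftrightarrow> Ck_on k ?S (\<lambda>(t, x).
    pd b (f t) x)"
    by (rule Ck_on_cong)
  ultimately show ?thesis by blast
qed

lemma slice_Ck:
  fixes f :: "real \<Rightarrow> 'a::euclidean_space \<Rightarrow> 'b::real_normed_vector"
  assumes "Ck_on k ({0..T} \<times> UNIV) (\<lambda>(t, x). f t x)" "t \<in> {0..T}"
  shows "Ck_on k UNIV (f t)"
  using assms(1)
proof (induction k arbitrary: f)
  case 0
  have "continuous_on UNIV (\<lambda>x. (\<lambda>(t, x). f t x) (t, x))"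
    by (rule continuous_on_compose2[of "{0..T} \<times> UNIV"]) (use 0 assms(2) in \<open>auto intro!:
      continuous_intros\<close>)
  then show ?case by simp
next
  case (Suc k)
  have "f t differentiable (at x)" for x
  proof -
    have "(\<lambda>(t, x). f t x) differentiable (at (t, x) within {0..T} \<times> UNIV)"
      using Suc.prems assms(2) by (auto simp: differentiable_on_def)
    from slice_has_derivative[OF this assms(2)] show ?thesis by (rule differentiableI)
  qed
  moreover have "Ck_on k UNIV (pd b (f t))" if "b \<in> Basis" for b
    using Suc.IH[of "\<lambda>t. pd b (f t)"] slice_Ck_pd[OF Suc.prems that] by simp
  ultimately show ?case by (simp add: Ck_on_UNIV_Suc del: Ck_on.simps(2))
qed

section \<open>The discrete evolution of \<open>\<xi>\<close>\<close>

text \<open>Countably many lattice translates of the unit cube cover the space, so the exceptional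
  set remains null.\<close>

lemma periodic_AE:
  assumes per: "\<And>x z. z \<in> lattice3 \<Longrightarrow> P (x + z) \<longleftrightarrow> P x" and ae: "AE x in torus. P x"
  shows "AE x in lebesgue. P x"
proof -
  have ae': "AE x in lebesgue. x \<in> cbox 0 1 \<longrightarrow> P x"
    using ae by (subst (asm) AE_restrict_space_iff) auto
  have "AE x in lebesgue. x - z \<in> cbox 0 1 \<longrightarrow> P x" if z: "z \<in> lattice3" for z
  proof -
    have "AE x in lebesgue. x + (- z) \<in> cbox 0 1 \<longrightarrow> P (x + (- z))" by (rule AE_lebesgue_shift[OF ae'])
    then show ?thesis using per[OF lattice3_uminus[OF z]] by simp
  qed
  then have "AE x in lebesgue. \<forall>z\<in>lattice3. x - z \<in> cbox 0 1 \<longrightarrow> P x"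
    by (subst AE_ball_countable[OF lattice3_countable]) blast
  then show ?thesis by eventually_elim (use lattice_translate_unit_cube in blast)
qed

lemma axis_axis_Basis: "axis k (axis \<gamma> 1) \<in> (Basis :: mat3 set)"
  by (auto simp: Basis_vec_def)

lemma inner_axis_axis_mat3: "X \<bullet> axis k (axis \<gamma> 1) = (X::mat3) $ k $ \<gamma>"
  by (simp add: inner_axis)

lemma ess_bounded_dPhi: "ess_bounded F \<Longrightarrow> ess_bounded (\<lambda>x. dPhi A i \<alpha> (F x))"
  by (rule ess_bounded_compose[OF _ continuous_dPhi])

lemma ess_bounded_fst: "ess_bounded f \<Longrightarrow> ess_bounded (\<lambda>x. fst (f x))"
  by (rule ess_bounded_compose) (auto intro: continuous_on_fst continuous_on_id)

lemma ess_bounded_snd: "ess_bounded f \<Longrightarrow> ess_bounded (\<lambda>x. snd (f x))"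
  by (rule ess_bounded_compose) (auto intro: continuous_on_snd continuous_on_id)

lemma ess_bounded_inner_const: "ess_bounded f \<Longrightarrow> ess_bounded (\<lambda>x. f x \<bullet> A)"
  by (rule ess_bounded_compose[where g = "\<lambda>y. y \<bullet> A"]) (auto intro!: continuous_intros)

lemma xi_Basis: "b \<in> Basis \<Longrightarrow> (b, 0, 0) \<in> (Basis :: xi_vec set)"
  by (auto simp: Basis_prod_def zero_prod_def)

lemma ess_bounded_divide: "ess_bounded f \<Longrightarrow> ess_bounded (\<lambda>x. f x / c :: real)"
  using ess_bounded_mult[OF _ ess_bounded_const[of "inverse c"]] by (simp add: divide_inverse)

lemma ess_bounded_scaleR_const: "ess_bounded f \<Longrightarrow> ess_bounded (\<lambda>x. f x *\<^sub>R A)"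
  by (rule ess_bounded_compose[where g = "\<lambda>r. r *\<^sub>R A"]) (auto intro!: continuous_intros)

context torus_mesh
begin

lemma AE_element_interior:
  assumes "K \<in> \<T>"
  shows "AE x in lebesgue. x \<in> K \<longrightarrow> x \<in> interior K"
proof -
  have "frontier K \<in> null_sets lebesgue"
    using negligible_convex_frontier[OF element(2)[OF assms]] negligible_iff_null_sets by blast
  then have "AE x in lebesgue. x \<notin> frontier K" by (rule AE_I') auto
  then show ?thesis
  proof eventually_elim
    case (elim x)
    then show ?case using closure_subset by (auto simp: frontier_def)
  qed
qed

text \<open>The derivative of \<open>Phi\<close> has degree 0, 1 and 2 in \<open>F\<close> for the
  components \<open>F\<close>, \<open>cof\<close> and \<open>det\<close>. With
  \<open>m = k - 1\<close> and the further degree \<open>k - 1\<close> of the derivatives of the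
  velocity, the three degrees in \<open>H_space\<close> result exactly.\<close>

lemma polys_dPhi:
  assumes "\<And>k \<gamma>. q k \<gamma> \<in> polys m"
  shows "(\<lambda>x. dPhi (b, 0, 0) i \<alpha> (\<chi> k \<gamma>. q k \<gamma> x)) \<in> polys 0"
    and "(\<lambda>x. dPhi (0, b, 0) i \<alpha> (\<chi> k \<gamma>. q k \<gamma> x)) \<in> polys m"
    and "(\<lambda>x. dPhi (0, 0, c) i \<alpha> (\<chi> k \<gamma>. q k \<gamma> x)) \<in> polys (2 * m)"
proof -
  show "(\<lambda>x. dPhi (b, 0, 0) i \<alpha> (\<chi> k \<gamma>. q k \<gamma> x)) \<in> polys 0"
    unfolding dPhi_eq by (simp add: polys_const)
  have "(\<lambda>x. \<Sum>j\<in>UNIV. \<Sum>\<beta>\<in>UNIV. b $ j $ \<beta> * (\<Sum>k\<in>UNIV. \<Sum>\<gamma>\<in>UNIV. (levi_civita j i k * levi_civita \<beta> \<alpha>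
    \<gamma>) * q k \<gamma> x)) \<in> polys m"
    by (intro polys_sum polys_cmult assms)
  then show "(\<lambda>x. dPhi (0, b, 0) i \<alpha> (\<chi> k \<gamma>. q k \<gamma> x)) \<in> polys m"
    unfolding dPhi_eq by simp
  have "(\<lambda>x. c * (1 / 2 * (\<Sum>j\<in>UNIV. \<Sum>k\<in>UNIV. \<Sum>\<beta>\<in>UNIV. \<Sum>\<gamma>\<in>UNIV.
      (levi_civita i j k * levi_civita \<alpha> \<beta> \<gamma>) * (q j \<beta> x * q k \<gamma> x)))) \<in> polys (m + m)"
    by (intro polys_sum polys_cmult polys_mult assms)
  then show "(\<lambda>x. dPhi (0, 0, c) i \<alpha> (\<chi> k \<gamma>. q k \<gamma> x)) \<in> polys (2 * m)"
    unfolding dPhi_eq cof_def by (simp add: mult.assoc mult_2)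
qed

text \<open>The degrees in \<open>H_space\<close> are such that both sides of the equation for \<open>\<xi>\<close> belong to the space, so
  that the equation can be tested with their difference.\<close>

lemma scheme_increment:
  assumes v: "v \<in> U_space \<T> k" and \<xi>: "\<xi>0 \<in> H_space \<T> k" "\<xi>1 \<in> H_space \<T> k"
    and eq: "\<And>\<psi>. \<psi> \<in> H_space \<T> k \<Longrightarrow>
      (LINT x|torus. (\<Sum>A\<in>Basis. (\<xi>1 x \<bullet> A - \<xi>0 x \<bullet> A) / \<tau> * (\<psi> x \<bullet> A)))
      = (LINT x|torus. (\<Sum>A\<in>Basis. \<Sum>i\<in>UNIV. \<Sum>\<alpha>\<in>UNIV.
          dPhi A i \<alpha> (fst (\<xi>0 x)) * pd (axis \<alpha> 1) (\<lambda>x. v x $ i) x * (\<psi> x \<bullet> A)))"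
  shows "AE x in lebesgue. \<forall>A\<in>Basis. (\<xi>1 x \<bullet> A - \<xi>0 x \<bullet> A) / \<tau>
    = (\<Sum>i\<in>UNIV. \<Sum>\<alpha>\<in>UNIV. dPhi A i \<alpha> (fst (\<xi>0 x)) * pd (axis \<alpha> 1) (\<lambda>x. v x $ i) x)"
proof -
  let ?p = "\<lambda>i \<alpha> x. pd (axis \<alpha> 1) (\<lambda>x. v x $ i) x"
  define rhs where "rhs A x = (\<Sum>i\<in>UNIV. \<Sum>\<alpha>\<in>UNIV. dPhi A i \<alpha> (fst (\<xi>0 x)) * ?p i \<alpha> x)" for A x
  define \<psi> where "\<psi> x = (\<Sum>A\<in>Basis. ((\<xi>1 x \<bullet> A - \<xi>0 x \<bullet> A) / \<tau> - rhs A x) *\<^sub>R A)" for x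
  have \<psi>A: "\<psi> x \<bullet> A = (\<xi>1 x \<bullet> A - \<xi>0 x \<bullet> A) / \<tau> - rhs A x" if "A \<in> Basis" for A x
    using that by (simp add: \<psi>_def)
  have per\<xi>: "\<xi>0 (x + z) = \<xi>0 x" "\<xi>1 (x + z) = \<xi>1 x" "?p i \<alpha> (x + z) = ?p i \<alpha> x" if "z \<in> lattice3"
    for x z i \<alpha>
  proof -
    show "\<xi>0 (x + z) = \<xi>0 x" "\<xi>1 (x + z) = \<xi>1 x"
      using \<xi>[THEN H_space_facts(3)] that by (auto simp: periodic_def)
    have "periodic (\<lambda>x. v x $ i)" using U_space_periodic[OF v] by (simp add: periodic_def)
    then show "?p i \<alpha> (x + z) = ?p i \<alpha> x" using periodic_pd that by (fastforce simp: periodic_def)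
  qed
  have per: "periodic \<psi>" unfolding periodic_def \<psi>_def rhs_def using per\<xi> by simp
  note eb = \<xi>[THEN H_space_facts(4)]
  have ebp: "ess_bounded (?p i \<alpha>)" for i \<alpha> by (rule ess_bounded_pd[OF U_space_admissible[OF v]])
  have ebr: "ess_bounded (rhs A)" for A
    unfolding rhs_def[abs_def]
    by (intro ess_bounded_sum ess_bounded_mult ebp ess_bounded_dPhi ess_bounded_fst eb)
  have eb\<psi>: "ess_bounded \<psi>"
    unfolding \<psi>_def[abs_def]
    by (intro ess_bounded_sum ess_bounded_scaleR_const ess_bounded_diff ess_bounded_divide
      ess_bounded_inner_const eb ebr)
  have d: "(\<lambda>x. fst (\<xi>0 x)) \<in> DG_space \<T> (k - 1)" using \<xi>(1) by (simp add: H_space_def)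
  \<comment> \<open>\<open>d\<close> is a degree bound for \<open>dPhi\<close> with index
    \<open>A\<close>: it is 0, \<open>k - 1\<close> and \<open>2 * (k - 1)\<close> in the three
    applications below.\<close>
  have poly: "\<exists>q\<in>polys (d + (k - 1)). AE x in lebesgue. x \<in> K \<longrightarrow> \<psi> x \<bullet> A = q x"
    if K: "K \<in> \<T>" and A: "A \<in> Basis"
      and h: "\<And>\<xi>. \<xi> \<in> {\<xi>0, \<xi>1} \<Longrightarrow> \<exists>q\<in>polys (d + (k - 1)). AE x in lebesgue. x \<in> K \<longrightarrow> \<xi> x \<bullet> A = q x"
      and dP: "\<And>q i \<alpha>. (\<And>k' \<gamma>. q k' \<gamma> \<in> polys (k - 1)) \<Longrightarrow> (\<lambda>x. dPhi A i \<alpha> (\<chi> k' \<gamma>. q k' \<gamma> x)) \<in> polys d"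
    for K A d
  proof -
    obtain q0 q1 where q01: "q0 \<in> polys (d + (k - 1))" "q1 \<in> polys (d + (k - 1))"
      "AE x in lebesgue. x \<in> K \<longrightarrow> \<xi>0 x \<bullet> A = q0 x" "AE x in lebesgue. x \<in> K \<longrightarrow> \<xi>1 x \<bullet> A = q1 x"
      using h[of \<xi>0] h[of \<xi>1] by auto
    have "\<forall>k' \<gamma>. \<exists>q. q \<in> polys (k - 1) \<and> (AE x in lebesgue. x \<in> K \<longrightarrow> fst (\<xi>0 x) $ k' $ \<gamma> = q x)"
    proof (intro allI)
      fix k' \<gamma>
      show "\<exists>q. q \<in> polys (k - 1) \<and> (AE x in lebesgue. x \<in> K \<longrightarrow> fst (\<xi>0 x) $ k' $ \<gamma> = q x)"
        using DG_space_polys[OF d K axis_axis_Basis[of k' \<gamma>]] unfolding inner_axis_axis_mat3 by blast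
    qed
    then have "\<exists>q. \<forall>k' \<gamma>. q k' \<gamma> \<in> polys (k - 1) \<and> (AE x in lebesgue. x \<in> K \<longrightarrow> fst (\<xi>0 x) $ k' $ \<gamma> =
      q k' \<gamma> x)"
      by (simp only: choice_iff)
    then obtain q where q: "\<And>k' \<gamma>. q k' \<gamma> \<in> polys (k - 1)"
      "\<And>k' \<gamma>. AE x in lebesgue. x \<in> K \<longrightarrow> fst (\<xi>0 x) $ k' $ \<gamma> = q k' \<gamma> x" by blast
    have "AE x in lebesgue. \<forall>k'\<in>UNIV. \<forall>\<gamma>\<in>UNIV. x \<in> K \<longrightarrow> fst (\<xi>0 x) $ k' $ \<gamma> = q k' \<gamma> x"
      using q(2) by (intro AE_finite_allI) auto
    then have qF: "AE x in lebesgue. x \<in> K \<longrightarrow> fst (\<xi>0 x) = (\<chi> k' \<gamma>. q k' \<gamma> x)"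
      by eventually_elim (simp add: vec_eq_iff)
    have "\<forall>i. \<exists>r. r \<in> polys k \<and> (\<forall>x\<in>K. v x $ i = r x)" using v K unfolding U_space_def by blast
    then obtain r where r: "\<And>i. r i \<in> polys k" "\<And>i x. x \<in> K \<Longrightarrow> v x $ i = r i x" by metis
    have rp: "AE x in lebesgue. x \<in> K \<longrightarrow> (\<forall>i \<alpha>. ?p i \<alpha> x = pd (axis \<alpha> 1) (r i) x)"
      using AE_element_interior[OF K]
      by eventually_elim (auto intro!: pd_piecewise_polynomial[OF _ r(1)] r(2))
    let ?q = "\<lambda>x. (inverse \<tau> * q1 x + (- inverse \<tau>) * q0 x) + (-1) * (\<Sum>i\<in>UNIV. \<Sum>\<alpha>\<in>UNIV. dPhi A i \<alpha>
      (\<chi> k' \<gamma>. q k' \<gamma> x) * pd (axis \<alpha> 1) (r i) x)"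
    have qp: "?q \<in> polys (d + (k - 1))"
      by (intro polys_add polys_cmult polys_sum polys_mult dP q r polys_pd q01)
    have "AE x in lebesgue. x \<in> K \<longrightarrow> \<psi> x \<bullet> A = ?q x"
      using q01(3,4) qF rp by eventually_elim (simp add: \<psi>A[OF A] rhs_def divide_inverse algebra_simps)
    then show ?thesis by (intro bexI[of _ ?q] qp)
  qed
  have "\<psi> \<in> H_space \<T> k"
    unfolding H_space_def mem_Collect_eq
  proof (intro conjI DG_spaceI)
    show "periodic (\<lambda>x. fst (\<psi> x))" "periodic (\<lambda>x. fst (snd (\<psi> x)))" "periodic (\<lambda>x. snd (snd (\<psi> x)))"
      using per by (auto simp: periodic_def)
    show "ess_bounded (\<lambda>x. fst (\<psi> x))" "ess_bounded (\<lambda>x. fst (snd (\<psi> x)))" "ess_bounded (\<lambda>x. snd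
      (snd (\<psi> x)))"
      by (intro ess_bounded_fst ess_bounded_snd eb\<psi>)+
    fix K assume K: "K \<in> \<T>"
    have B: "(b, 0, 0) \<in> (Basis :: xi_vec set)" "(0, b, 0) \<in> (Basis :: xi_vec set)" if "b \<in> Basis" for b
      using that by (auto simp: Basis_prod_def zero_prod_def)
    have B3: "(0, 0, b) \<in> (Basis :: xi_vec set)" if "b \<in> Basis" for b :: real
      using that by (auto simp: Basis_prod_def zero_prod_def)
    have D: "(\<lambda>x. fst (\<xi> x)) \<in> DG_space \<T> (k - 1)" "(\<lambda>x. fst (snd (\<xi> x))) \<in> DG_space \<T> (2 * (k - 1))"
      "(\<lambda>x. snd (snd (\<xi> x))) \<in> DG_space \<T> (3 * (k - 1))" if "\<xi> \<in> {\<xi>0, \<xi>1}" for \<xi>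
      using that \<xi> by (auto simp: H_space_def)
    have c: "0 + (k - 1) = k - 1" "(k - 1) + (k - 1) = 2 * (k - 1)" "2 * (k - 1) + (k - 1) = 3 * (k
      - 1)" by simp_all
    show "\<exists>q\<in>polys (k - 1). AE x in lebesgue. x \<in> K \<longrightarrow> fst (\<psi> x) \<bullet> b = q x" if b: "b \<in> Basis" for b
    proof -
      have "\<exists>q\<in>polys (0 + (k - 1)). AE x in lebesgue. x \<in> K \<longrightarrow> \<psi> x \<bullet> (b, 0, 0) = q x"
      proof (rule poly[OF K B(1)[OF b] _ polys_dPhi(1)])
        fix \<xi> assume "\<xi> \<in> {\<xi>0, \<xi>1}"
        from DG_space_polys[OF D(1)[OF this] K b]
        show "\<exists>q\<in>polys (0 + (k - 1)). AE x in lebesgue. x \<in> K \<longrightarrow> \<xi> x \<bullet> (b, 0, 0) = q x"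
          unfolding c(1) by (simp add: inner_prod_def) blast
      qed
      then show ?thesis by (simp add: inner_prod_def)
    qed
    show "\<exists>q\<in>polys (2 * (k - 1)). AE x in lebesgue. x \<in> K \<longrightarrow> fst (snd (\<psi> x)) \<bullet> b = q x" if b: "b \<in>
      Basis" for b
    proof -
      have "\<exists>q\<in>polys ((k - 1) + (k - 1)). AE x in lebesgue. x \<in> K \<longrightarrow> \<psi> x \<bullet> (0, b, 0) = q x"
      proof (rule poly[OF K B(2)[OF b] _ polys_dPhi(2)])
        fix \<xi> assume "\<xi> \<in> {\<xi>0, \<xi>1}"
        from DG_space_polys[OF D(2)[OF this] K b]
        show "\<exists>q\<in>polys ((k - 1) + (k - 1)). AE x in lebesgue. x \<in> K \<longrightarrow> \<xi> x \<bullet> (0, b, 0) = q x"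
          unfolding c(2) by (simp add: inner_prod_def) blast
      qed
      then show ?thesis by (simp add: inner_prod_def mult_2)
    qed
    show "\<exists>q\<in>polys (3 * (k - 1)). AE x in lebesgue. x \<in> K \<longrightarrow> snd (snd (\<psi> x)) \<bullet> b = q x" if b: "b \<in>
      Basis" for b :: real
    proof -
      have "\<exists>q\<in>polys (2 * (k - 1) + (k - 1)). AE x in lebesgue. x \<in> K \<longrightarrow> \<psi> x \<bullet> (0, 0, b) = q x"
      proof (rule poly[OF K B3[OF b] _ polys_dPhi(3)])
        fix \<xi> assume "\<xi> \<in> {\<xi>0, \<xi>1}"
        from DG_space_polys[OF D(3)[OF this] K b]
        show "\<exists>q\<in>polys (2 * (k - 1) + (k - 1)). AE x in lebesgue. x \<in> K \<longrightarrow> \<xi> x \<bullet> (0, 0, b) = q x"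
          unfolding c(3) by (simp add: inner_prod_def) blast
      qed
      then show ?thesis unfolding c(3) by (simp add: inner_prod_def)
    qed
  qed
  note eq\<psi> = eq[OF this]
  have eA: "ess_bounded (\<lambda>x. \<psi> x \<bullet> A)" for A by (intro ess_bounded_inner_const eb\<psi>)
  have i1: "ess_bounded (\<lambda>x. \<Sum>A\<in>Basis. (\<xi>1 x \<bullet> A - \<xi>0 x \<bullet> A) / \<tau> * (\<psi> x \<bullet> A))"
    by (intro ess_bounded_sum ess_bounded_mult ess_bounded_divide ess_bounded_diff
      ess_bounded_inner_const eb eb\<psi>)
  have i2: "ess_bounded (\<lambda>x. \<Sum>A\<in>Basis. rhs A x * (\<psi> x \<bullet> A))"
    by (intro ess_bounded_sum ess_bounded_mult ebr eA)
  have i3: "ess_bounded (\<lambda>x. \<Sum>A\<in>Basis. (\<psi> x \<bullet> A)\<^sup>2)"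
    unfolding power2_eq_square by (intro ess_bounded_sum ess_bounded_mult eA)
  have sq: "(\<Sum>A\<in>Basis. (\<psi> x \<bullet> A)\<^sup>2) = (\<Sum>A\<in>Basis. (\<xi>1 x \<bullet> A - \<xi>0 x \<bullet> A) / \<tau> * (\<psi> x \<bullet> A)) - (\<Sum>A\<in>Basis.
    rhs A x * (\<psi> x \<bullet> A))" for x
    unfolding sum_subtractf[symmetric] by (intro sum.cong refl) (simp add: \<psi>A power2_eq_square
      left_diff_distrib)
  have "(LINT x|torus. (\<Sum>A\<in>Basis. (\<psi> x \<bullet> A)\<^sup>2)) = 0"
    unfolding sq using eq\<psi> integrable_ess_bounded[OF i1] integrable_ess_bounded[OF i2]
    by (simp add: Bochner_Integration.integral_diff rhs_def sum_distrib_right)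
  then have "AE x in torus. (\<Sum>A\<in>Basis. (\<psi> x \<bullet> A)\<^sup>2) = 0"
    by (subst (asm) integral_nonneg_eq_0_iff_AE[OF integrable_ess_bounded[OF i3]]) (auto intro!:
      sum_nonneg)
  then have "AE x in torus. \<forall>A\<in>Basis. \<psi> x \<bullet> A = 0"
    by eventually_elim (simp add: sum_nonneg_eq_0_iff)
  then have "AE x in lebesgue. \<forall>A\<in>Basis. \<psi> x \<bullet> A = 0"
    by (rule periodic_AE[rotated]) (use per in \<open>simp add: periodic_def\<close>)
  then show ?thesis by eventually_elim (simp add: \<psi>A rhs_def)
qed

text \<open>For the components of \<open>F\<close> the coefficients \<open>dPhi\<close> are
  Kronecker symbols, so the step adds \<open>\<tau>\<close> times the gradient of
  \<open>v\<close>.\<close>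

lemma curl_free_step:
  assumes v: "v \<in> U_space \<T> k" and \<xi>: "\<xi>0 \<in> H_space \<T> k" "\<xi>1 \<in> H_space \<T> k" and "\<tau> \<noteq> 0"
    and incr: "AE x in lebesgue. \<forall>A\<in>Basis. (\<xi>1 x \<bullet> A - \<xi>0 x \<bullet> A) / \<tau>
      = (\<Sum>i\<in>UNIV. \<Sum>\<alpha>\<in>UNIV. dPhi A i \<alpha> (fst (\<xi>0 x)) * pd (axis \<alpha> 1) (\<lambda>x. v x $ i) x)"
    and cf: "curl_free (\<lambda>x. fst (\<xi>0 x))"
  shows "curl_free (\<lambda>x. fst (\<xi>1 x))"
proof -
  have d: "(\<lambda>x. fst (\<xi>0 x)) \<in> DG_space \<T> (k - 1)" "(\<lambda>x. fst (\<xi>1 x)) \<in> DG_space \<T> (k - 1)"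
    using \<xi> by (auto simp: H_space_def)
  obtain M where M: "AE x in lebesgue. norm (fst (\<xi>0 x)) \<le> M" using DG_space_bounded[OF d(1)] by blast
  show ?thesis
  proof (rule curl_free_add_gradient[OF cf DG_space_measurable[OF d(1)] M U_space_admissible[OF v]
    DG_space_measurable[OF d(2)]])
    show "AE x in lebesgue. \<forall>i \<alpha>. fst (\<xi>1 x) $ i $ \<alpha> = fst (\<xi>0 x) $ i $ \<alpha> + \<tau> * pd (axis \<alpha> 1) (\<lambda>x. v
      x $ i) x"
      using incr
    proof eventually_elim
      case (elim x)
      show ?case
      proof (intro allI)
        fix i \<alpha> :: 3
        let ?A = "(axis i (axis \<alpha> 1), 0, 0) :: xi_vec"
        have "?A \<in> Basis" by (intro xi_Basis axis_axis_Basis)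
        then have "(\<xi>1 x \<bullet> ?A - \<xi>0 x \<bullet> ?A) / \<tau> = (\<Sum>j\<in>UNIV. \<Sum>\<beta>\<in>UNIV. dPhi ?A j \<beta> (fst (\<xi>0 x)) * pd
          (axis \<beta> 1) (\<lambda>x. v x $ j) x)"
          using elim by blast
        also have "\<dots> = (\<Sum>j\<in>UNIV. \<Sum>\<beta>\<in>UNIV. if \<beta> = \<alpha> then (if j = i then pd (axis \<alpha> 1) (\<lambda>x. v x $ i) x
          else 0) else 0)"
          by (intro sum.cong refl) (auto simp: dPhi_eq axis_def)
        also have "\<dots> = pd (axis \<alpha> 1) (\<lambda>x. v x $ i) x" by simp
        finally show "fst (\<xi>1 x) $ i $ \<alpha> = fst (\<xi>0 x) $ i $ \<alpha> + \<tau> * pd (axis \<alpha> 1) (\<lambda>x. v x $ i) x"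
          using \<open>\<tau> \<noteq> 0\<close> by (simp add: inner_prod_def inner_axis_axis_mat3 field_simps)
      qed
    qed
  qed
qed

end

section \<open>The identity at a fixed time\<close>

text \<open>The summand with indices \<open>A\<close>, \<open>i\<close>, \<open>\<alpha>\<close> of the final identity. Here \<open>g\<close>, \<open>gh\<close>, \<open>h\<close> stand for the
  derivative of \<open>G\<close> at the new iterate, the interpolate and the exact solution, \<open>Ps\<close>, \<open>Ph\<close>, \<open>P\<close> for
  \<open>dPhi\<close> at the old iterate, the interpolate and the exact solution, and \<open>dw\<close> for a derivative of the
  projected velocity.\<close>

lemma relative_entropy_algebra:
  fixes g h gh P Ps Ph dv dv1 dw dh v v1 vh C :: real
  shows "(g - h) * Ps * dv1 - dh * P * (vh - v) - P * dv * C
      - (dh * (Ph - P) * (vh - v) + dv * (gh - h) * (Ph - P) + dv * (gh - h - C) * P)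
      - (dh * (P * (v1 - vh) + (Ph - P) * (v1 - vh) + (Ps - Ph) * (v1 - vh) + (Ps - Ph) * (vh - v))
         + dv * ((g - gh) * P + (g - gh) * (Ps - Ph) + (g - gh) * (Ph - P) + (gh - h) * (Ps - Ph)))
      - g * Ps * (dw - dv)
    = g * Ps * (dv1 - dw) - Ps * (dh * (v1 - v) + h * (dv1 - dv))"
  by algebra

lemma ess_bounded_nth: "ess_bounded f \<Longrightarrow> ess_bounded (\<lambda>x. f x $ i :: real)"
  by (rule ess_bounded_compose[where g = "\<lambda>y. y $ i"]) (auto intro!: continuous_intros)

text \<open>The time derivative of the relative entropy without the dissipation term \<open>- D / \<tau>\<close>.\<close>

definition reduced_rate ::
  "(xi_vec \<Rightarrow> real) \<Rightarrow> real \<Rightarrow> real^3 \<Rightarrow> xi_vec \<Rightarrow> real^3 \<Rightarrow> xi_vec \<Rightarrow>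
   real^3 \<Rightarrow> xi_vec \<Rightarrow> real^3 \<Rightarrow> xi_vec \<Rightarrow> real^3 \<Rightarrow> xi_vec \<Rightarrow> real" where
  "reduced_rate G \<tau> v0 \<xi>0 v1 \<xi>1 vh \<xi>h v \<xi> vt \<xi>t =
     (\<Sum>i\<in>UNIV. (v1 $ i - v $ i) * ((v1 $ i - v0 $ i) / \<tau>))
     + (\<Sum>A\<in>Basis. (pd A G \<xi>1 - pd A G \<xi>) * ((\<xi>1 \<bullet> A - \<xi>0 \<bullet> A) / \<tau>))
     - (\<Sum>i\<in>UNIV. vt $ i * (vh $ i - v $ i))
     - (\<Sum>A\<in>Basis. (\<xi>t \<bullet> A) * (\<Sum>B\<in>Basis. pd B (pd A G) \<xi> * ((\<xi>h - \<xi>) \<bullet> B)))"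

context torus_mesh
begin

text \<open>Time enters only through \<open>vt\<close> and \<open>\<xi>t\<close>, and
  \<open>vhat\<close>, \<open>\<xi>hat\<close> may be arbitrary bounded fields: their contributions
  cancel in the algebra, while the scheme ties together only the iterates \<open>v0\<close>,
  \<open>v1\<close>, \<open>\<xi>0\<close>, \<open>\<xi>1\<close>.\<close>

lemma spatial_identity:
  fixes G :: "xi_vec \<Rightarrow> real" and v vt vhat v0 v1 :: "real^3 \<Rightarrow> real^3"
    and \<xi> \<xi>t \<xi>hat \<xi>0 \<xi>1 :: "real^3 \<Rightarrow> xi_vec"
  assumes G: "Ck_on 3 UNIV G"
    and v01: "v0 \<in> U_space \<T> k" "v1 \<in> U_space \<T> k"
    and \<xi>01: "\<xi>0 \<in> H_space \<T> k" "\<xi>1 \<in> H_space \<T> k"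
    and cf0: "curl_free (\<lambda>x. fst (\<xi>0 x))"
    and mom: "\<And>\<phi>. \<phi> \<in> U_space \<T> k \<Longrightarrow>
        (LINT x|torus. (\<Sum>i\<in>UNIV. (v1 x $ i - v0 x $ i) / \<tau> * \<phi> x $ i))
        = - (LINT x|torus. (\<Sum>A\<in>Basis. \<Sum>i\<in>UNIV. \<Sum>\<alpha>\<in>UNIV.
              pd A G (\<xi>1 x) * dPhi A i \<alpha> (fst (\<xi>0 x)) * pd (axis \<alpha> 1) (\<lambda>x. \<phi> x $ i) x))"
    and incr: "AE x in lebesgue. \<forall>A\<in>Basis. (\<xi>1 x \<bullet> A - \<xi>0 x \<bullet> A) / \<tau>
        = (\<Sum>i\<in>UNIV. \<Sum>\<alpha>\<in>UNIV. dPhi A i \<alpha> (fst (\<xi>0 x)) * pd (axis \<alpha> 1) (\<lambda>x. v1 x $ i) x)"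
    and v: "Ck_on 2 UNIV v" "periodic v" and \<xi>: "Ck_on 2 UNIV \<xi>" "periodic \<xi>"
    and cf: "curl_free (\<lambda>x. fst (\<xi> x))"
    and vt: "\<And>x i. vt x $ i = (\<Sum>\<alpha>\<in>UNIV. pd (axis \<alpha> 1)
        (\<lambda>y. \<Sum>A\<in>Basis. pd A G (\<xi> y) * dPhi A i \<alpha> (fst (\<xi> y))) x)"
    and \<xi>t: "\<And>x A. A \<in> Basis \<Longrightarrow> \<xi>t x \<bullet> A = (\<Sum>\<alpha>\<in>UNIV. pd (axis \<alpha> 1)
        (\<lambda>y. \<Sum>i\<in>UNIV. dPhi A i \<alpha> (fst (\<xi> y)) * v y $ i) x)"
    and hat: "ess_bounded vhat" "ess_bounded \<xi>hat"
  defines "R \<equiv> \<lambda>x. reduced_rate G \<tau> (v0 x) (\<xi>0 x) (v1 x) (\<xi>1 x) (vhat x) (\<xi>hat x) (v x) (\<xi> x) (vt x)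
    (\<xi>t x)"
    and "S \<equiv> \<lambda>x. Q_term G v \<xi> vhat \<xi>hat x + E_term G v \<xi> vhat \<xi>hat v1 \<xi>1 (\<lambda>x. fst (\<xi>0 x)) x
        + Ebar_term G \<T> k v \<xi>1 (\<lambda>x. fst (\<xi>0 x)) x"
  shows "ess_bounded R" "ess_bounded S" "(LINT x|torus. R x) = (LINT x|torus. S x)"
proof -
  define w where "w = L2_proj (U_space \<T> k) v"
  define h where "h A y = pd A G (\<xi> y)" for A y
  define P where "P A i \<alpha> y = dPhi A i \<alpha> (fst (\<xi> y))" for A i \<alpha> y
  define Ps where "Ps A i \<alpha> x = dPhi A i \<alpha> (fst (\<xi>0 x))" for A i \<alpha> x
  define dv where "dv i \<alpha> x = pd (axis \<alpha> 1) (\<lambda>y. v y $ i) x" for i \<alpha> x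
  define dv1 where "dv1 i \<alpha> x = pd (axis \<alpha> 1) (\<lambda>y. v1 y $ i) x" for i \<alpha> x
  define dw where "dw i \<alpha> x = pd (axis \<alpha> 1) (\<lambda>y. w y $ i) x" for i \<alpha> x
  define dh where "dh A \<alpha> x = pd (axis \<alpha> 1) (h A) x" for A \<alpha> x
  define C where "C A x = (\<Sum>B\<in>Basis. pd B (pd A G) (\<xi> x) * ((\<xi>hat x - \<xi> x) \<bullet> B))" for A x
  have GA: "Ck_on 2 UNIV (pd A G)" if "A \<in> Basis" for A using Ck_pd[OF G _ that] by simp
  have GA1: "Ck_on (Suc 0) UNIV (pd A G)" if "A \<in> Basis" for A by (rule Ck_on_mono[OF GA[OF that]]) simp
  have GAc: "continuous_on UNIV (pd A G)" if "A \<in> Basis" for A using Ck_on_imp_continuous[OF GA[OF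
    that]] .
  have GABc: "continuous_on UNIV (pd B (pd A G))" if "A \<in> Basis" "B \<in> Basis" for A B
    using Ck_on_imp_continuous[OF Ck_pd[OF GA[OF that(1)] _ that(2)]] by simp
  have \<xi>1': "Ck_on (Suc 0) UNIV \<xi>" and v1': "Ck_on (Suc 0) UNIV v"
    by (rule Ck_on_mono[OF \<xi>(1)], simp, rule Ck_on_mono[OF v(1)], simp)
  have hC: "Ck_on (Suc 0) UNIV (h A)" if "A \<in> Basis" for A
    unfolding h_def[abs_def] by (rule C1_compose[OF GA1[OF that] \<xi>1'])
  have FC: "Ck_on (Suc 0) UNIV (\<lambda>x. fst (\<xi> x) $ i $ \<alpha>)" for i \<alpha>
    by (rule Ck_bounded_linear[OF _ \<xi>1'])
       (intro bounded_linear_compose[OF bounded_linear_entry] bounded_linear_fst)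
  have vC: "Ck_on (Suc 0) UNIV (\<lambda>x. v x $ i)" for i
    by (rule Ck_bounded_linear[OF bounded_linear_vec_nth v1'])
  have PC: "Ck_on (Suc 0) UNIV (P A i \<alpha>)" for A i \<alpha>
    unfolding P_def[abs_def] by (rule Ck_dPhi[OF FC])
  have hd: "h A differentiable (at x)" if "A \<in> Basis" for A x by (rule Ck_differentiable[OF hC[OF
    that]]) simp
  have Pd: "P A i \<alpha> differentiable (at x)" for A i \<alpha> x by (rule Ck_differentiable[OF PC]) simp
  have vd: "(\<lambda>x. v x $ i) differentiable (at x)" for i x by (rule Ck_differentiable[OF vC]) simp
  have perF: "periodic (\<lambda>x. fst (\<xi> x))" using \<xi>(2) by (simp add: periodic_def)
  have divP: "(\<Sum>\<alpha>\<in>UNIV. pd (axis \<alpha> 1) (P A i \<alpha>) x) = 0" for A i x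
    unfolding P_def[abs_def]
    by (rule div_dPhi_eq_0[OF Ck_differentiable[OF FC] curl_free_C1_symmetric[OF cf perF FC]]) simp
  \<comment> \<open>The pointwise identity \<open>divP\<close> removes the derivatives of
    \<open>P\<close>. Both equations of the exact system thus take the nonconservative form that can
    be compared with \<open>Q_term\<close> and \<open>E_term\<close>.\<close>
  have vt': "vt x $ i = (\<Sum>A\<in>Basis. \<Sum>\<alpha>\<in>UNIV. dh A \<alpha> x * P A i \<alpha> x)" for x i
  proof -
    have "vt x $ i = (\<Sum>\<alpha>\<in>UNIV. \<Sum>A\<in>Basis. dh A \<alpha> x * P A i \<alpha> x + h A x * pd (axis \<alpha> 1) (P A i \<alpha>) x)"
      unfolding vt h_def[symmetric] P_def[symmetric] dh_def
      by (intro sum.cong refl) (subst pd_sum, auto simp: pd_mult hd Pd intro!: differentiable_mult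
        hd Pd)
    also have "\<dots> = (\<Sum>A\<in>Basis. \<Sum>\<alpha>\<in>UNIV. dh A \<alpha> x * P A i \<alpha> x + h A x * pd (axis \<alpha> 1) (P A i \<alpha>) x)"
      by (rule sum.swap)
    also have "\<dots> = (\<Sum>A\<in>Basis. \<Sum>\<alpha>\<in>UNIV. dh A \<alpha> x * P A i \<alpha> x)"
      by (rule sum.cong[OF refl]) (simp add: sum.distrib sum_distrib_left[symmetric] divP)
    finally show ?thesis .
  qed
  have \<xi>t': "\<xi>t x \<bullet> A = (\<Sum>i\<in>UNIV. \<Sum>\<alpha>\<in>UNIV. P A i \<alpha> x * dv i \<alpha> x)" if "A \<in> Basis" for x A
  proof -
    have "\<xi>t x \<bullet> A = (\<Sum>\<alpha>\<in>UNIV. \<Sum>i\<in>UNIV. pd (axis \<alpha> 1) (P A i \<alpha>) x * v x $ i + P A i \<alpha> x * dv i \<alpha> x)"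
      unfolding \<xi>t[OF that] P_def[symmetric] dv_def
      by (intro sum.cong refl) (subst pd_sum, auto simp: pd_mult vd Pd intro!: differentiable_mult
        vd Pd)
    also have "\<dots> = (\<Sum>i\<in>UNIV. \<Sum>\<alpha>\<in>UNIV. pd (axis \<alpha> 1) (P A i \<alpha>) x * v x $ i + P A i \<alpha> x * dv i \<alpha> x)"
      by (rule sum.swap)
    also have "\<dots> = (\<Sum>i\<in>UNIV. \<Sum>\<alpha>\<in>UNIV. P A i \<alpha> x * dv i \<alpha> x)"
      by (rule sum.cong[OF refl]) (simp add: sum.distrib sum_distrib_right[symmetric] divP)
    finally show ?thesis .
  qed
  have vcont: "continuous_on UNIV v" and \<xi>cont: "continuous_on UNIV \<xi>"
    using Ck_on_imp_continuous[OF v(1)] Ck_on_imp_continuous[OF \<xi>(1)] .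
  have wU: "w \<in> U_space \<T> k" unfolding w_def by (rule L2_proj_U_space(1)[OF vcont])
  have worth: "torus_inner (\<lambda>x. v x - w x) \<phi> = 0" if "\<phi> \<in> U_space \<T> k" for \<phi>
    unfolding w_def by (rule L2_proj_U_space(2)[OF vcont that])
  have adm: "admissible (\<lambda>x. v x $ i)" "admissible (\<lambda>x. v1 x $ i)" "admissible (\<lambda>x. w x $ i)" for i
    by (auto intro: C1_imp_admissible vC U_space_admissible v01 wU)
  have admh: "admissible (h A)" if "A \<in> Basis" for A by (rule C1_imp_admissible[OF hC[OF that]])
  note eb\<xi> = \<xi>01[THEN H_space_facts(4)] ess_bounded_continuous[OF \<xi>cont]
  note ebv = v01[THEN U_space_continuous, THEN ess_bounded_continuous] ess_bounded_continuous[OF vcont]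
    ess_bounded_continuous[OF U_space_continuous[OF wU]]
  have ebG: "ess_bounded (\<lambda>x. pd A G (f x))" if "A \<in> Basis" "ess_bounded f" for A f
    by (rule ess_bounded_compose[OF that(2) GAc[OF that(1)]])
  have ebGG: "ess_bounded (\<lambda>x. pd B (pd A G) (f x))" if "A \<in> Basis" "B \<in> Basis" "ess_bounded f" for
    A B f
    by (rule ess_bounded_compose[OF that(3) GABc[OF that(1,2)]])
  have ebd: "ess_bounded (\<lambda>x. dv i \<alpha> x)" "ess_bounded (\<lambda>x. dv1 i \<alpha> x)" "ess_bounded (\<lambda>x. dw i \<alpha> x)"
    for i \<alpha>
    unfolding dv_def dv1_def dw_def by (intro ess_bounded_pd adm)+
  have ebdh: "ess_bounded (\<lambda>x. dh A \<alpha> x)" if "A \<in> Basis" for A \<alpha>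
    unfolding dh_def by (intro ess_bounded_pd admh that)
  have ebP: "ess_bounded (\<lambda>x. P A i \<alpha> x)" "ess_bounded (\<lambda>x. Ps A i \<alpha> x)" for A i \<alpha>
    unfolding P_def Ps_def by (intro ess_bounded_dPhi ess_bounded_fst eb\<xi>)+
  have ebh: "ess_bounded (\<lambda>x. h A x)" if "A \<in> Basis" for A unfolding h_def by (intro ebG that eb\<xi>)
  have ebvt: "ess_bounded (\<lambda>x. vt x $ i)" for i
    unfolding vt' by (intro ess_bounded_sum ess_bounded_mult ebdh ebP)
  have eb\<xi>t: "ess_bounded (\<lambda>x. \<xi>t x \<bullet> A)" if "A \<in> Basis" for A
    unfolding \<xi>t'[OF that] by (intro ess_bounded_sum ess_bounded_mult ebd ebP)
  have ebC: "ess_bounded (\<lambda>x. C A x)" if "A \<in> Basis" for A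
    unfolding C_def by (intro ess_bounded_sum ess_bounded_mult ebGG ess_bounded_inner_const
      ess_bounded_diff hat eb\<xi> that)
  show ebR: "ess_bounded R"
    unfolding R_def reduced_rate_def C_def[symmetric]
    by (intro ess_bounded_sum ess_bounded_mult ess_bounded_add ess_bounded_diff ess_bounded_divide
      ess_bounded_inner_const
        ess_bounded_nth ebG ebC ebvt eb\<xi>t hat eb\<xi> ebv)
  have pdw: "ess_bounded (\<lambda>x. pd (axis \<alpha> 1) (\<lambda>y. w y $ i - v y $ i) x)" for i \<alpha>
    by (intro ess_bounded_pd admissible_diff adm)
  show ebS: "ess_bounded S"
    unfolding S_def Q_term_def E_term_def Ebar_term_def w_def[symmetric] h_def[symmetric]
      C_def[symmetric]
      dh_def[symmetric] dv_def[symmetric] P_def[symmetric] Ps_def[symmetric]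
    by (intro ess_bounded_sum ess_bounded_mult ess_bounded_add ess_bounded_diff
        ess_bounded_nth ebG ebC ebh ebdh ebd ebP ess_bounded_dPhi ess_bounded_fst hat eb\<xi> ebv pdw)
  \<comment> \<open>\<open>R - S = I1 + I2 - I3 - I4\<close> almost everywhere. The integral of \<open>I1 + I2\<close> vanishes by the momentum
    equation tested with \<open>v1 - w\<close>, that of \<open>I3\<close> by the orthogonality of \<open>v - w\<close>, and that of \<open>I4\<close> by the
    weak Piola identity.\<close>
  define I1 where "I1 x = (\<Sum>i\<in>UNIV. (v1 x $ i - v0 x $ i) / \<tau> * (v1 x - w x) $ i)" for x
  define I2 where "I2 x = (\<Sum>A\<in>Basis. \<Sum>i\<in>UNIV. \<Sum>\<alpha>\<in>UNIV.
      pd A G (\<xi>1 x) * dPhi A i \<alpha> (fst (\<xi>0 x)) * pd (axis \<alpha> 1) (\<lambda>x. (v1 x - w x) $ i) x)" for x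
  define I3 where "I3 x = (1 / \<tau>) * ((v x - w x) \<bullet> (v1 x - v0 x))" for x
  define I4 where "I4 x = (\<Sum>A\<in>Basis. \<Sum>i\<in>UNIV. \<Sum>\<alpha>\<in>UNIV.
      dPhi A i \<alpha> (fst (\<xi>0 x)) * pd (axis \<alpha> 1) (\<lambda>y. h A y * (v1 y $ i - v y $ i)) x)" for x
  have d1: "(\<lambda>x. v1 x - w x) \<in> U_space \<T> k" by (rule U_space_diff[OF v01(2) wU])
  have d2: "(\<lambda>x. v1 x - v0 x) \<in> U_space \<T> k" by (rule U_space_diff[OF v01(2,1)])
  have eb1: "ess_bounded I1"
    unfolding I1_def[abs_def]
    by (intro ess_bounded_sum ess_bounded_mult ess_bounded_divide ess_bounded_nth ess_bounded_diff ebv)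
  have eb2: "ess_bounded I2"
    unfolding I2_def[abs_def]
    by (intro ess_bounded_sum ess_bounded_mult ebG ess_bounded_dPhi ess_bounded_fst eb\<xi>
      ess_bounded_pd U_space_admissible[OF d1])
  have eb3: "ess_bounded I3"
    unfolding I3_def[abs_def]
    by (intro ess_bounded_mult ess_bounded_const ess_bounded_inner ess_bounded_diff ebv)
  have adm4: "admissible (\<lambda>y. h A y * (v1 y $ i - v y $ i))" if "A \<in> Basis" for A i
    by (intro admissible_mult admissible_diff adm admh that)
  have eb4i: "ess_bounded (\<lambda>x. \<Sum>\<alpha>\<in>UNIV. dPhi A i \<alpha> (fst (\<xi>0 x)) * pd (axis \<alpha> 1) (\<lambda>y. h A y * (v1 y $
    i - v y $ i)) x)"
    if "A \<in> Basis" for A i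
    by (intro ess_bounded_sum ess_bounded_mult ess_bounded_dPhi ess_bounded_fst eb\<xi> ess_bounded_pd
      adm4 that)
  have eb4: "ess_bounded I4"
    unfolding I4_def[abs_def] by (intro ess_bounded_sum eb4i)
  note int = eb1[THEN integrable_ess_bounded] eb2[THEN integrable_ess_bounded]
    eb3[THEN integrable_ess_bounded] eb4[THEN integrable_ess_bounded]
  have z12: "(LINT x|torus. I1 x) + (LINT x|torus. I2 x) = 0"
    using mom[OF d1] unfolding I1_def I2_def by simp
  have z3: "(LINT x|torus. I3 x) = 0"
    using worth[OF d2] unfolding I3_def torus_inner_def by simp
  have D0: "(\<lambda>x. fst (\<xi>0 x)) \<in> DG_space \<T> (k - 1)" using \<xi>01(1) by (simp add: H_space_def)
  obtain M where M: "AE x in lebesgue. norm (fst (\<xi>0 x)) \<le> M" using DG_space_bounded[OF D0] by blast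
  have z4: "(LINT x|torus. I4 x) = 0"
  proof -
    have "(LINT x|torus. I4 x) = (\<Sum>A\<in>Basis. \<Sum>i\<in>UNIV. LINT x|torus.
        (\<Sum>\<alpha>\<in>UNIV. dPhi A i \<alpha> (fst (\<xi>0 x)) * pd (axis \<alpha> 1) (\<lambda>y. h A y * (v1 y $ i - v y $ i)) x))"
      unfolding I4_def
      by (subst Bochner_Integration.integral_sum, intro integrable_ess_bounded ess_bounded_sum eb4i,
        assumption)
         (intro sum.cong refl Bochner_Integration.integral_sum integrable_ess_bounded eb4i)
    also have "\<dots> = 0"
    proof (intro sum.neutral ballI)
      fix A :: xi_vec and i :: 3 assume A: "A \<in> Basis"
      have per: "periodic (\<lambda>y. h A y * (v1 y $ i - v y $ i))"
        using v(2) \<xi>(2) U_space_periodic[OF v01(2)] by (simp add: periodic_def h_def)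
      show "(LINT x|torus. (\<Sum>\<alpha>\<in>UNIV. dPhi A i \<alpha> (fst (\<xi>0 x)) * pd (axis \<alpha> 1) (\<lambda>y. h A y * (v1 y $ i
        - v y $ i)) x)) = 0"
        by (rule weak_piola[OF DG_space_measurable[OF D0] M DG_space_periodic[OF D0] cf0
              DG_space_locally_continuous[OF D0] adm4[OF A] per])
    qed
    finally show ?thesis .
  qed
  \<comment> \<open>The identity is pointwise off the null set where the increment formula, or
    differentiability of some component of \<open>v1\<close> or \<open>w\<close>, fails.\<close>
  have "AE x in torus. R x - S x = I1 x + I2 x - I3 x - I4 x"
    using torus_AE[OF incr] adm(2)[of 1, unfolded admissible_def, THEN conjunct2, THEN torus_AE]
      adm(2)[of 2, unfolded admissible_def, THEN conjunct2, THEN torus_AE]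
      adm(2)[of 3, unfolded admissible_def, THEN conjunct2, THEN torus_AE]
      adm(3)[of 1, unfolded admissible_def, THEN conjunct2, THEN torus_AE]
      adm(3)[of 2, unfolded admissible_def, THEN conjunct2, THEN torus_AE]
      adm(3)[of 3, unfolded admissible_def, THEN conjunct2, THEN torus_AE]
  proof eventually_elim
    case (elim x)
    have v1d: "(\<lambda>x. v1 x $ i) differentiable (at x)" and wd: "(\<lambda>x. w x $ i) differentiable (at x)" for i
      using exhaust_3[of i] elim(2-7) by auto
    have p1: "pd (axis \<alpha> 1) (\<lambda>x. (v1 x - w x) $ i) x = dv1 i \<alpha> x - dw i \<alpha> x" for i \<alpha>
      unfolding dv1_def dw_def vector_minus_component by (rule pd_diff[OF v1d wd])
    have p2: "pd (axis \<alpha> 1) (\<lambda>y. w y $ i - v y $ i) x = dw i \<alpha> x - dv i \<alpha> x" for i \<alpha>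
      unfolding dv_def dw_def by (rule pd_diff[OF wd vd])
    have p3: "pd (axis \<alpha> 1) (\<lambda>y. h A y * (v1 y $ i - v y $ i)) x
        = dh A \<alpha> x * (v1 x $ i - v x $ i) + h A x * (dv1 i \<alpha> x - dv i \<alpha> x)" if "A \<in> Basis" for A i \<alpha>
      unfolding dv1_def dv_def dh_def
      by (simp add: pd_mult[OF hd[OF that] differentiable_diff[OF v1d vd]] pd_diff[OF v1d vd])
    let ?S = "\<lambda>f. \<Sum>A\<in>Basis. \<Sum>i\<in>UNIV. \<Sum>\<alpha>\<in>UNIV. f A i \<alpha>"
    have r1: "(\<Sum>A\<in>Basis. (pd A G (\<xi>1 x) - h A x) * ((\<xi>1 x \<bullet> A - \<xi>0 x \<bullet> A) / \<tau>))
        = ?S (\<lambda>A i \<alpha>. (pd A G (\<xi>1 x) - h A x) * Ps A i \<alpha> x * dv1 i \<alpha> x)"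
    proof (intro sum.cong refl)
      fix A :: xi_vec assume "A \<in> Basis"
      then have "(\<xi>1 x \<bullet> A - \<xi>0 x \<bullet> A) / \<tau> = (\<Sum>i\<in>UNIV. \<Sum>\<alpha>\<in>UNIV. Ps A i \<alpha> x * dv1 i \<alpha> x)"
        using elim(1) unfolding Ps_def dv1_def by blast
      then show "(pd A G (\<xi>1 x) - h A x) * ((\<xi>1 x \<bullet> A - \<xi>0 x \<bullet> A) / \<tau>)
          = (\<Sum>i\<in>UNIV. \<Sum>\<alpha>\<in>UNIV. (pd A G (\<xi>1 x) - h A x) * Ps A i \<alpha> x * dv1 i \<alpha> x)"
        by (simp only: sum_distrib_left mult.assoc)
    qed
    have r2: "(\<Sum>i\<in>UNIV. vt x $ i * (vhat x $ i - v x $ i)) = ?S (\<lambda>A i \<alpha>. dh A \<alpha> x * P A i \<alpha> x *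
      (vhat x $ i - v x $ i))"
      unfolding vt' by (simp only: sum_distrib_right) (rule sum.swap)
    have r3: "(\<Sum>A\<in>Basis. (\<xi>t x \<bullet> A) * C A x) = ?S (\<lambda>A i \<alpha>. P A i \<alpha> x * dv i \<alpha> x * C A x)"
      by (intro sum.cong refl) (simp only: \<xi>t' sum_distrib_right)
    have Req: "R x = (\<Sum>i\<in>UNIV. (v1 x $ i - v x $ i) * ((v1 x $ i - v0 x $ i) / \<tau>))
        + ?S (\<lambda>A i \<alpha>. (pd A G (\<xi>1 x) - h A x) * Ps A i \<alpha> x * dv1 i \<alpha> x)
        - ?S (\<lambda>A i \<alpha>. dh A \<alpha> x * P A i \<alpha> x * (vhat x $ i - v x $ i))
        - ?S (\<lambda>A i \<alpha>. P A i \<alpha> x * dv i \<alpha> x * C A x)"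
      unfolding R_def reduced_rate_def h_def[symmetric] C_def[symmetric] r1 r2 r3 ..
    \<comment> \<open>\<open>v1 - w\<close> and \<open>v - w\<close> differ by
      \<open>v1 - v\<close>: passing from the admissible test field \<open>v1 - w\<close> to
      \<open>v1 - v\<close> costs exactly the orthogonality integral.\<close>
    have I13: "I1 x - I3 x = (\<Sum>i\<in>UNIV. (v1 x $ i - v x $ i) * ((v1 x $ i - v0 x $ i) / \<tau>))"
      unfolding I1_def I3_def inner_vec_def
      by (simp add: sum_distrib_left sum_subtractf[symmetric] algebra_simps diff_divide_distrib)
    have Seq: "S x = ?S (\<lambda>A i \<alpha>. dh A \<alpha> x * (dPhi A i \<alpha> (fst (\<xi>hat x)) - P A i \<alpha> x) * (vhat x $ i -
      v x $ i)
          + dv i \<alpha> x * (pd A G (\<xi>hat x) - h A x) * (dPhi A i \<alpha> (fst (\<xi>hat x)) - P A i \<alpha> x)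
          + dv i \<alpha> x * (pd A G (\<xi>hat x) - h A x - C A x) * P A i \<alpha> x)
        + ?S (\<lambda>A i \<alpha>. dh A \<alpha> x * (P A i \<alpha> x * (v1 x $ i - vhat x $ i)
              + (dPhi A i \<alpha> (fst (\<xi>hat x)) - P A i \<alpha> x) * (v1 x $ i - vhat x $ i)
              + (Ps A i \<alpha> x - dPhi A i \<alpha> (fst (\<xi>hat x))) * (v1 x $ i - vhat x $ i)
              + (Ps A i \<alpha> x - dPhi A i \<alpha> (fst (\<xi>hat x))) * (vhat x $ i - v x $ i))
          + dv i \<alpha> x * ((pd A G (\<xi>1 x) - pd A G (\<xi>hat x)) * P A i \<alpha> x
              + (pd A G (\<xi>1 x) - pd A G (\<xi>hat x)) * (Ps A i \<alpha> x - dPhi A i \<alpha> (fst (\<xi>hat x)))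
              + (pd A G (\<xi>1 x) - pd A G (\<xi>hat x)) * (dPhi A i \<alpha> (fst (\<xi>hat x)) - P A i \<alpha> x)
              + (pd A G (\<xi>hat x) - h A x) * (Ps A i \<alpha> x - dPhi A i \<alpha> (fst (\<xi>hat x)))))
        + ?S (\<lambda>A i \<alpha>. pd A G (\<xi>1 x) * Ps A i \<alpha> x * (dw i \<alpha> x - dv i \<alpha> x))"
      unfolding S_def Q_term_def E_term_def Ebar_term_def w_def[symmetric] p2 h_def[symmetric]
        C_def[symmetric]
        dh_def[symmetric] dv_def[symmetric] P_def[symmetric] Ps_def[symmetric] ..
    have I2eq: "I2 x = ?S (\<lambda>A i \<alpha>. pd A G (\<xi>1 x) * Ps A i \<alpha> x * (dv1 i \<alpha> x - dw i \<alpha> x))"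
      unfolding I2_def p1 Ps_def ..
    have I4eq: "I4 x = ?S (\<lambda>A i \<alpha>. Ps A i \<alpha> x * (dh A \<alpha> x * (v1 x $ i - v x $ i) + h A x * (dv1 i \<alpha>
      x - dv i \<alpha> x)))"
      unfolding I4_def Ps_def by (intro sum.cong refl) (simp only: p3)
    \<comment> \<open>All sums run over the same triple of indices, so it is enough to apply
      \<open>relative_entropy_algebra\<close> to a single summand.\<close>
    have comb: "?S a - ?S b - ?S c - ?S d - ?S e - ?S f = ?S m - ?S n"
      if "\<And>A i \<alpha>. a A i \<alpha> - b A i \<alpha> - c A i \<alpha> - d A i \<alpha> - e A i \<alpha> - f A i \<alpha> = m A i \<alpha> - n A i \<alpha>"
      for a b c d e f m n :: "xi_vec \<Rightarrow> 3 \<Rightarrow> 3 \<Rightarrow> real"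
      unfolding sum_subtractf[symmetric] that ..
    have "R x - S x = (I1 x - I3 x) + (I2 x - I4 x)"
      unfolding Req Seq I13 I2eq I4eq
      by (subst comb[symmetric, OF relative_entropy_algebra]) simp
    then show "R x - S x = I1 x + I2 x - I3 x - I4 x" by simp
  qed
  then have "(LINT x|torus. R x - S x) = (LINT x|torus. I1 x + I2 x - I3 x - I4 x)"
    using ess_bounded_diff[OF ebR ebS] int
    by (intro integral_cong_AE) (auto simp: ess_bounded_def)
  also have "\<dots> = 0" using int z12 z3 z4 by simp
  finally show "(LINT x|torus. R x) = (LINT x|torus. S x)"
    using integrable_ess_bounded[OF ebR] integrable_ess_bounded[OF ebS] by simp
qed

end

section \<open>Time derivative of the relative entropy\<close>

lemma eta_has_derivative:
  assumes "Ck_on (Suc 0) UNIV G"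
  shows "(eta G has_derivative (\<lambda>h. v \<bullet> fst h + pd (snd h) G \<xi>)) (at (v, \<xi>))"
proof -
  have G: "(G has_derivative (\<lambda>h. pd h G \<xi>)) (at \<xi>)"
    by (rule has_derivative_pd[OF Ck_differentiable[OF assms]]) simp
  have "((\<lambda>z::state. 1 / 2 * (fst z \<bullet> fst z) + G (snd z)) has_derivative (\<lambda>h. v \<bullet> fst h + pd (snd h)
    G \<xi>)) (at (v, \<xi>))"
  proof (rule has_derivative_add)
    show "((\<lambda>z::state. 1 / 2 * (fst z \<bullet> fst z)) has_derivative (\<lambda>h. v \<bullet> fst h)) (at (v, \<xi>))"
      by (auto intro!: derivative_eq_intros simp: inner_commute)
    have "(snd has_derivative snd) (at (v, \<xi>))" by (rule bounded_linear_imp_has_derivative[OF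
      bounded_linear_snd])
    then show "((\<lambda>z::state. G (snd z)) has_derivative (\<lambda>h. pd (snd h) G \<xi>)) (at (v, \<xi>))"
      by (rule has_derivative_compose) (simp add: G)
  qed
  moreover have "eta G = (\<lambda>z. 1 / 2 * (fst z \<bullet> fst z) + G (snd z))"
    by (auto simp: eta_def fun_eq_iff power2_norm_eq_inner)
  ultimately show ?thesis by simp
qed

lemma pd_real_direction_sum:
  fixes f :: "'a::euclidean_space \<Rightarrow> real"
  shows "f differentiable (at x) \<Longrightarrow> pd h f x = (\<Sum>b\<in>Basis. (h \<bullet> b) * pd b f x)"
  using pd_direction_sum[of f x h] by simp

lemma grad_inner: "f differentiable (at x) \<Longrightarrow> grad f x \<bullet> w = pd w f x"
  by (simp add: grad_def inner_sum_left pd_real_direction_sum[of f x w] inner_commute[of w]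
    mult.commute)

lemma grad_eta_inner:
  assumes "Ck_on (Suc 0) UNIV G"
  shows "grad (eta G) (v, \<xi>) \<bullet> (a, b) = v \<bullet> a + (\<Sum>A\<in>Basis. (b \<bullet> A) * pd A G \<xi>)"
proof -
  note d = eta_has_derivative[OF assms, of v \<xi>]
  have "grad (eta G) (v, \<xi>) \<bullet> (a, b) = pd (a, b) (eta G) (v, \<xi>)"
    by (rule grad_inner[OF differentiableI[OF d]])
  also have "\<dots> = v \<bullet> a + pd b G \<xi>" by (simp add: pd_eqI[OF d])
  finally show ?thesis using pd_real_direction_sum[where x = \<xi> and h = b, OF Ck_differentiable[OF
    assms]] by simp
qed

lemma eta_rel_eq:
  assumes "Ck_on (Suc 0) UNIV G"
  shows "eta_rel G (p, a) (q, b) = (1 / 2 * (p \<bullet> p) + G a) - (1 / 2 * (q \<bullet> q) + G b)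
    - (q \<bullet> (p - q) + (\<Sum>A\<in>Basis. ((a - b) \<bullet> A) * pd A G b))"
proof -
  have fd: "frechet_derivative (eta G) (at (q, b)) = (\<lambda>h. q \<bullet> fst h + pd (snd h) G b)"
    by (rule frechet_derivative_at[symmetric, OF eta_has_derivative[OF assms]])
  show ?thesis
    unfolding eta_rel_def fd
    using pd_real_direction_sum[where x = b and h = "a - b", OF Ck_differentiable[OF assms]]
    by (simp add: eta_def power2_norm_eq_inner)
qed

text \<open>First derivatives of \<open>eta\<close> at \<open>(q, b)\<close>, applied to the
  velocity of \<open>(q, b)\<close>, cancel between the value of \<open>eta\<close> there and its
  linear term. Of that motion only second derivatives survive, contracted with the difference of the
  states.\<close>

lemma eta_rel_has_derivative:
  fixes p q :: "real \<Rightarrow> real^3" and a b :: "real \<Rightarrow> xi_vec"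
  assumes G: "Ck_on 3 UNIV G"
    and d: "(p has_vector_derivative p') (at t)" "(q has_vector_derivative q') (at t)"
      "(a has_vector_derivative a') (at t)" "(b has_vector_derivative b') (at t)"
  shows "((\<lambda>s. eta_rel G (p s, a s) (q s, b s)) has_real_derivative
    ((p t - q t) \<bullet> p' + (\<Sum>A\<in>Basis. (pd A G (a t) - pd A G (b t)) * (a' \<bullet> A)) - q' \<bullet> (p t - q t)
      - (\<Sum>A\<in>Basis. (b' \<bullet> A) * (\<Sum>B\<in>Basis. pd B (pd A G) (b t) * ((a t - b t) \<bullet> B))))) (at t)"
proof -
  have G1: "Ck_on (Suc 0) UNIV G" by (rule Ck_on_mono[OF G]) simp
  have G2: "Ck_on (Suc (Suc 0)) UNIV G" by (rule Ck_on_mono[OF G]) simp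
  have GA: "pd A G differentiable (at x)" if "A \<in> Basis" for A x
    using Ck_differentiable[OF Ck_pd[OF G _ that]] by simp
  have Gd: "G differentiable (at x)" for x by (rule Ck_differentiable[OF G1]) simp
  have chain: "((\<lambda>s. f (c s)) has_real_derivative (\<Sum>B\<in>Basis. (c' \<bullet> B) * pd B f (c t))) (at t)"
    if f: "f differentiable (at (c t))" and c: "(c has_vector_derivative c') (at t)"
    for f :: "xi_vec \<Rightarrow> real" and c c'
  proof -
    have "((\<lambda>s. f (c s)) has_derivative (\<lambda>h. pd (h *\<^sub>R c') f (c t))) (at t)"
      by (rule has_derivative_compose[OF c[unfolded has_vector_derivative_def] has_derivative_pd[OF f]])
    moreover have "pd (h *\<^sub>R c') f (c t) = (\<Sum>B\<in>Basis. (c' \<bullet> B) * pd B f (c t)) * h" for h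
      unfolding pd_real_direction_sum[OF f, of "h *\<^sub>R c'"] sum_distrib_right
      by (intro sum.cong refl) (simp add: mult_ac)
    ultimately show ?thesis by (simp add: has_field_derivative_def)
  qed
  have inn: "((\<lambda>s. x s \<bullet> y s) has_real_derivative (x t \<bullet> y' + x' \<bullet> y t)) (at t)"
    if "(x has_vector_derivative x') (at t)" "(y has_vector_derivative y') (at t)"
    for x y :: "real \<Rightarrow> 'z::real_inner" and x' y'
    using has_derivative_inner[OF that[unfolded has_vector_derivative_def]]
    by (rule has_derivative_imp_has_field_derivative) (simp add: algebra_simps)
  have pq: "((\<lambda>s. p s - q s) has_vector_derivative (p' - q')) (at t)"
    and ab: "((\<lambda>s. a s - b s) has_vector_derivative (a' - b')) (at t)"
    by (intro has_vector_derivative_diff d)+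
  have cA: "((\<lambda>s. A) has_vector_derivative 0) (at t)" for A :: xi_vec by (rule
    has_vector_derivative_const)
  have lin: "((\<lambda>s. (a s - b s) \<bullet> A) has_real_derivative (a' - b') \<bullet> A) (at t)" for A
    using inn[OF ab cA[of A]] by simp
  have prod_deriv: "((\<lambda>s. ((a s - b s) \<bullet> A) * pd A G (b s)) has_real_derivative
      ((a' - b') \<bullet> A) * pd A G (b t) + ((a t - b t) \<bullet> A) * (\<Sum>B\<in>Basis. (b' \<bullet> B) * pd B (pd A G) (b
        t))) (at t)"
    if A: "A \<in> Basis" for A
    using DERIV_mult[OF lin[of A] chain[OF GA[OF A] d(4)]] by (simp add: algebra_simps)
  have main: "((\<lambda>s. eta_rel G (p s, a s) (q s, b s)) has_real_derivative
     ((1 / 2 * (p t \<bullet> p' + p' \<bullet> p t) + (\<Sum>B\<in>Basis. (a' \<bullet> B) * pd B G (a t)))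
      - (1 / 2 * (q t \<bullet> q' + q' \<bullet> q t) + (\<Sum>B\<in>Basis. (b' \<bullet> B) * pd B G (b t)))
      - ((q t \<bullet> (p' - q') + q' \<bullet> (p t - q t))
         + (\<Sum>A\<in>Basis. ((a' - b') \<bullet> A) * pd A G (b t) + ((a t - b t) \<bullet> A) * (\<Sum>B\<in>Basis. (b' \<bullet> B) * pd
           B (pd A G) (b t)))))) (at t)"
    unfolding eta_rel_eq[OF G1]
    by (intro DERIV_diff DERIV_add DERIV_cmult DERIV_sum inn chain prod_deriv d pq Gd)
  \<comment> \<open>Symmetry of the second derivatives of \<open>G\<close> exchanges the velocity
    \<open>b'\<close> with the difference \<open>a t - b t\<close>, so that \<open>b'\<close> ends
    up in the outer sum.\<close>
  have sym: "(\<Sum>A\<in>Basis. ((a t - b t) \<bullet> A) * (\<Sum>B\<in>Basis. (b' \<bullet> B) * pd B (pd A G) (b t)))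
      = (\<Sum>A\<in>Basis. (b' \<bullet> A) * (\<Sum>B\<in>Basis. pd B (pd A G) (b t) * ((a t - b t) \<bullet> B)))"
  proof -
    have "(\<Sum>A\<in>Basis. ((a t - b t) \<bullet> A) * (\<Sum>B\<in>Basis. (b' \<bullet> B) * pd B (pd A G) (b t)))
        = (\<Sum>A\<in>Basis. \<Sum>B\<in>Basis. ((a t - b t) \<bullet> A) * ((b' \<bullet> B) * pd B (pd A G) (b t)))"
      by (simp only: sum_distrib_left)
    also have "\<dots> = (\<Sum>B\<in>Basis. \<Sum>A\<in>Basis. ((a t - b t) \<bullet> A) * ((b' \<bullet> B) * pd B (pd A G) (b t)))"
      by (rule sum.swap)
    also have "\<dots> = (\<Sum>B\<in>Basis. \<Sum>A\<in>Basis. (b' \<bullet> B) * (pd A (pd B G) (b t) * ((a t - b t) \<bullet> A)))"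
      by (intro sum.cong refl) (simp add: pd_commute[OF G2])
    finally show ?thesis by (simp only: sum_distrib_left)
  qed
  have eq: "(1 / 2 * (p t \<bullet> p' + p' \<bullet> p t) + (\<Sum>B\<in>Basis. (a' \<bullet> B) * pd B G (a t)))
      - (1 / 2 * (q t \<bullet> q' + q' \<bullet> q t) + (\<Sum>B\<in>Basis. (b' \<bullet> B) * pd B G (b t)))
      - ((q t \<bullet> (p' - q') + q' \<bullet> (p t - q t))
         + (\<Sum>A\<in>Basis. ((a' - b') \<bullet> A) * pd A G (b t) + ((a t - b t) \<bullet> A) * (\<Sum>B\<in>Basis. (b' \<bullet> B) * pd
           B (pd A G) (b t))))
    = (p t - q t) \<bullet> p' + (\<Sum>A\<in>Basis. (pd A G (a t) - pd A G (b t)) * (a' \<bullet> A)) - q' \<bullet> (p t - q t)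
      - (\<Sum>A\<in>Basis. (b' \<bullet> A) * (\<Sum>B\<in>Basis. pd B (pd A G) (b t) * ((a t - b t) \<bullet> B)))"
    unfolding sym[symmetric]
    by (simp add: sum.distrib sum_subtractf inner_diff_left inner_diff_right inner_commute[of p']
      inner_commute[of q']
        left_diff_distrib mult.commute[of "pd _ G _"])
  show ?thesis by (rule main[unfolded eq])
qed

section \<open>Interpolation in time\<close>

text \<open>Strict inequalities keep a whole neighbourhood of \<open>t\<close> in one grid interval,
  so that the interpolates can be differentiated there. The shift to \<open>Suc\<close> comes from
  counting the intervals from 1.\<close>

lemma chi_eq:
  assumes "real n * \<tau> < t" "t < real (Suc n) * \<tau>" "0 < \<tau>"
  shows "chi \<tau> (Suc m) t = (if m = n then 1 else 0)"
proof (cases "m = n")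
  case True
  then show ?thesis using assms by (simp add: chi_def algebra_simps)
next
  case False
  then have "m < n \<or> n < m" by linarith
  then have "\<not> (real m * \<tau> \<le> t \<and> t < real (Suc m) * \<tau>)"
  proof
    assume "m < n"
    then have "real (Suc m) * \<tau> \<le> real n * \<tau>" using assms(3) by (intro mult_right_mono) auto
    then show ?thesis using assms by linarith
  next
    assume "n < m"
    then have "real (Suc n) * \<tau> \<le> real m * \<tau>" using assms(3) by (intro mult_right_mono) auto
    then show ?thesis using assms by linarith
  qed
  then show ?thesis using False by (simp add: chi_def indicator_def)
qed

lemma suminf_chi:
  fixes f :: "nat \<Rightarrow> 'a::real_normed_vector"
  assumes "real n * \<tau> < t" "t < real (Suc n) * \<tau>" "0 < \<tau>"
  shows "(\<Sum>m. chi \<tau> (Suc m) t *\<^sub>R f m) = f n"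
proof -
  have "(\<lambda>m. chi \<tau> (Suc m) t *\<^sub>R f m) = (\<lambda>m. if m = n then f m else 0)"
    by (simp add: chi_eq[OF assms] fun_eq_iff)
  then show ?thesis using sums_unique[OF sums_single[of n f]] by simp
qed

lemma interp_eq:
  assumes "real n * \<tau> < t" "t < real (Suc n) * \<tau>" "0 < \<tau>"
  shows "hat_interp \<tau> f t x = f n x + ((t - \<tau> * real n) / \<tau>) *\<^sub>R (f (Suc n) x - f n x)"
    and "bar_interp \<tau> f t x = f (Suc n) x"
    and "lag_interp \<tau> f t x = f n x"
  unfolding hat_interp_def bar_interp_def lag_interp_def by (rule suminf_chi[OF assms])+

lemma hat_interp_has_derivative:
  assumes "real n * \<tau> < t" "t < real (Suc n) * \<tau>" "0 < \<tau>"
  shows "((\<lambda>s. hat_interp \<tau> f s x) has_vector_derivative (1 / \<tau>) *\<^sub>R (f (Suc n) x - f n x)) (at t)"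
proof (rule has_vector_derivative_transform_within_open)
  show "((\<lambda>s. f n x + ((s - \<tau> * real n) / \<tau>) *\<^sub>R (f (Suc n) x - f n x)) has_vector_derivative (1 /
    \<tau>) *\<^sub>R (f (Suc n) x - f n x)) (at t)"
    using assms(3) by (auto intro!: derivative_eq_intros)
  show "t \<in> {real n * \<tau> <..< real (Suc n) * \<tau>}" using assms by simp
  show "f n x + ((s - \<tau> * real n) / \<tau>) *\<^sub>R (f (Suc n) x - f n x) = hat_interp \<tau> f s x"
    if "s \<in> {real n * \<tau> <..< real (Suc n) * \<tau>}" for s
    using interp_eq(1)[of n \<tau> s f x] that assms(3) by simp
qed simp

text \<open>The excluded times form a countable set. The end times \<open>0\<close> and
  \<open>T\<close> are among them, which makes derivatives within \<open>{0..T}\<close>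
  two-sided.\<close>

lemma AE_between_grid_points:
  assumes "0 < \<tau>"
  shows "AE t in lebesgue_on {0..T}. 0 < t \<and> t < T \<and> (\<exists>n. real n * \<tau> < t \<and> t < real (Suc n) * \<tau>)"
proof -
  let ?N = "{0, T} \<union> range (\<lambda>n. real n * \<tau>)"
  have "countable ?N" by simp
  then have "?N \<in> null_sets lebesgue" by (intro null_sets_completionI countable_imp_null_set_lborel)
  then have "AE t in lebesgue. t \<notin> ?N" by (rule AE_not_in)
  then have "AE t in lebesgue. t \<in> {0..T} \<longrightarrow> 0 < t \<and> t < T \<and> (\<exists>n. real n * \<tau> < t \<and> t < real (Suc n) * \<tau>)"
  proof eventually_elim
    case (elim t)
    show ?case
    proof
      assume t: "t \<in> {0..T}"
      define n where "n = nat \<lfloor>t / \<tau>\<rfloor>"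
      have "0 \<le> t / \<tau>" using t assms by simp
      then have "real n = of_int \<lfloor>t / \<tau>\<rfloor>" by (simp add: n_def)
      then have "real n \<le> t / \<tau>" "t / \<tau> < real n + 1" by linarith+
      then have "real n * \<tau> \<le> t" "t < real (Suc n) * \<tau>" using assms by (simp_all add: field_simps)
      moreover have "real n * \<tau> \<noteq> t" "t \<noteq> 0" "t \<noteq> T" using elim by auto
      ultimately show "0 < t \<and> t < T \<and> (\<exists>n. real n * \<tau> < t \<and> t < real (Suc n) * \<tau>)"
        using t by (intro conjI exI[of _ n]) auto
    qed
  qed
  then show ?thesis by (subst AE_restrict_space_iff) auto
qed

lemma D_term_eq:
  assumes n: "real n * \<tau> < t" "t < real (Suc n) * \<tau>" "0 < \<tau>" and G: "Ck_on (Suc 0) UNIV G"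
  shows "D_term G \<tau> (\<lambda>n x. (vh n x, \<xi>h n x)) t x
    = (vh (Suc n) x - hat_interp \<tau> vh t x) \<bullet> (vh (Suc n) x - vh n x)
      + (\<Sum>A\<in>Basis. (pd A G (\<xi>h (Suc n) x) - pd A G (hat_interp \<tau> \<xi>h t x)) * ((\<xi>h (Suc n) x - \<xi>h n x)
        \<bullet> A))"
proof -
  have hat: "hat_interp \<tau> (\<lambda>n x. (vh n x, \<xi>h n x)) t x = (hat_interp \<tau> vh t x, hat_interp \<tau> \<xi>h t x)"
    by (simp add: interp_eq(1)[OF n])
  have "D_term G \<tau> (\<lambda>n x. (vh n x, \<xi>h n x)) t x
    = (grad (eta G) (vh (Suc n) x, \<xi>h (Suc n) x) - grad (eta G) (hat_interp \<tau> vh t x, hat_interp \<tau>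
      \<xi>h t x))
      \<bullet> (vh (Suc n) x - vh n x, \<xi>h (Suc n) x - \<xi>h n x)"
    unfolding D_term_def using suminf_chi[OF n, of "\<lambda>m. (grad (eta G) (bar_interp \<tau> (\<lambda>n x. (vh n x,
      \<xi>h n x)) t x)
      - grad (eta G) (hat_interp \<tau> (\<lambda>n x. (vh n x, \<xi>h n x)) t x)) \<bullet> ((vh (Suc m) x, \<xi>h (Suc m) x) -
        (vh m x, \<xi>h m x))"]
    by (simp add: interp_eq(2)[OF n] hat)
  also have "\<dots> = (vh (Suc n) x - hat_interp \<tau> vh t x) \<bullet> (vh (Suc n) x - vh n x)
      + (\<Sum>A\<in>Basis. (pd A G (\<xi>h (Suc n) x) - pd A G (hat_interp \<tau> \<xi>h t x)) * ((\<xi>h (Suc n) x - \<xi>h n x)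
        \<bullet> A))"
  proof -
    have s: "(\<Sum>A\<in>Basis. (d \<bullet> A) * g A) - (\<Sum>A\<in>Basis. (d \<bullet> A) * h A) = (\<Sum>A\<in>Basis. (g A - h A) * (d \<bullet> A))"
      for d :: xi_vec and g h
      unfolding sum_subtractf[symmetric] by (intro sum.cong refl) (simp add: algebra_simps)
    show ?thesis
      unfolding inner_diff_left[of "grad _ _"] grad_eta_inner[OF G] s[symmetric] by (simp only:
        inner_diff_left)
  qed
  finally show ?thesis .
qed

text \<open>In the equations for the components of \<open>F\<close> the coefficients
  \<open>dPhi\<close> are Kronecker symbols, so \<open>F\<close> evolves by the gradient of
  \<open>v\<close> and the initial symmetry persists.\<close>

lemma smooth_solution_curl_free:
  assumes sol: "smooth_solution G T v \<xi>" and F0: "is_gradient (\<lambda>x. fst (\<xi> 0 x))" and t: "t \<in> {0..T}"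
  shows "curl_free (\<lambda>x. fst (\<xi> t x))"
proof -
  have sm: "smooth_on ({0..T} \<times> UNIV) (\<lambda>(t, x). v t x)" "smooth_on ({0..T} \<times> UNIV) (\<lambda>(t, x). \<xi> t x)"
    and eq: "\<And>t x A. t \<in> {0..T} \<Longrightarrow> A \<in> Basis \<Longrightarrow> ((\<lambda>s. \<xi> s x \<bullet> A) has_real_derivative
          (\<Sum>\<alpha>\<in>UNIV. pd (axis \<alpha> 1)
             (\<lambda>y. \<Sum>i\<in>UNIV. dPhi A i \<alpha> (fst (\<xi> t y)) * v t y $ i) x)) (at t within {0..T})"
    using sol unfolding smooth_solution_def by blast+
  have vC: "Ck_on k UNIV (v t)" and \<xi>C: "Ck_on k UNIV (\<xi> t)" if "t \<in> {0..T}" for t k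
    using sm that by (auto intro: slice_Ck simp: smooth_on_def)
  have vd: "v t differentiable (at x)" if "t \<in> {0..T}" for t x
    by (rule Ck_differentiable[OF vC[OF that, of 1]]) simp
  show ?thesis
  proof (rule curl_free_evolution[where F = "\<lambda>t x. fst (\<xi> t x)" and v = v, OF _ _ _ _
    gradient_curl_free[OF F0] t])
    fix t x i \<alpha> assume t: "t \<in> {0..T}"
    let ?A = "(axis i (axis \<alpha> 1), 0, 0) :: xi_vec"
    have dP: "dPhi ?A j \<beta> F = (if j = i then if \<beta> = \<alpha> then 1 else 0 else 0)" for j \<beta> F
      by (auto simp: dPhi_eq axis_def)
    have "(\<Sum>\<beta>\<in>UNIV. pd (axis \<beta> 1) (\<lambda>y. \<Sum>j\<in>UNIV. dPhi ?A j \<beta> (fst (\<xi> t y)) * v t y $ j) x)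
        = (\<Sum>\<beta>\<in>UNIV. if \<beta> = \<alpha> then pd (axis \<alpha> 1) (\<lambda>y. v t y $ i) x else 0)"
      by (intro sum.cong refl) (simp add: dP if_distrib[of "\<lambda>u. u * _"] cong: if_cong)
    also have "\<dots> = pd (axis \<alpha> 1) (\<lambda>y. v t y $ i) x" by simp
    finally show "((\<lambda>s. fst (\<xi> s x) $ i $ \<alpha>) has_real_derivative pd (axis \<alpha> 1) (\<lambda>y. v t y $ i) x)
      (at t within {0..T})"
      using eq[OF t xi_Basis[OF axis_axis_Basis[of i \<alpha>]], of x] by (simp add: inner_prod_def
        inner_axis_axis_mat3)
  next
    fix i \<alpha> :: 3
    have "continuous_on ({0..T} \<times> UNIV) (\<lambda>(t, x). pd (axis \<alpha> 1) (v t) x)"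
      using Ck_on_imp_continuous[OF slice_Ck_pd[of 0 T v "axis \<alpha> 1"]] sm axis_Basis
      by (auto simp: smooth_on_def simp del: Ck_on.simps)
    then have c: "continuous_on ({0..T} \<times> UNIV) (\<lambda>z. (case z of (t, x) \<Rightarrow> pd (axis \<alpha> 1) (v t) x) $ i)"
      by (intro continuous_intros)
    have "(case z of (t, x) \<Rightarrow> pd (axis \<alpha> 1) (v t) x) $ i = (case z of (t, x) \<Rightarrow> pd (axis \<alpha> 1) (\<lambda>y. v
      t y $ i) x)"
      if "z \<in> {0..T} \<times> UNIV" for z
      using that pd_bounded_linear[OF bounded_linear_vec_nth vd] by auto
    from continuous_on_cong[OF refl this] c
    show "continuous_on ({0..T} \<times> UNIV) (\<lambda>(t, x). pd (axis \<alpha> 1) (\<lambda>y. v t y $ i) x)" by (rule iffD1)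
  next
    fix t assume t: "t \<in> {0..T}"
    show "continuous_on UNIV (\<lambda>x. fst (\<xi> t x))"
      using Ck_on_imp_continuous[OF \<xi>C[OF t, of 0]] by (rule continuous_on_fst)
    show "admissible (\<lambda>x. v t x $ i)" for i
      by (intro C1_imp_admissible Ck_bounded_linear[OF bounded_linear_vec_nth] vC t)
  qed
qed

theorem lemma4p4:
  fixes G :: "xi_vec \<Rightarrow> real"
    and \<T> :: "(real^3) set set" and k :: nat
    and \<tau> T :: real
    and vh :: "nat \<Rightarrow> real^3 \<Rightarrow> real^3" and \<xi>h :: "nat \<Rightarrow> real^3 \<Rightarrow> xi_vec"
    and v vhat vbar :: "real \<Rightarrow> real^3 \<Rightarrow> real^3"
    and \<xi> \<xi>hat \<xi>bar :: "real \<Rightarrow> real^3 \<Rightarrow> xi_vec"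
    and Fstar :: "real \<Rightarrow> real^3 \<Rightarrow> mat3"
    and \<eta>r :: "real \<Rightarrow> real^3 \<Rightarrow> real"
    and rhs :: "real \<Rightarrow> real^3 \<Rightarrow> real"
  assumes G: "energy_assms G"
    and mesh: "torus_triangulation \<T>" and k: "k \<ge> 1"
    and \<tau>: "\<tau> > 0" and T: "T > 0"
    and scheme: "scheme G \<T> k \<tau> vh \<xi>h"
    and F0h: "is_gradient (\<lambda>x. fst (\<xi>h 0 x))"
    and sol: "smooth_solution G T v \<xi>"
    and F0: "is_gradient (\<lambda>x. fst (\<xi> 0 x))"
    and vhat: "vhat = hat_interp \<tau> vh" and \<xi>hat: "\<xi>hat = hat_interp \<tau> \<xi>h"
    and vbar: "vbar = bar_interp \<tau> vh" and \<xi>bar: "\<xi>bar = bar_interp \<tau> \<xi>h"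
    and Fstar: "Fstar = lag_interp \<tau> (\<lambda>n x. fst (\<xi>h n x))"
    and \<eta>r: "\<eta>r = (\<lambda>t x. eta_rel G (vhat t x, \<xi>hat t x) (v t x, \<xi> t x))"
    and rhs: "rhs = (\<lambda>t x.
        - 1 / \<tau> * D_term G \<tau> (\<lambda>n x. (vh n x, \<xi>h n x)) t x
        + Q_term G (v t) (\<xi> t) (vhat t) (\<xi>hat t) x
        + E_term G (v t) (\<xi> t) (vhat t) (\<xi>hat t) (vbar t) (\<xi>bar t) (Fstar t) x
        + Ebar_term G \<T> k (v t) (\<xi>bar t) (Fstar t) x)"
  shows "AE t in lebesgue_on {0..T}.
           (AE x in torus. (\<lambda>s. \<eta>r s x) differentiable (at t)) \<and>
           integrable torus (\<lambda>x. deriv (\<lambda>s. \<eta>r s x) t) \<and>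
           integrable torus (rhs t) \<and>
           (LINT x|torus. deriv (\<lambda>s. \<eta>r s x) t) = (LINT x|torus. rhs t x)"
proof -
  interpret torus_mesh \<T> by unfold_locales (rule mesh)
  have G3: "Ck_on 3 UNIV G" using G unfolding energy_assms_def by blast
  have G1: "Ck_on (Suc 0) UNIV G" by (rule Ck_on_mono[OF G3]) simp
  have spaces: "vh n \<in> U_space \<T> k" "\<xi>h n \<in> H_space \<T> k" for n
    using scheme unfolding scheme_def by blast+
  have mom: "(LINT x|torus. (\<Sum>i\<in>UNIV. (vh (Suc n) x $ i - vh n x $ i) / \<tau> * \<phi> x $ i))
      = - (LINT x|torus. (\<Sum>A\<in>Basis. \<Sum>i\<in>UNIV. \<Sum>\<alpha>\<in>UNIV.
            pd A G (\<xi>h (Suc n) x) * dPhi A i \<alpha> (fst (\<xi>h n x)) * pd (axis \<alpha> 1) (\<lambda>x. \<phi> x $ i) x))"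
    if "\<phi> \<in> U_space \<T> k" for n \<phi>
    using scheme[unfolded scheme_def, THEN conjunct2, rule_format, of "Suc n", THEN conjunct1,
      rule_format, OF _ that] by simp
  have trans: "(LINT x|torus. (\<Sum>A\<in>Basis. (\<xi>h (Suc n) x \<bullet> A - \<xi>h n x \<bullet> A) / \<tau> * (\<psi> x \<bullet> A)))
      = (LINT x|torus. (\<Sum>A\<in>Basis. \<Sum>i\<in>UNIV. \<Sum>\<alpha>\<in>UNIV.
          dPhi A i \<alpha> (fst (\<xi>h n x)) * pd (axis \<alpha> 1) (\<lambda>x. vh (Suc n) x $ i) x * (\<psi> x \<bullet> A)))"
    if "\<psi> \<in> H_space \<T> k" for n \<psi>
    using scheme[unfolded scheme_def, THEN conjunct2, rule_format, of "Suc n", THEN conjunct2,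
      rule_format, OF _ that] by simp
  note incr = scheme_increment[OF spaces(1) spaces(2) spaces(2) trans]
  have cfh: "curl_free (\<lambda>x. fst (\<xi>h n x))" for n
  proof (induction n)
    case 0
    show ?case by (rule gradient_curl_free[OF F0h])
  next
    case (Suc n)
    show ?case by (rule curl_free_step[OF spaces(1) spaces(2) spaces(2) _ incr Suc]) (use \<tau> in simp)
  qed
  have main: "(AE x in torus. (\<lambda>s. \<eta>r s x) differentiable (at t)) \<and>
      integrable torus (\<lambda>x. deriv (\<lambda>s. \<eta>r s x) t) \<and> integrable torus (rhs t) \<and>
      (LINT x|torus. deriv (\<lambda>s. \<eta>r s x) t) = (LINT x|torus. rhs t x)"
    if t: "0 < t" "t < T" and n: "real n * \<tau> < t" "t < real (Suc n) * \<tau>" for t n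
  proof -
    have tT: "t \<in> {0..T}" using t by simp
    note n' = n \<tau>
    have sm: "smooth_on ({0..T} \<times> UNIV) (\<lambda>(t, x). v t x)" "smooth_on ({0..T} \<times> UNIV) (\<lambda>(t, x). \<xi> t x)"
      and per: "periodic (v t)" "periodic (\<xi> t)"
      and eqv: "\<And>x i. ((\<lambda>s. v s x $ i) has_real_derivative
          (\<Sum>\<alpha>\<in>UNIV. pd (axis \<alpha> 1)
             (\<lambda>y. \<Sum>A\<in>Basis. pd A G (\<xi> t y) * dPhi A i \<alpha> (fst (\<xi> t y))) x)) (at t within {0..T})"
      and eq\<xi>: "\<And>x A. A \<in> Basis \<Longrightarrow> ((\<lambda>s. \<xi> s x \<bullet> A) has_real_derivative
          (\<Sum>\<alpha>\<in>UNIV. pd (axis \<alpha> 1)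
             (\<lambda>y. \<Sum>i\<in>UNIV. dPhi A i \<alpha> (fst (\<xi> t y)) * v t y $ i) x)) (at t within {0..T})"
      using sol tT unfolding smooth_solution_def by blast+
    have vC: "Ck_on 2 UNIV (v t)" and \<xi>C: "Ck_on 2 UNIV (\<xi> t)"
      using sm tT by (auto intro: slice_Ck simp: smooth_on_def simp del: Ck_on.simps)
    \<comment> \<open>The time derivatives are introduced as the right-hand sides of the system,
      which are fields of \<open>x\<close> alone, as \<open>spatial_identity\<close>
      requires.\<close>
    define vt where "vt x = (\<chi> i. \<Sum>\<alpha>\<in>UNIV. pd (axis \<alpha> 1)
        (\<lambda>y. \<Sum>A\<in>Basis. pd A G (\<xi> t y) * dPhi A i \<alpha> (fst (\<xi> t y))) x)" for x
    define \<xi>t where "\<xi>t x = (\<Sum>A\<in>Basis. (\<Sum>\<alpha>\<in>UNIV. pd (axis \<alpha> 1)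
        (\<lambda>y. \<Sum>i\<in>UNIV. dPhi A i \<alpha> (fst (\<xi> t y)) * v t y $ i) x) *\<^sub>R A)" for x
    have vt: "vt x $ i = (\<Sum>\<alpha>\<in>UNIV. pd (axis \<alpha> 1)
        (\<lambda>y. \<Sum>A\<in>Basis. pd A G (\<xi> t y) * dPhi A i \<alpha> (fst (\<xi> t y))) x)" for x i
      by (simp add: vt_def)
    have \<xi>t: "\<xi>t x \<bullet> A = (\<Sum>\<alpha>\<in>UNIV. pd (axis \<alpha> 1)
        (\<lambda>y. \<Sum>i\<in>UNIV. dPhi A i \<alpha> (fst (\<xi> t y)) * v t y $ i) x)" if "A \<in> Basis" for x A
      using that by (simp add: \<xi>t_def)
    have at_t: "at t within {0..T} = at t" using t by (intro at_within_interior) simp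
    have dv: "((\<lambda>s. v s x) has_vector_derivative vt x) (at t)" for x
      unfolding has_vector_derivative_def
    proof (subst has_derivative_componentwise_within, intro ballI)
      fix b :: "real^3" assume "b \<in> Basis"
      then obtain i where b: "b = axis i 1" by (auto simp: Basis_vec_def)
      show "((\<lambda>s. v s x \<bullet> b) has_derivative (\<lambda>h. (h *\<^sub>R vt x) \<bullet> b)) (at t)"
        using eqv[of x i, folded vt, unfolded at_t has_field_derivative_def]
        by (simp add: b inner_axis mult.commute[of _ "vt x $ i"])
    qed
    have d\<xi>: "((\<lambda>s. \<xi> s x) has_vector_derivative \<xi>t x) (at t)" for x
      unfolding has_vector_derivative_def
    proof (subst has_derivative_componentwise_within, intro ballI)
      fix A :: xi_vec assume A: "A \<in> Basis"
      show "((\<lambda>s. \<xi> s x \<bullet> A) has_derivative (\<lambda>h. (h *\<^sub>R \<xi>t x) \<bullet> A)) (at t)"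
        using eq\<xi>[OF A, of x, folded \<xi>t[OF A], unfolded at_t has_field_derivative_def]
        by (simp add: mult.commute[of _ "\<xi>t x \<bullet> A"])
    qed
    let ?R = "\<lambda>x. reduced_rate G \<tau> (vh n x) (\<xi>h n x) (vh (Suc n) x) (\<xi>h (Suc n) x) (vhat t x) (\<xi>hat t x)
        (v t x) (\<xi> t x) (vt x) (\<xi>t x)"
    let ?D = "\<lambda>x. D_term G \<tau> (\<lambda>n x. (vh n x, \<xi>h n x)) t x"
    \<comment> \<open>Replacing the derivative of \<open>eta\<close> at the interpolate by that at
      the new iterate produces \<open>- 1 / \<tau> * ?D x\<close>. The rest,
      \<open>reduced_rate\<close>, then contains the derivative of \<open>G\<close> at the new
      iterate, as the momentum equation does.\<close>
    have der: "((\<lambda>s. \<eta>r s x) has_real_derivative (- 1 / \<tau> * ?D x + ?R x)) (at t)" for x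
    proof -
      note h = hat_interp_has_derivative[OF n']
      have "((\<lambda>s. \<eta>r s x) has_real_derivative
        ((vhat t x - v t x) \<bullet> ((1 / \<tau>) *\<^sub>R (vh (Suc n) x - vh n x))
        + (\<Sum>A\<in>Basis. (pd A G (\<xi>hat t x) - pd A G (\<xi> t x)) * (((1 / \<tau>) *\<^sub>R (\<xi>h (Suc n) x - \<xi>h n x)) \<bullet> A))
        - vt x \<bullet> (vhat t x - v t x)
        - (\<Sum>A\<in>Basis. (\<xi>t x \<bullet> A) * (\<Sum>B\<in>Basis. pd B (pd A G) (\<xi> t x) * ((\<xi>hat t x - \<xi> t x) \<bullet> B)))))
          (at t)"
        unfolding \<eta>r vhat \<xi>hat by (rule eta_rel_has_derivative[OF G3 h dv h d\<xi>])
      moreover have "(vhat t x - v t x) \<bullet> ((1 / \<tau>) *\<^sub>R (vh (Suc n) x - vh n x))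
        + (\<Sum>A\<in>Basis. (pd A G (\<xi>hat t x) - pd A G (\<xi> t x)) * (((1 / \<tau>) *\<^sub>R (\<xi>h (Suc n) x - \<xi>h n x)) \<bullet> A))
        - vt x \<bullet> (vhat t x - v t x)
        - (\<Sum>A\<in>Basis. (\<xi>t x \<bullet> A) * (\<Sum>B\<in>Basis. pd B (pd A G) (\<xi> t x) * ((\<xi>hat t x - \<xi> t x) \<bullet> B)))
        = - 1 / \<tau> * ?D x + ?R x"
      proof -
        have A: "(vhat t x - v t x) \<bullet> ((1 / \<tau>) *\<^sub>R (vh (Suc n) x - vh n x))
            = - 1 / \<tau> * ((vh (Suc n) x - vhat t x) \<bullet> (vh (Suc n) x - vh n x))
              + (\<Sum>i\<in>UNIV. (vh (Suc n) x $ i - v t x $ i) * ((vh (Suc n) x $ i - vh n x $ i) / \<tau>))"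
        proof -
          have "(\<Sum>i\<in>UNIV. (vh (Suc n) x $ i - v t x $ i) * ((vh (Suc n) x $ i - vh n x $ i) / \<tau>))
              = 1 / \<tau> * ((vh (Suc n) x - v t x) \<bullet> (vh (Suc n) x - vh n x))"
            by (simp add: inner_vec_def sum_divide_distrib)
          moreover have "(vhat t x - v t x) \<bullet> (vh (Suc n) x - vh n x)
              = (vh (Suc n) x - v t x) \<bullet> (vh (Suc n) x - vh n x) - (vh (Suc n) x - vhat t x) \<bullet> (vh
                (Suc n) x - vh n x)"
            by (simp add: inner_diff_left)
          ultimately show ?thesis by (simp add: diff_divide_distrib)
        qed
        have B: "(\<Sum>A\<in>Basis. (pd A G (\<xi>hat t x) - pd A G (\<xi> t x)) * (((1 / \<tau>) *\<^sub>R (\<xi>h (Suc n) x - \<xi>h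
          n x)) \<bullet> A))
            = - 1 / \<tau> * (\<Sum>A\<in>Basis. (pd A G (\<xi>h (Suc n) x) - pd A G (\<xi>hat t x)) * ((\<xi>h (Suc n) x - \<xi>h
              n x) \<bullet> A))
              + (\<Sum>A\<in>Basis. (pd A G (\<xi>h (Suc n) x) - pd A G (\<xi> t x)) * ((\<xi>h (Suc n) x \<bullet> A - \<xi>h n x \<bullet>
                A) / \<tau>))"
          unfolding sum_distrib_left sum.distrib[symmetric]
          by (intro sum.cong refl) (simp add: inner_diff_left diff_divide_distrib algebra_simps)
        have C: "vt x \<bullet> (vhat t x - v t x) = (\<Sum>i\<in>UNIV. vt x $ i * (vhat t x $ i - v t x $ i))"
          by (simp add: inner_vec_def)
        show ?thesis
          unfolding D_term_eq[OF n' G1] reduced_rate_def A B C vhat[symmetric] \<xi>hat[symmetric]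
          by (simp add: distrib_left diff_divide_distrib add_divide_distrib)
      qed
      ultimately show ?thesis by simp
    qed
    have hatU: "ess_bounded (vhat t)" and hatH: "ess_bounded (\<xi>hat t)"
    proof -
      have s: "ess_bounded (\<lambda>x. c *\<^sub>R f x)" if "ess_bounded f" for c and f :: "real^3 \<Rightarrow>
        'z::euclidean_space"
        by (rule ess_bounded_compose[OF that]) (intro continuous_intros)
      show "ess_bounded (vhat t)"
        unfolding vhat interp_eq(1)[OF n', abs_def]
        by (intro ess_bounded_add s ess_bounded_diff ess_bounded_continuous U_space_continuous[OF
          spaces(1)])
      show "ess_bounded (\<xi>hat t)"
        unfolding \<xi>hat interp_eq(1)[OF n', abs_def]
        by (intro ess_bounded_add s ess_bounded_diff H_space_facts(4)[OF spaces(2)])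
    qed
    have ebG: "ess_bounded (\<lambda>x. pd A G (f x))" if "A \<in> Basis" "ess_bounded f" for A f
      using Ck_on_imp_continuous[OF Ck_pd[OF G3 _ that(1)]] by (intro ess_bounded_compose[OF
        that(2)]) simp
    have ebD: "ess_bounded ?D"
      unfolding D_term_eq[OF n' G1] vhat[symmetric] \<xi>hat[symmetric]
      by (intro ess_bounded_add ess_bounded_sum ess_bounded_mult ess_bounded_inner ess_bounded_diff ebG
          ess_bounded_inner_const ess_bounded_continuous U_space_continuous[OF spaces(1)]
            H_space_facts(4)[OF spaces(2)] hatU hatH)
    let ?S = "\<lambda>x. Q_term G (v t) (\<xi> t) (vhat t) (\<xi>hat t) x
        + E_term G (v t) (\<xi> t) (vhat t) (\<xi>hat t) (vh (Suc n)) (\<xi>h (Suc n)) (\<lambda>x. fst (\<xi>h n x)) x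
        + Ebar_term G \<T> k (v t) (\<xi>h (Suc n)) (\<lambda>x. fst (\<xi>h n x)) x"
    note id = spatial_identity[OF G3 spaces(1) spaces(1) spaces(2) spaces(2) cfh mom incr vC per(1)
      \<xi>C per(2)
        smooth_solution_curl_free[OF sol F0 tT] vt \<xi>t hatU hatH]
    \<comment> \<open>Inside the grid interval the piecewise constant interpolates are the iterates
      with index \<open>Suc n\<close>, and index \<open>n\<close> for the lagged \<open>F\<close>,
      which turns \<open>rhs t\<close> into the right-hand side of \<open>id\<close> plus the
      dissipation term.\<close>
    have bars: "vbar t = vh (Suc n)" "\<xi>bar t = \<xi>h (Suc n)" "Fstar t = (\<lambda>x. fst (\<xi>h n x))"
      by (simp_all add: vbar \<xi>bar Fstar fun_eq_iff interp_eq[OF n'])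
    have rhs_eq: "rhs t x = - 1 / \<tau> * ?D x + ?S x" for x
      unfolding rhs bars by simp
    have deriv_eq: "deriv (\<lambda>s. \<eta>r s x) t = - 1 / \<tau> * ?D x + ?R x" for x
      by (rule DERIV_imp_deriv[OF der])
    note int = integrable_ess_bounded[OF ebD] id(1,2)[THEN integrable_ess_bounded]
    have "(\<lambda>s. \<eta>r s x) differentiable (at t)" for x
      using der real_differentiable_def by blast
    moreover have "integrable torus (\<lambda>x. deriv (\<lambda>s. \<eta>r s x) t)"
      unfolding deriv_eq by (intro Bochner_Integration.integrable_add integrable_mult_right int)
    moreover have "integrable torus (rhs t)"
      unfolding rhs_eq[abs_def] by (intro Bochner_Integration.integrable_add[OF
        integrable_mult_right[OF int(1)] int(3)])
    moreover have "(LINT x|torus. deriv (\<lambda>s. \<eta>r s x) t) = (LINT x|torus. rhs t x)"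
      unfolding deriv_eq rhs_eq
      using Bochner_Integration.integral_add[OF integrable_mult_right[OF int(1), of "- 1 / \<tau>"] int(2)]
        Bochner_Integration.integral_add[OF integrable_mult_right[OF int(1), of "- 1 / \<tau>"] int(3)] id(3)
      by presburger
    ultimately show ?thesis by simp
  qed
  show ?thesis
    using AE_between_grid_points[OF \<tau>, of T]
  proof eventually_elim
    case (elim t)
    then obtain n where "0 < t" "t < T" "real n * \<tau> < t" "t < real (Suc n) * \<tau>" by blast
    then show ?case by (rule main)
  qed
qed

end
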